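(* Let $\mathcal{C}$ be either the category $\mathcal{LRF}$ of labeled rooted forests or the category $\mathcal{LFG}$ of labeled Feynman graphs. For every $M\in\mathrm{Iso}(\mathcal{C})$, the subspace $\mathrm{H}_{quot(M)}\subset\mathrm{H}^*_{\mathcal{C}}$ is a finite-dimensional representation of $\mathfrak{n}_{\mathcal{C}}$ with respect to the elimination action $$X_A\cdot\phi_B=-\sum_{N\subset B,\ N\simeq A}\phi_{B/N}.$$
   Context: **Category $\mathcal{LRF}$.** Fix an infinite label set $S$. A labeled rooted tree is a finite tree $T$ with a distinguished root and an injection $V(T)\hookrightarrow S$; a labeled rooted forest is a finite set of labeled rooted trees with pairwise disjoint label sets. An admissible cut of a tree $T$ is a subset of $E(T)$ containing at most one edge on any path from a leaf to the root; removing the cut edges gives a forest $P_C(T)$ (the components not containing the root) and a tree $R_C(T)$ (the component containing the root). The empty cut $C_{null}$ (with $P=\emptyset$, $R=T$) and the formal full cut $C_{full}$ (with $P=T$, $R=\emptyset$) are admissible. A cut $C$ of a forest $F$ is a choice of cut of each tree, with $P_C(F)$, $R_C(F)$ the unions of the corresponding parts. Isomorphisms of forests are bijections of trees and of their vertices preserving roots and incidences (labels are ignored). Objects are labeled rooted forests and the empty forest $\emptyset$ (zero object); $\mathrm{Hom}(F_1,F_2)$ is the set of triples $(C_1,C_2,f)$ with $C_i$ an admissible cut of $F_i$ and $f:R_{C_1}(F_1)\cong P_{C_2}(F_2)$. A subobject of $F$ is $N=P_C(F)$ for an admissible cut $C$, with quotient $F/N=R_C(F)$; different cuts give different subobjects.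 **Category $\mathcal{LFG}$ ($\phi^3$ theory).** A graph has half-edges $H$ and vertices $V$; each half-edge is adjacent to exactly one vertex and at most one other half-edge. Half-edges not adjacent to another half-edge are external edges; pairs of adjacent half-edges are internal edges. A Feynman graph is a (possibly disconnected) graph in which each vertex has exactly three half-edges, and each connected component has 2 or 3 external edges and at least one loop. A labeled Feynman graph has its half-edges labeled bijectively by a set. Isomorphisms are bijections of vertices and half-edges preserving incidences (labels are ignored). A subgraph $\gamma\subset\Gamma$ is a Feynman graph with $V(\gamma)\subset V(\Gamma)$, $H(\gamma)\subset H(\Gamma)$, containing all half-edges at its vertices, with incidences inherited from $\Gamma$. For $\gamma$ connected, $\Gamma/\gamma$ is obtained as follows: if $\gamma$ has 3 external edges, replace $\gamma$ by a single new trivalent vertex to which the external half-edges of $\gamma$ are attached; if $\gamma$ has 2 external edges, delete all vertices and half-edges of $\gamma$ and join the half-edges to which its two external half-edges were joined. For general $\gamma$ take successive quotients by components. The quotient of a connected component by itself is empty; in particular $\Gamma/\Gamma=\emptyset$. Objects are labeled Feynman graphs and the empty graph $\emptyset$ (zero object); $\mathrm{Hom}(\Gamma_1,\Gamma_2)$ is the set of triples $(\gamma_1,\gamma_2,f)$ with $\gamma_i\subset\Gamma_i$ subgraphs (possibly $\emptyset$ or $\Gamma_i$) and $f:\Gamma_1/\gamma_1\cong\gamma_2$. Subobjects of $\Gamma$ are its subgraphs $\gamma$ (including $\emptyset$, $\Gamma$), with quotient $\Gamma/\gamma$. **Known facts on $\mathcal{C}$.** $\oplus$ denotes disjoint union.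 For $A\subset B$ there is an inclusion-preserving bijection between subobjects $S$ of $B$ containing $A$ and subobjects $\overline S$ of $B/A$, with $(B/A)/\overline S\cong B/S$. An object is decomposable if it is of the form $A\oplus B$ with $A,B\ne\emptyset$, and indecomposable otherwise. **Hall algebra.** $\mathrm{Iso}(\mathcal{C})$ is the set of isomorphism classes. $\mathrm{H}_{\mathcal{C}}$ is the $\mathbb{Q}$-vector space of finitely supported functions $\mathrm{Iso}(\mathcal{C})\to\mathbb{Q}$, with basis of delta functions $\delta_A$, product $(f\times g)(M)=\sum_{N\subset M}f(N)g(M/N)$ (sum over subobjects of a representative of $M$) and coproduct $\Delta(f)(M,N)=f(M\oplus N)$. It is a cocommutative Hopf algebra, isomorphic to $U(\mathfrak{n}_{\mathcal{C}})$, where $\mathfrak{n}_{\mathcal{C}}$ is its Lie algebra of primitive elements, with basis the $X_A:=\delta_A$ for $A$ nonempty indecomposable. $\mathrm{H}^*_{\mathcal{C}}$ is the restricted dual, with basis $\{\phi_A\}$ dual to $\{\delta_A\}$. **Action and subspace.** The elimination action is the left action of $\mathfrak{n}_{\mathcal{C}}$ on $\mathrm{H}^*_{\mathcal{C}}$ given by the formula in the claim for $X_A\in\mathfrak{n}_{\mathcal{C}}$ and $B\in\mathrm{Iso}(\mathcal{C})$, the sum running over subobjects $N$ of a representative of $B$ that are isomorphic to $A$. For $M\in\mathrm{Iso}(\mathcal{C})$, $Quot(M)$ is the set of $E\in\mathrm{Iso}(\mathcal{C})$ that are quotients $M/K$ of $M$ ($K\subset M$ a subobject), and $\mathrm{H}_{quot(M)}$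 is the span of $\{\phi_E : E\in Quot(M)\}$ in $\mathrm{H}^*_{\mathcal{C}}$.
   Formalization: For Feynman graphs the compatibility with the Lie bracket is asserted only for one-particle irreducible graphs and subgraphs; for all labeled Feynman graphs, where B/N may have no loop and the bracket identity fails, only finite dimension and stability under the action (such terms 0) are claimed. *)

theory Defs
  imports Complex_Main "HOL-Library.Infinite_Typeclass" "HOL-Library.Function_Algebras"
    "HOL-Library.Disjoint_Sets"
begin

section \<open>Hall algebra and elimination action\<close>

text \<open>
  Only the following part of the categories enters: the objects, isomorphism, the zero object,
  the disjoint union (of objects with disjoint labels), and the subobjects of an object together
  with the quotients by them. A subobject is given by a datum \<open>u \<in> Sub C A\<close> (a cut, or a subgraph),
  with underlying object \<open>sub_obj C A u\<close> and quotient \<open>quot_obj C A u\<close>.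
\<close>

record ('o, 'u) hall_cat =
  Obj :: "'o set"
  isom :: "'o \<Rightarrow> 'o \<Rightarrow> bool"
  zero_obj :: 'o
  disj_labels :: "'o \<Rightarrow> 'o \<Rightarrow> bool"
  disj_union :: "'o \<Rightarrow> 'o \<Rightarrow> 'o"
  Sub :: "'o \<Rightarrow> 'u set"
  sub_obj :: "'o \<Rightarrow> 'u \<Rightarrow> 'o"
  quot_obj :: "'o \<Rightarrow> 'u \<Rightarrow> 'o"

definition cls :: "('o, 'u) hall_cat \<Rightarrow> 'o \<Rightarrow> 'o set" where
  "cls C A = {B \<in> Obj C. isom C A B}"

definition Iso :: "('o, 'u) hall_cat \<Rightarrow> 'o set set" where
  "Iso C = cls C ` Obj C"

definition rep :: "'o set \<Rightarrow> 'o" where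
  "rep M = (SOME A. A \<in> M)"

definition oplus :: "('o, 'u) hall_cat \<Rightarrow> 'o set \<Rightarrow> 'o set \<Rightarrow> 'o set" where
  "oplus C M N =
     (let (A, B) = (SOME (A, B). A \<in> M \<and> B \<in> N \<and> disj_labels C A B)
      in cls C (disj_union C A B))"

text \<open>The isomorphism classes of nonempty indecomposable objects.\<close>

definition Indec :: "('o, 'u) hall_cat \<Rightarrow> 'o set set" where
  "Indec C = {A \<in> Iso C. A \<noteq> cls C (zero_obj C) \<and>
     \<not> (\<exists>M\<in>Iso C. \<exists>N\<in>Iso C.
          M \<noteq> cls C (zero_obj C) \<and> N \<noteq> cls C (zero_obj C) \<and> A = oplus C M N)}"

definition Hall :: "('o, 'u) hall_cat \<Rightarrow> ('o set \<Rightarrow> rat) set" where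
  "Hall C = {f. finite {M. f M \<noteq> 0} \<and> {M. f M \<noteq> 0} \<subseteq> Iso C}"

definition delta :: "'o set \<Rightarrow> 'o set \<Rightarrow> rat" where
  "delta A = (\<lambda>M. if M = A then 1 else 0)"

definition hall_mult ::
  "('o, 'u) hall_cat \<Rightarrow> ('o set \<Rightarrow> rat) \<Rightarrow> ('o set \<Rightarrow> rat) \<Rightarrow> 'o set \<Rightarrow> rat" where
  "hall_mult C f g = (\<lambda>M. if M \<in> Iso C
     then \<Sum>u \<in> Sub C (rep M). f (cls C (sub_obj C (rep M) u)) * g (cls C (quot_obj C (rep M) u))
     else 0)"

definition hall_comult :: "('o, 'u) hall_cat \<Rightarrow> ('o set \<Rightarrow> rat) \<Rightarrow> 'o set \<Rightarrow> 'o set \<Rightarrow> rat" where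
  "hall_comult C f M N = f (oplus C M N)"

definition hall_bracket ::
  "('o, 'u) hall_cat \<Rightarrow> ('o set \<Rightarrow> rat) \<Rightarrow> ('o set \<Rightarrow> rat) \<Rightarrow> 'o set \<Rightarrow> rat" where
  "hall_bracket C f g = hall_mult C f g - hall_mult C g f"

text \<open>
  The primitive elements, \<open>\<Delta> f = f \<otimes> 1 + 1 \<otimes> f\<close>; the unit of the Hall algebra is the delta
  function of the zero object.
\<close>

definition primitives :: "('o, 'u) hall_cat \<Rightarrow> ('o set \<Rightarrow> rat) set" where
  "primitives C = {f \<in> Hall C. \<forall>M\<in>Iso C. \<forall>N\<in>Iso C.
     hall_comult C f M N =
       f M * delta (cls C (zero_obj C)) N + delta (cls C (zero_obj C)) M * f N}"

definition scale :: "rat \<Rightarrow> ('x \<Rightarrow> rat) \<Rightarrow> 'x \<Rightarrow> rat" where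
  "scale c f = (\<lambda>x. c * f x)"

global_interpretation fun_space: vector_space "scale :: rat \<Rightarrow> ('x \<Rightarrow> rat) \<Rightarrow> 'x \<Rightarrow> rat"
  by unfold_locales (auto simp: scale_def fun_eq_iff algebra_simps)

text \<open>
  Linear functionals on the Hall algebra are extended by zero outside of it. In particular
  \<open>phi C A = 0\<close> if \<open>A\<close> is not in \<open>Iso C\<close>.
\<close>

definition phi :: "('o, 'u) hall_cat \<Rightarrow> 'o set \<Rightarrow> ('o set \<Rightarrow> rat) \<Rightarrow> rat" where
  "phi C A = (\<lambda>f. if f \<in> Hall C then f A else 0)"

definition Hall_dual :: "('o, 'u) hall_cat \<Rightarrow> (('o set \<Rightarrow> rat) \<Rightarrow> rat) set" where
  "Hall_dual C = fun_space.span (phi C ` Iso C)"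

definition elim :: "('o, 'u) hall_cat \<Rightarrow> 'o set \<Rightarrow> 'o set \<Rightarrow> ('o set \<Rightarrow> rat) \<Rightarrow> rat" where
  "elim C A B =
     - (\<Sum>u \<in> {u \<in> Sub C (rep B). cls C (sub_obj C (rep B) u) = A}. phi C (cls C (quot_obj C (rep B) u)))"

text \<open>
  The bilinear extension of \<open>elim\<close>. An element \<open>X\<close> of the Lie algebra is
  \<open>\<Sum>A \<in> Indec C. X A \<cdot> delta A\<close>, and an element \<open>\<psi>\<close> of the restricted dual is
  \<open>\<Sum>B \<in> Iso C. \<psi> (delta B) \<cdot> phi C B\<close>.
\<close>

definition act ::
  "('o, 'u) hall_cat \<Rightarrow> ('o set \<Rightarrow> rat) \<Rightarrow> (('o set \<Rightarrow> rat) \<Rightarrow> rat) \<Rightarrow> ('o set \<Rightarrow> rat) \<Rightarrow> rat" where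
  "act C X \<psi> =
     (\<Sum>A \<in> {A \<in> Indec C. X A \<noteq> 0}. \<Sum>B \<in> {B \<in> Iso C. \<psi> (delta B) \<noteq> 0}.
        scale (X A * \<psi> (delta B)) (elim C A B))"

lemma delta_apply: "delta A M = (if M = A then 1 else 0)"
  by (simp add: delta_def)

lemma delta_in_Hall: "B \<in> Iso C \<Longrightarrow> delta B \<in> Hall C"
  by (simp add: Hall_def delta_apply)

lemma act_delta_phi:
  assumes "A \<in> Indec C" "B \<in> Iso C"
  shows "act C (delta A) (phi C B) = elim C A B"
proof -
  have "{A' \<in> Indec C. delta A A' \<noteq> 0} = {A}"
    using assms(1) by (auto simp: delta_apply)
  moreover have "{B' \<in> Iso C. phi C B (delta B') \<noteq> 0} = {B}"
    using assms(2) by (auto simp: phi_def delta_in_Hall delta_apply)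
  moreover have "phi C B (delta B) = 1"
    using assms(2) by (simp add: phi_def delta_in_Hall delta_apply)
  ultimately show ?thesis
    by (simp add: act_def delta_apply)
qed

definition Quot :: "('o, 'u) hall_cat \<Rightarrow> 'o set \<Rightarrow> 'o set set" where
  "Quot C M = {E \<in> Iso C. \<exists>u \<in> Sub C (rep M). E = cls C (quot_obj C (rep M) u)}"

definition H_quot :: "('o, 'u) hall_cat \<Rightarrow> 'o set \<Rightarrow> (('o set \<Rightarrow> rat) \<Rightarrow> rat) set" where
  "H_quot C M = fun_space.span (phi C ` Quot C M)"

definition finite_dim :: "('x \<Rightarrow> rat) set \<Rightarrow> bool" where
  "finite_dim W \<longleftrightarrow> (\<exists>B. finite B \<and> fun_space.independent B \<and> fun_space.span B = W)"

definition acts_on :: "('o, 'u) hall_cat \<Rightarrow> (('o set \<Rightarrow> rat) \<Rightarrow> rat) set \<Rightarrow> bool" where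
  "acts_on C W \<longleftrightarrow>
     fun_space.subspace W \<and> W \<subseteq> Hall_dual C \<and>
     (\<forall>X\<in>primitives C. \<forall>\<psi>\<in>W. act C X \<psi> \<in> W) \<and>
     (\<forall>X\<in>primitives C. \<forall>Y\<in>primitives C. \<forall>\<psi>\<in>W. act C (X + Y) \<psi> = act C X \<psi> + act C Y \<psi>) \<and>
     (\<forall>c. \<forall>X\<in>primitives C. \<forall>\<psi>\<in>W. act C (scale c X) \<psi> = scale c (act C X \<psi>)) \<and>
     (\<forall>X\<in>primitives C. \<forall>\<psi>\<in>W. \<forall>\<chi>\<in>W. act C X (\<psi> + \<chi>) = act C X \<psi> + act C X \<chi>) \<and>
     (\<forall>c. \<forall>X\<in>primitives C. \<forall>\<psi>\<in>W. act C X (scale c \<psi>) = scale c (act C X \<psi>))"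

definition lie_representation :: "('o, 'u) hall_cat \<Rightarrow> (('o set \<Rightarrow> rat) \<Rightarrow> rat) set \<Rightarrow> bool" where
  "lie_representation C W \<longleftrightarrow> acts_on C W \<and>
     (\<forall>X\<in>primitives C. \<forall>Y\<in>primitives C. \<forall>\<psi>\<in>W.
        act C (hall_bracket C X Y) \<psi> = act C X (act C Y \<psi>) - act C Y (act C X \<psi>))"


section \<open>Labeled rooted forests\<close>

text \<open>
  Vertices are identified with their labels. Edges are oriented towards the roots:
  \<open>(x, y) \<in> fedges F\<close> means that \<open>y\<close> is the parent of \<open>x\<close>. The trees of a forest are its
  connected components.
\<close>

datatype 's forest = Forest (fverts: "'s set") (fedges: "('s \<times> 's) set")

definition forest :: "'s forest \<Rightarrow> bool" where
  "forest F \<longleftrightarrow> finite (fverts F) \<and> fedges F \<subseteq> fverts F \<times> fverts F \<and>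
     single_valued (fedges F) \<and> acyclic (fedges F)"

definition froots :: "'s forest \<Rightarrow> 's set" where
  "froots F = {x \<in> fverts F. \<forall>y. (x, y) \<notin> fedges F}"

definition fleaves :: "'s forest \<Rightarrow> 's set" where
  "fleaves F = {x \<in> fverts F. \<forall>y. (y, x) \<notin> fedges F}"

text \<open>The edges on the path from a vertex to the root of its tree.\<close>

definition root_path :: "'s forest \<Rightarrow> 's \<Rightarrow> ('s \<times> 's) set" where
  "root_path F x = {(u, v) \<in> fedges F. (x, u) \<in> (fedges F)\<^sup>*}"

definition forest_iso :: "'s forest \<Rightarrow> 's forest \<Rightarrow> bool" where
  "forest_iso F G \<longleftrightarrow> (\<exists>f. bij_betw f (fverts F) (fverts G) \<and>
     (\<forall>x\<in>fverts F. \<forall>y\<in>fverts F. (x, y) \<in> fedges F \<longleftrightarrow> (f x, f y) \<in> fedges G))"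

text \<open>
  A cut \<open>(E, Z)\<close> of a forest consists of the set \<open>E\<close> of cut edges and the set \<open>Z\<close> of the roots of
  those trees on which the cut is the formal full cut; these contain no cut edges.
\<close>

type_synonym 's cut = "('s \<times> 's) set \<times> 's set"

definition cuts :: "'s forest \<Rightarrow> 's cut set" where
  "cuts F = {(E, Z). E \<subseteq> fedges F \<and> Z \<subseteq> froots F \<and>
     (\<forall>x\<in>fleaves F. \<forall>e\<in>E \<inter> root_path F x. \<forall>e'\<in>E \<inter> root_path F x. e = e') \<and>
     (\<forall>(u, v)\<in>E. \<forall>z\<in>Z. (v, z) \<notin> (fedges F)\<^sup>*)}"

text \<open>The vertices that remain connected to the root of a tree that is not fully cut.\<close>

definition root_part :: "'s forest \<Rightarrow> 's cut \<Rightarrow> 's set" where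
  "root_part F = (\<lambda>(E, Z). {x \<in> fverts F. \<exists>r \<in> froots F - Z. (x, r) \<in> (fedges F - E)\<^sup>*})"

definition cut_R :: "'s forest \<Rightarrow> 's cut \<Rightarrow> 's forest" where
  "cut_R F c = (let W = root_part F c in Forest W ((fedges F - fst c) \<inter> W \<times> W))"

definition cut_P :: "'s forest \<Rightarrow> 's cut \<Rightarrow> 's forest" where
  "cut_P F c = (let W = fverts F - root_part F c in Forest W ((fedges F - fst c) \<inter> W \<times> W))"

definition LRF :: "('s::infinite forest, 's cut) hall_cat" where
  "LRF = \<lparr>
     Obj = {F. forest F},
     isom = forest_iso,
     zero_obj = Forest {} {},
     disj_labels = (\<lambda>F G. fverts F \<inter> fverts G = {}),
     disj_union = (\<lambda>F G. Forest (fverts F \<union> fverts G) (fedges F \<union> fedges G)),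
     Sub = cuts,
     sub_obj = cut_P,
     quot_obj = cut_R\<rparr>"


section \<open>Labeled Feynman graphs\<close>

text \<open>
  Half-edges are identified with their labels. A vertex is identified with the set of the
  half-edges adjacent to it, and \<open>joins\<close> consists of the pairs of adjacent half-edges, that is,
  the internal edges.
\<close>

datatype 's graph = Graph (half: "'s set") (verts: "'s set set") (joins: "'s set set")

definition graph :: "'s graph \<Rightarrow> bool" where
  "graph G \<longleftrightarrow> finite (half G) \<and> partition_on (half G) (verts G) \<and>
     (\<forall>e\<in>joins G. e \<subseteq> half G \<and> card e = 2) \<and> disjoint (joins G)"

definition ext :: "'s graph \<Rightarrow> 's set" where
  "ext G = half G - \<Union> (joins G)"

text \<open>The connected components, given by their sets of half-edges.\<close>

definition comps :: "'s graph \<Rightarrow> 's set set" where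
  "comps G = half G // {(x, y). \<exists>s \<in> verts G \<union> joins G. x \<in> s \<and> y \<in> s}\<^sup>*"

definition loop_number :: "'s graph \<Rightarrow> 's set \<Rightarrow> int" where
  "loop_number G K = int (card {e \<in> joins G. e \<subseteq> K}) - int (card {v \<in> verts G. v \<subseteq> K}) + 1"

definition feynman :: "'s graph \<Rightarrow> bool" where
  "feynman G \<longleftrightarrow> graph G \<and> (\<forall>v\<in>verts G. card v = 3) \<and>
     (\<forall>K\<in>comps G. card (ext G \<inter> K) \<in> {2, 3} \<and> loop_number G K \<ge> 1)"

text \<open>One-particle irreducibility: no component falls apart when an internal edge is removed.\<close>

definition one_PI :: "'s graph \<Rightarrow> bool" where
  "one_PI G \<longleftrightarrow> (\<forall>e\<in>joins G. comps (Graph (half G) (verts G) (joins G - {e})) = comps G)"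

definition graph_iso :: "'s graph \<Rightarrow> 's graph \<Rightarrow> bool" where
  "graph_iso G H \<longleftrightarrow> (\<exists>f. bij_betw f (half G) (half H) \<and>
     (`) f ` verts G = verts H \<and> (`) f ` joins G = joins H)"

text \<open>
  By the encoding of vertices, a subgraph contains all half-edges at its vertices. Half-edges
  that are adjacent in the subgraph are adjacent in the graph, but not conversely: the components
  of a subgraph may be joined to each other in the graph by their external edges. (Otherwise,
  contracting a subgraph and then another one next to it would not be contracting a subgraph.)
\<close>

definition subgraph :: "'s graph \<Rightarrow> 's graph \<Rightarrow> bool" where
  "subgraph g G \<longleftrightarrow> feynman g \<and> half g \<subseteq> half G \<and> verts g \<subseteq> verts G \<and> joins g \<subseteq> joins G"

text \<open>
  The quotient by all components of \<open>g\<close> at once. The new vertex that replaces a component with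
  three external edges is the set of these edges; a component of \<open>g\<close> that is also a component of
  \<open>G\<close> disappears. A pair \<open>(h, k)\<close> in \<open>bypass\<close> means passing from an external edge \<open>h\<close> of a
  component with two external edges to the half-edge \<open>k\<close> to which the other one is joined. This is
  iterated since several such components may follow each other.
\<close>

definition new_verts :: "'s graph \<Rightarrow> 's graph \<Rightarrow> 's set set" where
  "new_verts G g = {ext g \<inter> K | K. K \<in> comps g - comps G \<and> card (ext g \<inter> K) = 3}"

definition bypass :: "'s graph \<Rightarrow> 's graph \<Rightarrow> ('s \<times> 's) set" where
  "bypass G g = {(h, k). \<exists>h'. \<exists>K\<in>comps g. ext g \<inter> K = {h, h'} \<and> h \<noteq> h' \<and> {h', k} \<in> joins G}"

definition quotient_graph :: "'s graph \<Rightarrow> 's graph \<Rightarrow> 's graph" where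
  "quotient_graph G g =
     (let H = (half G - half g) \<union> \<Union> (new_verts G g) in
      Graph H ((verts G - verts g) \<union> new_verts G g)
        {{x, y} | x y. x \<in> H \<and> y \<in> H \<and> (\<exists>h. {x, h} \<in> joins G \<and> (h, y) \<in> (bypass G g)\<^sup>*)})"

text \<open>
  The parameter \<open>Q\<close> selects a class of Feynman graphs. Without restriction on the graphs,
  \<open>quotient_graph G g\<close> need not be an object, since it may have components without a loop (delete
  a component with two external edges attached to a leg of a vertex); then
  \<open>cls C (quotient_graph G g)\<close> is empty and \<open>phi C {} = 0\<close>.
\<close>

definition LFG_class :: "('s::infinite graph \<Rightarrow> bool) \<Rightarrow> ('s graph, 's graph) hall_cat" where
  "LFG_class Q = \<lparr>
     Obj = {G. feynman G \<and> Q G},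
     isom = graph_iso,
     zero_obj = Graph {} {} {},
     disj_labels = (\<lambda>G H. half G \<inter> half H = {}),
     disj_union = (\<lambda>G H. Graph (half G \<union> half H) (verts G \<union> verts H) (joins G \<union> joins H)),
     Sub = (\<lambda>G. {g. subgraph g G \<and> Q g}),
     sub_obj = (\<lambda>G g. g),
     quot_obj = quotient_graph\<rparr>"

definition LFG :: "('s::infinite graph, 's graph) hall_cat" where
  "LFG = LFG_class (\<lambda>_. True)"

text \<open>
  For \<open>LFG\<close> the elimination operators do not respect the bracket: let a graph \<open>L\<close> arise by joining
  a leg of the two-vertex bubble \<open>N\<close> to a leg of the triangle \<open>N'\<close>. Then \<open>L / N\<close> is \<open>N'\<close>, so that
  \<open>L\<close> occurs in \<open>[delta N, delta N']\<close>, but inside a larger graph \<open>N\<close> and \<open>N'\<close> may be contracted in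
  either order with the same result as contracting \<open>L\<close>. The graph \<open>L\<close> is not one-particle
  irreducible. The one-particle irreducible graphs are closed under quotients, and for them the
  subobjects of a quotient \<open>B/A\<close> correspond to the subobjects of \<open>B\<close> that contain \<open>A\<close>.
\<close>

definition LFG_1PI :: "('s::infinite graph, 's graph) hall_cat" where
  "LFG_1PI = LFG_class one_PI"

end

theory Submission
  imports Defs
begin

text \<open>
  Let \<open>e f\<close> be the operator that sends \<open>phi B\<close> to the sum of \<open>f (N) phi (B / N)\<close> over the subobjects
  \<open>N\<close> of \<open>B\<close>, so that \<open>f\<close> acts as \<open>- e f\<close>. A quotient of a quotient of \<open>M\<close> is a quotient of \<open>M\<close>, which
  makes the span of the quotients invariant. Since the subobjects of \<open>B / N\<close> correspond to the
  subobjects of \<open>B\<close> that contain \<open>N\<close>, the composition of \<open>e g\<close> after \<open>e f\<close> is \<open>e (f \<times> g)\<close>, and the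
  bracket relation follows once the commutator of two primitive elements is seen to be supported
  on indecomposable objects: on a union of \<open>A\<close> and \<open>B\<close> both products have the value
  \<open>X (A) Y (B) + X (B) Y (A)\<close>.

  For forests the subobjects are the sets of vertices that are closed under descendants, and all
  of this is plain. For Feynman graphs the joins of \<open>A / u\<close> are the paths that alternate between two
  matchings: the joins of \<open>A\<close> outside of \<open>u\<close>, and the pairs of external edges of the components of
  \<open>u\<close> with two external edges. The preimage of a subgraph \<open>v\<close> of \<open>A / u\<close> consists of \<open>u\<close>, the old
  vertices of \<open>v\<close> and all joins of \<open>A\<close> on the paths that are joins of \<open>v\<close>. It is unique if no path leads
  from a leg of the larger subgraph into \<open>u\<close>, and one-particle irreducibility excludes such paths.
\<close>

section \<open>Subgraphs and quotients of graphs\<close>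

subsection \<open>Two matchings\<close>

text \<open>\<open>quotient_graph\<close> describes joins by directed walks through
  \<open>bypass\<close>, which are awkward to compose. Read as classes of the equivalence relation
  generated by two matchings, strings become symmetric, and contracting twice only means regrouping
  the generating pairs. Direction is needed only for the facts on ends: a string has at most two of
  them. That a second end exists is a matter of parity.

  The obstacle is a component of \<open>u\<close> with two legs, one of which is a leg of
  \<open>A\<close>: contracting it moves a leg of \<open>A\<close>, and the quotient may stop being
  a Feynman graph. The predicate \<open>good\<close> excludes this. It follows from one-particle
  irreducibility, but it also holds for \<open>u\<close> inside every preimage, so
  \<open>(A / u) / v\<close> and \<open>A / w\<close> can be compared for all Feynman graphs, up to
  the components that are deleted altogether.

  Invariance of the span needs only some \<open>w\<close> with the right quotient, whereas the
  bracket needs a bijection between towers. Hence there are two abstract settings: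
  \<open>hall_category\<close> with a bare existence statement, which \<open>LFG\<close> satisfies,
  and \<open>hall_lie_category\<close> with the bijection.\<close>

definition linked :: "'s set set \<Rightarrow> ('s \<times> 's) set" where
  "linked S = {(x, y). \<exists>s\<in>S. x \<in> s \<and> y \<in> s}\<^sup>*"

lemma linked_refl [simp]: "(x, x) \<in> linked S"
  by (simp add: linked_def)

lemma linked_in: "s \<in> S \<Longrightarrow> x \<in> s \<Longrightarrow> y \<in> s \<Longrightarrow> (x, y) \<in> linked S"
  by (auto simp: linked_def)

lemma linked_trans: "(x, y) \<in> linked S \<Longrightarrow> (y, z) \<in> linked S \<Longrightarrow> (x, z) \<in> linked S"
  by (auto simp: linked_def)

lemma linked_sym: "(x, y) \<in> linked S \<Longrightarrow> (y, x) \<in> linked S"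
  unfolding linked_def by (rule symD[OF sym_rtrancl]) (auto intro: symI)

lemma linked_induct [consumes 1, case_names base step]:
  assumes "(x, y) \<in> linked S" "P x"
    "\<And>y z s. (x, y) \<in> linked S \<Longrightarrow> s \<in> S \<Longrightarrow> y \<in> s \<Longrightarrow> z \<in> s \<Longrightarrow> P y \<Longrightarrow> P z"
  shows "P y"
  using assms(1) unfolding linked_def
proof (induction rule: rtrancl_induct)
  case base
  show ?case by (fact assms(2))
next
  case (step y z)
  then show ?case using assms(3)[of y _ z] unfolding linked_def by blast
qed

lemma linked_least:
  assumes "\<And>s x y. s \<in> S \<Longrightarrow> x \<in> s \<Longrightarrow> y \<in> s \<Longrightarrow> (x, y) \<in> linked S'"
  shows "linked S \<subseteq> linked S'"
proof clarify
  fix x y assume "(x, y) \<in> linked S"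
  then show "(x, y) \<in> linked S'"
    by (induction rule: linked_induct) (auto intro: linked_trans assms)
qed

lemma linked_mono: "S \<subseteq> S' \<Longrightarrow> linked S \<subseteq> linked S'"
  by (rule linked_least) (auto intro: linked_in)

text \<open>Serves to find the cell through which a string leaves its starting point.\<close>

lemma linked_neq:
  assumes "(x, y) \<in> linked S" "x \<noteq> y"
  obtains s z where "s \<in> S" "x \<in> s" "z \<in> s" "z \<noteq> x"
proof -
  have "(x, y) \<in> linked S \<Longrightarrow> x = y \<or> (\<exists>s\<in>S. \<exists>z\<in>s. x \<in> s \<and> z \<noteq> x)"
    by (induction rule: linked_induct) auto
  then show ?thesis using assms that by blast
qed

lemma linked_closed:
  assumes "(x, y) \<in> linked S" "x \<in> X" "\<And>s. s \<in> S \<Longrightarrow> s \<inter> X \<noteq> {} \<Longrightarrow> s \<subseteq> X"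
  shows "y \<in> X"
  using assms(1,2) by (induction rule: linked_induct) (use assms(3) in blast)+

section \<open>Matchings and the strings formed by two of them\<close>

definition matching :: "'s set set \<Rightarrow> bool" where
  "matching M \<longleftrightarrow> (\<forall>e\<in>M. card e = 2) \<and> disjoint M"

lemma matching_unique: "matching M \<Longrightarrow> e \<in> M \<Longrightarrow> e' \<in> M \<Longrightarrow> x \<in> e \<Longrightarrow> x \<in> e' \<Longrightarrow> e = e'"
  unfolding matching_def by (metis disjointD disjoint_iff)

lemma matching_partner:
  assumes "matching M" "e \<in> M" "x \<in> e"
  obtains y where "e = {x, y}" "x \<noteq> y"
proof -
  have "card e = 2" using assms(1,2) by (simp add: matching_def)
  then obtain a b where "e = {a, b}" "a \<noteq> b" by (auto simp: card_2_iff)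
  then show ?thesis using that[of a] that[of b] assms(3) by (auto simp: insert_commute)
qed

lemma matching_inj: "matching M \<Longrightarrow> {x, y} \<in> M \<Longrightarrow> {x, z} \<in> M \<Longrightarrow> y = z"
  using matching_unique[of M "{x, y}" "{x, z}" x] by (auto simp: doubleton_eq_iff)

lemma matching_irrefl: "matching M \<Longrightarrow> {x, y} \<in> M \<Longrightarrow> x \<noteq> y"
  unfolding matching_def by force

lemma matching_subset: "matching M \<Longrightarrow> M' \<subseteq> M \<Longrightarrow> matching M'"
  unfolding matching_def by (meson disjoint_def subset_iff)

text \<open>The members of \<open>M\<close> inside \<open>Z\<close> split \<open>Z\<close> into
  pairs.\<close>

lemma even_matching:
  assumes "matching M" "finite Z" "Z \<subseteq> \<Union>M" "\<And>e. e \<in> M \<Longrightarrow> e \<inter> Z \<noteq> {} \<Longrightarrow> e \<subseteq> Z"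
  shows "even (card Z)"
proof -
  let ?M = "{e \<in> M. e \<subseteq> Z}"
  have "\<Union>?M = Z"
  proof
    show "Z \<subseteq> \<Union>?M"
    proof
      fix z assume "z \<in> Z"
      then obtain e where "e \<in> M" "z \<in> e" using assms(3) by auto
      with \<open>z \<in> Z\<close> show "z \<in> \<Union>?M" using assms(4)[of e] by auto
    qed
  qed auto
  moreover have "card (\<Union>?M) = sum card ?M"
  proof (rule card_Union_disjoint)
    show "pairwise disjnt ?M"
      using assms(1) unfolding matching_def disjoint_def pairwise_def disjnt_def by blast
    show "finite A" if "A \<in> ?M" for A
      using that assms(2) by (auto intro: finite_subset)
  qed
  moreover have "sum card ?M = sum (\<lambda>_. 2) ?M"
    by (rule sum.cong) (use assms(1) in \<open>auto simp: matching_def\<close>)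
  ultimately show ?thesis by simp
qed

text \<open>The abstract form of \<open>bypass\<close>: \<open>M1\<close> plays the part of the
  joins, \<open>M2\<close> that of the pairs of legs of components with two legs.\<close>

definition byp :: "'s set set \<Rightarrow> 's set set \<Rightarrow> ('s \<times> 's) set" where
  "byp M1 M2 = {(h, k). \<exists>h'. {h, h'} \<in> M2 \<and> {h', k} \<in> M1}"

locale two_matchings =
  fixes M1 M2 :: "'s set set"
  assumes m1: "matching M1" and m2: "matching M2"
begin

lemma byp_single_valued: "(h, k) \<in> byp M1 M2 \<Longrightarrow> (h, k') \<in> byp M1 M2 \<Longrightarrow> k = k'"
  unfolding byp_def using matching_inj[OF m1] matching_inj[OF m2] by blast

text \<open>A closed alternating walk would begin and end with the same pair of \<open>M1\<close>.
  Stripping it at both ends, together with the adjacent pairs of \<open>M2\<close>, leaves a closed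
  walk that is shorter by two. For the lengths 0 and 1 some pair would degenerate to a
  singleton.\<close>

lemma no_return: "{x, h} \<in> M1 \<Longrightarrow> (h, x) \<in> byp M1 M2 ^^ n \<Longrightarrow> False"
proof (induction n arbitrary: x h rule: less_induct)
  case (less n)
  consider "n = 0" | "n = 1" | m where "n = Suc (Suc m)"
    by (metis One_nat_def not0_implies_Suc)
  then show ?case
  proof cases
    case 1
    then show ?thesis using less.prems matching_irrefl[OF m1] by force
  next
    case 2
    then obtain h' where "{h, h'} \<in> M2" "{h', x} \<in> M1" using less.prems(2) by (auto simp: byp_def)
    moreover from this have "h' = h"
      using matching_inj[OF m1, of x h' h] less.prems(1) by (simp add: insert_commute)
    ultimately show ?thesis using matching_irrefl[OF m2] by blast
  next
    case (3 m)
    then obtain k l where k: "(h, k) \<in> byp M1 M2" "(k, l) \<in> byp M1 M2 ^^ m" "(l, x) \<in> byp M1 M2"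
      using less.prems(2) by (metis relpow_Suc_D2 relpow_Suc_E)
    obtain h' where h': "{h, h'} \<in> M2" "{h', k} \<in> M1" using k(1) by (auto simp: byp_def)
    obtain l' where l': "{l, l'} \<in> M2" "{l', x} \<in> M1" using k(3) by (auto simp: byp_def)
    have "l' = h"
      using matching_inj[OF m1, of x l' h] less.prems(1) l'(2) by (simp add: insert_commute)
    with l' h' have "l = h'"
      using matching_inj[OF m2, of h l h'] by (simp add: insert_commute)
    then show ?thesis using less.IH[of m h' k] h'(2) k(2) 3 by auto
  qed
qed

text \<open>A point outside the pairs of \<open>M2\<close> can be left only along its pair of
  \<open>M1\<close>, and from then on the pairs alternate, so the undirected relation becomes a
  directed walk. The last alternative is a stop halfway through a step of
  \<open>byp\<close>.\<close>

lemma reach: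
  assumes "(x, z) \<in> linked (M1 \<union> M2)" "x \<notin> \<Union>M2"
  shows "z = x \<or> (\<exists>h. {x, h} \<in> M1 \<and> ((h, z) \<in> (byp M1 M2)\<^sup>* \<or>
           (\<exists>h'. (h, h') \<in> (byp M1 M2)\<^sup>* \<and> {h', z} \<in> M2)))"
  using assms(1)
proof (induction rule: linked_induct)
  case base
  show ?case by simp
next
  case (step y z s)
  show ?case
  proof (cases "y = z")
    case True
    then show ?thesis using step by simp
  next
    case False
    have s: "s = {y, z}"
      using step(2-4) False m1 m2 unfolding matching_def by (auto simp: card_2_iff)
    from step.IH show ?thesis
    proof (elim disjE exE conjE)
      assume "y = x"
      then show ?thesis using step(2) s assms(2) by auto
    next
      fix h assume h: "{x, h} \<in> M1" "(h, y) \<in> (byp M1 M2)\<^sup>*"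
      show ?thesis
      proof (cases "s \<in> M2")
        case True
        then show ?thesis using h s by blast
      next
        case F: False
        then have "{y, z} \<in> M1" using step(2) s by blast
        from h(2) show ?thesis
        proof (cases rule: rtranclE)
          case base
          then have "z = x"
            using h(1) \<open>{y, z} \<in> M1\<close> matching_inj[OF m1, of h z x] by (simp add: insert_commute)
          then show ?thesis by simp
        next
          case (step w)
          then obtain w' where w': "{w, w'} \<in> M2" "{w', y} \<in> M1" by (auto simp: byp_def)
          then have "z = w'"
            using \<open>{y, z} \<in> M1\<close> matching_inj[OF m1, of y z w'] by (simp add: insert_commute)
          then show ?thesis using w' step(1) h by blast
        qed
      qed
    next
      fix h h' assume h: "{x, h} \<in> M1" "(h, h') \<in> (byp M1 M2)\<^sup>*" "{h', y} \<in> M2"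
      show ?thesis
      proof (cases "s \<in> M1")
        case True
        then have "(h', z) \<in> byp M1 M2" using h s by (auto simp: byp_def)
        then show ?thesis using h by (meson rtrancl.rtrancl_into_rtrancl)
      next
        case False
        then have "z = h'"
          using step(2) s h(3) matching_inj[OF m2, of y z h'] by (simp add: insert_commute)
        then show ?thesis using h by blast
      qed
    qed
  qed
qed

lemma byp_linked: "(h, k) \<in> (byp M1 M2)\<^sup>* \<Longrightarrow> (h, k) \<in> linked (M1 \<union> M2)"
proof (induction rule: rtrancl_induct)
  case (step k l)
  then obtain k' where "{k, k'} \<in> M2" "{k', l} \<in> M1" by (auto simp: byp_def)
  then have "(k, k') \<in> linked (M1 \<union> M2)" "(k', l) \<in> linked (M1 \<union> M2)" by (auto intro: linked_in)
  then show ?case using step.IH by (blast intro: linked_trans)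
qed simp

lemma byp_terminal: "k \<notin> \<Union>M2 \<Longrightarrow> (k, l) \<notin> byp M1 M2"
  by (auto simp: byp_def)

lemma reach_end:
  assumes "(x, y) \<in> linked (M1 \<union> M2)" "x \<notin> \<Union>M2" "y \<notin> \<Union>M2" "x \<noteq> y"
  obtains h where "{x, h} \<in> M1" "(h, y) \<in> (byp M1 M2)\<^sup>*"
  using reach[OF assms(1,2)] assms that by blast

lemma rtrancl_byp_linear:
  "(h, y) \<in> (byp M1 M2)\<^sup>* \<Longrightarrow> (h, z) \<in> (byp M1 M2)\<^sup>* \<Longrightarrow> (y, z) \<in> (byp M1 M2)\<^sup>* \<or> (z, y) \<in> (byp M1 M2)\<^sup>*"
  by (rule single_valued_confluent) (auto intro: single_valuedI byp_single_valued)

text \<open>\<open>byp\<close> is single-valued and no step of it starts outside the pairs of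
  \<open>M2\<close>, so the walk out of \<open>x\<close> stops at the first such point.\<close>

lemma end_unique:
  assumes "(x, y) \<in> linked (M1 \<union> M2)" "(x, z) \<in> linked (M1 \<union> M2)"
    "x \<notin> \<Union>M2" "y \<notin> \<Union>M2" "z \<notin> \<Union>M2" "x \<noteq> y" "x \<noteq> z"
  shows "y = z"
proof -
  obtain h where h: "{x, h} \<in> M1" "(h, y) \<in> (byp M1 M2)\<^sup>*"
    using reach_end[of x y] assms by blast
  obtain k where k: "{x, k} \<in> M1" "(k, z) \<in> (byp M1 M2)\<^sup>*"
    using reach_end[of x z] assms by blast
  have "h = k" using h k matching_inj[OF m1] by blast
  then show ?thesis
    using rtrancl_byp_linear[of h y z] h k assms byp_terminal by (metis converse_rtranclE)
qed

text \<open>The walk out of \<open>x\<close> has to go on until it reaches \<open>y\<close>, so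
  after each pair of \<open>M2\<close> another pair of \<open>M1\<close> follows.\<close>

lemma string_joined:
  assumes "(x, y) \<in> linked (M1 \<union> M2)" "(x, z) \<in> linked (M1 \<union> M2)" "x \<notin> \<Union>M2" "y \<notin> \<Union>M2" "x \<noteq> y"
  shows "z \<in> \<Union>M1"
proof -
  obtain h where h: "{x, h} \<in> M1" "(h, y) \<in> (byp M1 M2)\<^sup>*"
    using reach_end[of x y] assms by blast
  have *: "k \<in> \<Union>M1" if "(h, k) \<in> (byp M1 M2)\<^sup>*" for k
    using that h(1) by (cases rule: rtranclE) (auto simp: byp_def)
  from reach[OF assms(2,3)] show ?thesis
  proof (elim disjE exE conjE)
    assume "z = x" then show ?thesis using h by blast
  next
    fix k assume "{x, k} \<in> M1" "(k, z) \<in> (byp M1 M2)\<^sup>*"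
    moreover from this have "k = h" using h matching_inj[OF m1] by blast
    ultimately show ?thesis using * by blast
  next
    fix k k' assume k: "{x, k} \<in> M1" "(k, k') \<in> (byp M1 M2)\<^sup>*" "{k', z} \<in> M2"
    have "k = h" using h k matching_inj[OF m1] by blast
    have "k' \<noteq> y" using k assms by blast
    have "(k', y) \<in> (byp M1 M2)\<^sup>*"
      using rtrancl_byp_linear[of h y k'] h k \<open>k = h\<close> assms byp_terminal \<open>k' \<noteq> y\<close>
      by (metis converse_rtranclE)
    then obtain l where "(k', l) \<in> byp M1 M2" using \<open>k' \<noteq> y\<close> by (meson converse_rtranclE)
    then obtain z' where "{k', z'} \<in> M2" "{z', l} \<in> M1" by (auto simp: byp_def)
    then show ?thesis using k matching_inj[OF m2] by blast
  qed
qed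

text \<open>The left side has the shape of the joins in \<open>quotient_graph\<close>; the right
  side is symmetric and free of directed walks.\<close>

lemma ends_eq:
  assumes "H \<inter> \<Union>M2 = {}"
  shows "{{x, y} | x y. x \<in> H \<and> y \<in> H \<and> (\<exists>h. {x, h} \<in> M1 \<and> (h, y) \<in> (byp M1 M2)\<^sup>*)} =
         {{x, y} | x y. x \<in> H \<and> y \<in> H \<and> x \<noteq> y \<and> (x, y) \<in> linked (M1 \<union> M2)}"
proof -
  have *: "(\<exists>h. {x, h} \<in> M1 \<and> (h, y) \<in> (byp M1 M2)\<^sup>*) \<longleftrightarrow> x \<noteq> y \<and> (x, y) \<in> linked (M1 \<union> M2)"
    if "x \<in> H" "y \<in> H" for x y
  proof
    assume "\<exists>h. {x, h} \<in> M1 \<and> (h, y) \<in> (byp M1 M2)\<^sup>*"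
    then obtain h where h: "{x, h} \<in> M1" "(h, y) \<in> (byp M1 M2)\<^sup>*" by blast
    have "x \<noteq> y" using no_return h by (metis rtrancl_imp_relpow)
    moreover have "(x, h) \<in> linked (M1 \<union> M2)" using h by (auto intro: linked_in)
    ultimately show "x \<noteq> y \<and> (x, y) \<in> linked (M1 \<union> M2)" using linked_trans[OF _ byp_linked[OF h(2)]] by blast
  next
    assume "x \<noteq> y \<and> (x, y) \<in> linked (M1 \<union> M2)"
    then show "\<exists>h. {x, h} \<in> M1 \<and> (h, y) \<in> (byp M1 M2)\<^sup>*"
      using reach_end[of x y] that assms by blast
  qed
  show ?thesis by (intro Collect_cong iff_exI conj_cong refl) (simp_all add: *)
qed

text \<open>
  A string with exactly one end outside the second matching has an odd number of elements, but
  the first matching pairs them off.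
\<close>

lemma no_lone_end:
  assumes "x \<notin> \<Union>M2" "finite Z" "Z = linked (M1 \<union> M2) `` {x}" "Z - {x} \<subseteq> \<Union>M2" "Z \<subseteq> \<Union>M1"
  shows False
proof -
  have closed: "e \<subseteq> Z" if e: "e \<in> M1 \<union> M2" "e \<inter> Z \<noteq> {}" for e
  proof
    fix z assume "z \<in> e"
    obtain y where y: "y \<in> e" "(x, y) \<in> linked (M1 \<union> M2)" using e assms(3) by blast
    show "z \<in> Z"
      using linked_trans[OF y(2) linked_in[OF e(1) y(1) \<open>z \<in> e\<close>]] assms(3) by blast
  qed
  have "even (card Z)"
    by (rule even_matching[OF m1]) (use assms(2,5) closed in auto)
  moreover have "even (card (Z - {x}))"
    by (rule even_matching[OF m2]) (use assms(1,2,4) closed in blast)+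
  moreover have "x \<in> Z" using assms(3) by simp
  ultimately show False using card_Suc_Diff1[OF assms(2)] by (metis even_Suc)
qed

end

subsection \<open>Components\<close>

abbreviation "glinked G \<equiv> linked (verts G \<union> joins G)"

lemma comps_linked: "comps G = half G // glinked G"
  unfolding comps_def linked_def ..

lemma comps_iff: "K \<in> comps G \<longleftrightarrow> (\<exists>x\<in>half G. K = glinked G `` {x})"
  by (auto simp: comps_linked quotient_def)

lemma comp_eq: "K \<in> comps G \<Longrightarrow> x \<in> K \<Longrightarrow> K = glinked G `` {x}"
  by (auto simp: comps_iff intro: linked_trans linked_sym)

lemma comp_nonempty: "K \<in> comps G \<Longrightarrow> K \<noteq> {}"
  by (metis Image_singleton_iff comps_iff linked_refl empty_iff)

lemma comp_linked: "K \<in> comps G \<Longrightarrow> x \<in> K \<Longrightarrow> y \<in> K \<Longrightarrow> (x, y) \<in> glinked G"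
  using comp_eq by fastforce

lemma comp_linked_in: "K \<in> comps G \<Longrightarrow> x \<in> K \<Longrightarrow> (x, y) \<in> glinked G \<Longrightarrow> y \<in> K"
  using comp_eq by fastforce

lemma comp_closed: "K \<in> comps G \<Longrightarrow> s \<in> verts G \<union> joins G \<Longrightarrow> s \<inter> K \<noteq> {} \<Longrightarrow> s \<subseteq> K"
  by (auto intro: comp_linked_in linked_in)

lemma comp_disjoint: "K \<in> comps G \<Longrightarrow> L \<in> comps G \<Longrightarrow> x \<in> K \<Longrightarrow> x \<in> L \<Longrightarrow> K = L"
  using comp_eq by metis

lemma comp_exists: "x \<in> half G \<Longrightarrow> \<exists>K\<in>comps G. x \<in> K"
  by (metis Image_singleton_iff comps_iff linked_refl)

lemma comp_least:
  assumes "K \<in> comps G" "x \<in> K" "x \<in> X"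
    "\<And>s. s \<in> verts G \<union> joins G \<Longrightarrow> s \<inter> X \<noteq> {} \<Longrightarrow> s \<subseteq> X"
  shows "K \<subseteq> X"
proof
  fix y assume "y \<in> K"
  show "y \<in> X" by (rule linked_closed[OF comp_linked[OF assms(1,2) \<open>y \<in> K\<close>] assms(3)]) (fact assms(4))
qed

lemma compI:
  assumes "x \<in> K" "x \<in> half G" "\<And>s. s \<in> verts G \<union> joins G \<Longrightarrow> s \<inter> K \<noteq> {} \<Longrightarrow> s \<subseteq> K"
    "\<And>y. y \<in> K \<Longrightarrow> (x, y) \<in> glinked G"
  shows "K \<in> comps G"
proof -
  have "y \<in> K" if "(x, y) \<in> glinked G" for y
    by (rule linked_closed[OF that assms(1)]) (fact assms(3))
  then have "K = glinked G `` {x}" using assms(4) by blast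
  then show ?thesis using assms(2) by (auto simp: comps_iff)
qed

section \<open>Elementary facts on graphs, loops and one-particle irreducibility\<close>

lemma graph_matching: "graph G \<Longrightarrow> matching (joins G)"
  by (auto simp: graph_def matching_def)

lemma graph_finite: "graph G \<Longrightarrow> finite (half G)"
  by (simp add: graph_def)

lemma vert_subset: "graph G \<Longrightarrow> v \<in> verts G \<Longrightarrow> v \<subseteq> half G"
  by (auto simp: graph_def partition_on_def)

lemma vert_nonempty: "graph G \<Longrightarrow> v \<in> verts G \<Longrightarrow> v \<noteq> {}"
  by (auto simp: graph_def partition_on_def)

lemma vert_exists: "graph G \<Longrightarrow> x \<in> half G \<Longrightarrow> \<exists>v\<in>verts G. x \<in> v"
  by (auto simp: graph_def partition_on_def)

lemma vert_unique: "graph G \<Longrightarrow> v \<in> verts G \<Longrightarrow> v' \<in> verts G \<Longrightarrow> x \<in> v \<Longrightarrow> x \<in> v' \<Longrightarrow> v = v'"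
  unfolding graph_def partition_on_def by (metis disjointD disjoint_iff)

lemma half_eq: "graph G \<Longrightarrow> half G = \<Union>(verts G)"
  by (auto simp: graph_def partition_on_def)

lemma join_subset: "graph G \<Longrightarrow> e \<in> joins G \<Longrightarrow> e \<subseteq> half G"
  by (auto simp: graph_def)

lemma cell_subset: "graph G \<Longrightarrow> s \<in> verts G \<union> joins G \<Longrightarrow> s \<subseteq> half G"
  using vert_subset join_subset by blast

lemma comp_subset: "graph G \<Longrightarrow> K \<in> comps G \<Longrightarrow> K \<subseteq> half G"
  by (auto simp: comps_iff dest: linked_closed[where X = "half G"] cell_subset)

lemma glinked_half: "graph G \<Longrightarrow> (x, y) \<in> glinked G \<Longrightarrow> x \<in> half G \<Longrightarrow> y \<in> half G"
  using comp_subset comp_exists comp_linked_in by (metis subsetD)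

lemma join_partner:
  assumes "graph G" "x \<in> \<Union>(joins G)"
  obtains y where "{x, y} \<in> joins G" "x \<noteq> y"
  using assms matching_partner[OF graph_matching[OF assms(1)]] by (metis UnionE)

lemma in_ext: "x \<in> ext G \<longleftrightarrow> x \<in> half G \<and> x \<notin> \<Union>(joins G)"
  by (simp add: ext_def)

lemma graphI:
  assumes "finite (half G)" "\<Union>(verts G) = half G" "{} \<notin> verts G"
    "\<And>v v' x. v \<in> verts G \<Longrightarrow> v' \<in> verts G \<Longrightarrow> x \<in> v \<Longrightarrow> x \<in> v' \<Longrightarrow> v = v'"
    "\<And>e. e \<in> joins G \<Longrightarrow> e \<subseteq> half G" "matching (joins G)"
  shows "graph G"
  using assms unfolding graph_def partition_on_def matching_def by (auto intro!: disjointI)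

lemma graph_finite_verts: "graph G \<Longrightarrow> finite (verts G)"
  unfolding graph_def using finite_elements by blast

text \<open>
  For a trivalent component with \<open>V\<close> vertices and \<open>n\<close> external edges the loop number is
  \<open>(V - n) / 2 + 1\<close>, so the absence of loops means that the component is a single vertex.
\<close>

lemma loop_number_ge_1:
  assumes "graph G" "\<And>v. v \<in> verts G \<Longrightarrow> card v = 3" "K \<in> comps G" "card (ext G \<inter> K) \<in> {2, 3}"
  shows "loop_number G K \<ge> 1 \<longleftrightarrow> \<not> (\<exists>v\<in>verts G. v \<subseteq> ext G \<inter> K)"
proof -
  define V where "V = {v \<in> verts G. v \<subseteq> K}"
  define E where "E = {e \<in> joins G. e \<subseteq> K}"
  have KH: "K \<subseteq> half G" using comp_subset assms by blast
  have fK: "finite K" using KH graph_finite[OF assms(1)] finite_subset by blast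
  have "K = \<Union>V"
  proof
    show "K \<subseteq> \<Union>V"
    proof
      fix x assume x: "x \<in> K"
      then obtain v where v: "v \<in> verts G" "x \<in> v" using vert_exists[OF assms(1)] KH by blast
      then have "v \<subseteq> K" using comp_closed[OF assms(3), of v] x by blast
      then show "x \<in> \<Union>V" using v by (auto simp: V_def)
    qed
  qed (auto simp: V_def)
  moreover have "card (\<Union>V) = sum card V"
  proof (rule card_Union_disjoint)
    show "pairwise disjnt V"
      unfolding pairwise_def disjnt_iff V_def using vert_unique[OF assms(1)] by blast
    show "finite v" if "v \<in> V" for v using that fK by (auto simp: V_def intro: finite_subset)
  qed
  moreover have "sum card V = sum (\<lambda>_. 3) V"
    by (rule sum.cong) (use assms(2) in \<open>auto simp: V_def\<close>)
  ultimately have cV: "card K = 3 * card V" by simp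
  have "K = (ext G \<inter> K) \<union> \<Union>E"
  proof
    show "K \<subseteq> (ext G \<inter> K) \<union> \<Union>E"
    proof
      fix x assume x: "x \<in> K"
      show "x \<in> (ext G \<inter> K) \<union> \<Union>E"
      proof (cases "x \<in> ext G")
        case False
        then obtain e where e: "e \<in> joins G" "x \<in> e" using x KH by (auto simp: in_ext)
        then have "e \<subseteq> K" using comp_closed[OF assms(3), of e] x by blast
        then show ?thesis using e by (auto simp: E_def)
      qed (use x in simp)
    qed
  qed (auto simp: E_def)
  then have "card K = card ((ext G \<inter> K) \<union> \<Union>E)" by simp
  also have "\<dots> = card (ext G \<inter> K) + card (\<Union>E)"
  proof (rule card_Un_disjoint)
    show "finite (ext G \<inter> K)" using fK by simp
    show "finite (\<Union>E)" using fK by (rule rev_finite_subset) (auto simp: E_def)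
    show "ext G \<inter> K \<inter> \<Union>E = {}" by (auto simp: E_def in_ext)
  qed
  also have "card (\<Union>E) = sum card E"
  proof (rule card_Union_disjoint)
    show "pairwise disjnt E"
      unfolding pairwise_def disjnt_iff E_def
      using matching_unique[OF graph_matching[OF assms(1)]] by blast
    show "finite v" if "v \<in> E" for v using that fK by (auto simp: E_def intro: finite_subset)
  qed
  also have "sum card E = sum (\<lambda>_. 2) E"
    by (rule sum.cong) (use graph_matching[OF assms(1)] in \<open>auto simp: E_def matching_def\<close>)
  finally have cE: "3 * card V = card (ext G \<inter> K) + 2 * card E" using cV by simp
  have "V \<noteq> {}" using \<open>K = \<Union>V\<close> comp_nonempty[OF assms(3)] by auto
  moreover have fV: "finite V" unfolding V_def using graph_finite_verts[OF assms(1)] by simp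
  ultimately have "card V > 0" by (simp add: card_gt_0_iff)
  have loop: "loop_number G K = int (card E) - int (card V) + 1"
    by (simp add: loop_number_def E_def V_def)
  show ?thesis
  proof
    assume l: "loop_number G K \<ge> 1"
    show "\<not> (\<exists>v\<in>verts G. v \<subseteq> ext G \<inter> K)"
    proof
      assume "\<exists>v\<in>verts G. v \<subseteq> ext G \<inter> K"
      then obtain v where v: "v \<in> verts G" "v \<subseteq> ext G" "v \<subseteq> K" by blast
      obtain x where x: "x \<in> v" using vert_nonempty[OF assms(1) v(1)] by blast
      have "K \<subseteq> v"
      proof (rule comp_least[OF assms(3)])
        show "x \<in> K" "x \<in> v" using x v by auto
        fix s assume s: "s \<in> verts G \<union> joins G" "s \<inter> v \<noteq> {}"
        obtain y where y: "y \<in> s" "y \<in> v" using s(2) by blast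
        then have "s \<notin> joins G" using v(2) by (auto simp: in_ext)
        then have "s = v" using vert_unique[OF assms(1), of s v y] s(1) v(1) y by blast
        then show "s \<subseteq> v" by simp
      qed
      then have "K = v" using v by blast
      then have "card V = 1" using cV assms(2)[OF v(1)] by simp
      moreover have "card (ext G \<inter> K) = 3"
        using assms(2)[OF v(1)] \<open>K = v\<close> v(2) by (simp add: Int_absorb1)
      ultimately show False using cE l loop by simp
    qed
  next
    assume nv: "\<not> (\<exists>v\<in>verts G. v \<subseteq> ext G \<inter> K)"
    \<comment> \<open>Write \<open>V\<close>, \<open>E\<close> and \<open>n\<close> for the numbers
      of vertices, joins and legs. From \<open>3 V = n + 2 E\<close> it follows that
      \<open>E >= V\<close> amounts to \<open>V >= n\<close>, and that \<open>V\<close> and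
      \<open>n\<close> have the same parity. As \<open>n\<close> is 2 or 3, a smaller
      \<open>V\<close> leaves only \<open>V = 1\<close> and \<open>n = 3\<close>.\<close>
    have "card V \<ge> card (ext G \<inter> K)"
    proof (rule ccontr)
      assume "\<not> card (ext G \<inter> K) \<le> card V"
      then have "card V = 1 \<or> card V = 2 \<and> card (ext G \<inter> K) = 3"
        using \<open>card V > 0\<close> assms(4) by auto
      then have V1: "card V = 1" "card (ext G \<inter> K) = 3" using cE assms(4) by (auto, presburger+)
      then obtain v where V: "V = {v}" by (meson card_1_singletonE)
      then have "K = v" using \<open>K = \<Union>V\<close> by simp
      have "v \<in> V" using V by simp
      then have "v \<in> verts G" unfolding V_def by blast
      note v = \<open>K = v\<close> \<open>v \<in> verts G\<close>
      have "ext G \<inter> K = K"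
        by (rule card_subset_eq) (use fK V1 v assms(2) in auto)
      then show False using nv v by auto
    qed
    then show "loop_number G K \<ge> 1" using loop cE by linarith
  qed
qed

text \<open>The condition on loops becomes a condition at single vertices, which is easily
  transferred to quotients and preimages, where counting joins would be laborious.\<close>

lemma feynman_iff:
  "feynman G \<longleftrightarrow> graph G \<and> (\<forall>v\<in>verts G. card v = 3) \<and>
     (\<forall>K\<in>comps G. card (ext G \<inter> K) \<in> {2, 3}) \<and> (\<forall>v\<in>verts G. \<not> v \<subseteq> ext G)" (is "_ = ?R")
proof
  assume f: "feynman G"
  have "\<not> v \<subseteq> ext G" if v: "v \<in> verts G" for v
  proof
    assume ve: "v \<subseteq> ext G"
    have g: "graph G" using f by (simp add: feynman_def)
    obtain x where x: "x \<in> v" using vert_nonempty[OF g v] by blast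
    obtain K where K: "K \<in> comps G" "x \<in> K"
      using comp_exists[of x G] x vert_subset[OF g v] by blast
    then have "v \<subseteq> K" using comp_closed[OF K(1), of v] x v by blast
    then show False using loop_number_ge_1[OF g _ K(1)] f K v ve unfolding feynman_def by blast
  qed
  then show ?R using f by (auto simp: feynman_def)
next
  assume R: ?R
  have "loop_number G K \<ge> 1" if "K \<in> comps G" for K
    using loop_number_ge_1[of G K] R that by blast
  then show "feynman G" using R unfolding feynman_def by blast
qed

lemma feynman_graph: "feynman G \<Longrightarrow> graph G"
  by (simp add: feynman_def)

text \<open>With \<open>e\<close> only one generating cell is lost, so the generated relation is
  unchanged as soon as the ends of \<open>e\<close> stay linked by the others.\<close>

lemma one_PI_iff:
  assumes "graph G"
  shows "one_PI G \<longleftrightarrow> (\<forall>e\<in>joins G. \<forall>x\<in>e. \<forall>y\<in>e. (x, y) \<in> linked (verts G \<union> (joins G - {e})))"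
proof -
  have "comps (Graph (half G) (verts G) (joins G - {e})) = comps G \<longleftrightarrow>
      (\<forall>x\<in>e. \<forall>y\<in>e. (x, y) \<in> linked (verts G \<union> (joins G - {e})))" (is "?L = ?R") if e: "e \<in> joins G" for e
  proof
    assume L: ?L
    show ?R
    proof (intro ballI)
      fix x y assume xy: "x \<in> e" "y \<in> e"
      then have "x \<in> half G" using join_subset[OF assms e] by blast
      then obtain K where K: "K \<in> comps G" "x \<in> K" using comp_exists[of x G] by blast
      have "y \<in> K" using comp_closed[OF K(1), of e] e xy K(2) by blast
      then show "(x, y) \<in> linked (verts G \<union> (joins G - {e}))"
        using comp_linked[of K "Graph (half G) (verts G) (joins G - {e})" x y] L K by simp
    qed
  next
    assume R: ?R
    have "glinked G = linked (verts G \<union> (joins G - {e}))"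
    proof
      show "glinked G \<subseteq> linked (verts G \<union> (joins G - {e}))"
      proof (rule linked_least)
        fix s x y assume "s \<in> verts G \<union> joins G" "x \<in> s" "y \<in> s"
        then show "(x, y) \<in> linked (verts G \<union> (joins G - {e}))"
          using R linked_in[of s "verts G \<union> (joins G - {e})"] by blast
      qed
      show "linked (verts G \<union> (joins G - {e})) \<subseteq> glinked G" by (rule linked_mono) blast
    qed
    then show ?L by (simp add: comps_linked)
  qed
  then show ?thesis unfolding one_PI_def by blast
qed

subsection \<open>Quotients\<close>

text \<open>
  The strings of \<open>A\<close> relative to \<open>u\<close> run alternately along the joins of \<open>A\<close> that are not in \<open>u\<close>
  and through the components of \<open>u\<close> with two external edges. The joins of \<open>A / u\<close> are the strings
  with both ends in \<open>A / u\<close>.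
\<close>

definition outer :: "'s graph \<Rightarrow> 's graph \<Rightarrow> 's set set" where
  "outer A u = joins A - joins u"

definition links :: "'s graph \<Rightarrow> 's set set" where
  "links u = {ext u \<inter> K | K. K \<in> comps u \<and> card (ext u \<inter> K) = 2}"

abbreviation "string A u \<equiv> linked (outer A u \<union> links u)"

text \<open>The condition under which contracting \<open>u\<close> keeps the external edges of
  \<open>A\<close>: no string runs through a component with two legs into a leg of \<open>A\<close>.
  Components of \<open>u\<close> that are also components of \<open>A\<close> are exempt because
  they are deleted as a whole.\<close>

definition good :: "'s graph \<Rightarrow> 's graph \<Rightarrow> bool" where
  "good A u \<longleftrightarrow> (\<forall>K\<in>comps u - comps A. card (ext u \<inter> K) = 2 \<longrightarrow> ext u \<inter> K \<inter> ext A = {})"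

lemma matching_links: "matching (links u)"
  unfolding matching_def links_def
  by (auto intro!: disjointI dest: comp_disjoint)

lemma links_ext: "l \<in> links u \<Longrightarrow> l \<subseteq> ext u"
  by (auto simp: links_def)

lemma link_comp: "l \<in> links u \<Longrightarrow> x \<in> l \<Longrightarrow> K \<in> comps u \<Longrightarrow> x \<in> K \<Longrightarrow> l = ext u \<inter> K \<and> card (ext u \<inter> K) = 2"
  unfolding links_def using comp_disjoint[of _ u K x] by blast

lemma half_quotient: "half (quotient_graph A u) = (half A - half u) \<union> \<Union>(new_verts A u)"
  and verts_quotient: "verts (quotient_graph A u) = (verts A - verts u) \<union> new_verts A u"
  by (simp_all add: quotient_graph_def Let_def)

lemma new_vertsI: "K \<in> comps u \<Longrightarrow> K \<notin> comps A \<Longrightarrow> card (ext u \<inter> K) = 3 \<Longrightarrow> ext u \<inter> K \<in> new_verts A u"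
  by (auto simp: new_verts_def)

lemma new_vertsE:
  assumes "v \<in> new_verts A u"
  obtains K where "K \<in> comps u" "K \<notin> comps A" "card (ext u \<inter> K) = 3" "v = ext u \<inter> K"
  using assms by (auto simp: new_verts_def)

section \<open>Contraction of one subgraph\<close>

locale contraction =
  fixes A u :: "'s graph"
  assumes gA: "graph A" and fu: "feynman u"
    and half_sub: "half u \<subseteq> half A" and verts_sub: "verts u \<subseteq> verts A" and joins_sub: "joins u \<subseteq> joins A"
begin

abbreviation "Q \<equiv> quotient_graph A u"

lemma gu: "graph u"
  using fu by (rule feynman_graph)

lemma comp_ext_card: "K \<in> comps u \<Longrightarrow> card (ext u \<inter> K) = 2 \<or> card (ext u \<inter> K) = 3"
  using fu by (auto simp: feynman_iff)

lemma vert_u: "v \<in> verts A \<Longrightarrow> x \<in> v \<Longrightarrow> x \<in> half u \<Longrightarrow> v \<in> verts u"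
  using vert_exists[OF gu, of x] vert_unique[OF gA, of v _ x] verts_sub by blast

lemma join_u: "e \<in> joins A \<Longrightarrow> x \<in> e \<Longrightarrow> x \<in> \<Union>(joins u) \<Longrightarrow> e \<in> joins u"
  using matching_unique[OF graph_matching[OF gA], of e _ x] joins_sub by blast

lemma outer_joins: "e \<in> outer A u \<Longrightarrow> e \<in> joins A"
  by (simp add: outer_def)

lemma outer_ext: "e \<in> outer A u \<Longrightarrow> x \<in> e \<Longrightarrow> x \<in> half u \<Longrightarrow> x \<in> ext u"
  using join_u[of e x] by (auto simp: outer_def in_ext)

lemma outerI: "e \<in> joins A \<Longrightarrow> x \<in> e \<Longrightarrow> x \<notin> \<Union>(joins u) \<Longrightarrow> e \<in> outer A u"
  by (auto simp: outer_def)

lemma ext_A_u: "x \<in> half u \<Longrightarrow> x \<in> ext A \<Longrightarrow> x \<in> ext u"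
  using joins_sub by (auto simp: in_ext)

lemma matching_outer: "matching (outer A u)"
  using graph_matching[OF gA] by (rule matching_subset) (auto simp: outer_def)

sublocale two_matchings "outer A u" "links u"
  by unfold_locales (rule matching_outer, rule matching_links)

lemma glinked_u_A: "glinked u \<subseteq> glinked A"
  by (rule linked_mono) (use verts_sub joins_sub in blast)

lemma comp_u_sub: "K \<in> comps u \<Longrightarrow> x \<in> K \<Longrightarrow> L \<in> comps A \<Longrightarrow> x \<in> L \<Longrightarrow> K \<subseteq> L"
  using comp_linked_in[of L A x] comp_linked[of K u x] glinked_u_A by blast

text \<open>A step of \<open>bypass\<close> leaves a component through one of its legs. A leg lies
  in no join of \<open>u\<close>, so the join of \<open>A\<close> at it is automatically an outer
  one.\<close>

lemma bypass_byp: "bypass A u = byp (outer A u) (links u)"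
proof -
  have *: "(\<exists>K\<in>comps u. ext u \<inter> K = {h, h'} \<and> h \<noteq> h') \<longleftrightarrow> {h, h'} \<in> links u" for h h'
  proof
    assume "{h, h'} \<in> links u"
    then obtain K where "K \<in> comps u" "ext u \<inter> K = {h, h'}" "card {h, h'} = 2"
      by (auto simp: links_def)
    then show "\<exists>K\<in>comps u. ext u \<inter> K = {h, h'} \<and> h \<noteq> h'" by auto
  next
    assume "\<exists>K\<in>comps u. ext u \<inter> K = {h, h'} \<and> h \<noteq> h'"
    then obtain K where K: "K \<in> comps u" "ext u \<inter> K = {h, h'}" "h \<noteq> h'" by auto
    then have "card (ext u \<inter> K) = 2" by simp
    then show "{h, h'} \<in> links u" using K unfolding links_def by (metis (mono_tags, lifting) mem_Collect_eq)
  qed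
  have **: "{h', k} \<in> joins A \<longleftrightarrow> {h', k} \<in> outer A u" if "{h, h'} \<in> links u" for h h' k
    using links_ext[OF that] outerI[of "{h', k}" h'] outer_joins by (auto simp: in_ext)
  have "(h, k) \<in> bypass A u \<longleftrightarrow> (h, k) \<in> byp (outer A u) (links u)" for h k
  proof -
    have "(h, k) \<in> bypass A u \<longleftrightarrow>
        (\<exists>h'. (\<exists>K\<in>comps u. ext u \<inter> K = {h, h'} \<and> h \<noteq> h') \<and> {h', k} \<in> joins A)"
      by (auto simp: bypass_def)
    also have "\<dots> \<longleftrightarrow> (\<exists>h'. {h, h'} \<in> links u \<and> {h', k} \<in> joins A)" by (simp only: *)
    also have "\<dots> \<longleftrightarrow> (h, k) \<in> byp (outer A u) (links u)" by (simp add: byp_def ** cong: conj_cong)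
    finally show ?thesis .
  qed
  then show ?thesis by auto
qed

lemma half_Q_iff: "x \<in> half Q \<longleftrightarrow> x \<in> half A \<and> x \<notin> half u \<or>
    (\<exists>K. K \<in> comps u \<and> K \<notin> comps A \<and> card (ext u \<inter> K) = 3 \<and> x \<in> ext u \<and> x \<in> K)"
  by (auto simp: half_quotient new_verts_def)

lemma half_Q_sub: "half Q \<subseteq> half A"
  using half_sub by (auto simp: half_Q_iff in_ext)

lemma half_Q_comp:
  assumes "K \<in> comps u" "x \<in> K" "x \<in> half Q"
  shows "K \<notin> comps A \<and> card (ext u \<inter> K) = 3 \<and> x \<in> ext u"
proof -
  have "x \<in> half u" using comp_subset[OF gu assms(1)] assms(2) by blast
  then obtain K' where K': "K' \<in> comps u" "K' \<notin> comps A" "card (ext u \<inter> K') = 3" "x \<in> ext u" "x \<in> K'"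
    using assms(3) unfolding half_Q_iff by blast
  moreover have "K' = K" by (rule comp_disjoint[OF K'(1) assms(1) K'(5) assms(2)])
  ultimately show ?thesis by simp
qed

lemma half_Q_unjoined: "x \<in> half Q \<Longrightarrow> x \<notin> \<Union>(joins u)"
  using join_subset[OF gu] by (auto simp: half_Q_iff in_ext)

text \<open>This makes the half-edges of \<open>A / u\<close> ends of strings, as the results on two
  matchings require.\<close>

lemma half_Q_links: "half Q \<inter> \<Union>(links u) = {}"
proof -
  have False if "x \<in> half Q" "x \<in> ext u" "x \<in> K" "K \<in> comps u" "card (ext u \<inter> K) = 2" for x K
    using half_Q_comp[OF that(4,3,1)] that(5) by simp
  then show ?thesis by (auto simp: links_def)
qed

lemma half_Q_notin_links: "x \<in> half Q \<Longrightarrow> x \<notin> \<Union>(links u)"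
  using half_Q_links by blast

text \<open>From here on the joins of the quotient are strings with two ends, and
  \<open>bypass\<close> is no longer used.\<close>

lemma joins_Q: "joins Q = {{x, y} | x y. x \<in> half Q \<and> y \<in> half Q \<and> x \<noteq> y \<and> (x, y) \<in> string A u}"
proof -
  have "joins Q = {{x, y} | x y. x \<in> half Q \<and> y \<in> half Q \<and> (\<exists>h. {x, h} \<in> joins A \<and> (h, y) \<in> (bypass A u)\<^sup>*)}"
    by (simp add: quotient_graph_def Let_def)
  also have "\<dots> = {{x, y} | x y. x \<in> half Q \<and> y \<in> half Q \<and>
      (\<exists>h. {x, h} \<in> outer A u \<and> (h, y) \<in> (byp (outer A u) (links u))\<^sup>*)}"
  proof -
    have "{x, h} \<in> joins A \<longleftrightarrow> {x, h} \<in> outer A u" if "x \<in> half Q" for x h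
      using outerI[of "{x, h}" x] half_Q_unjoined[OF that] outer_joins by blast
    then show ?thesis unfolding bypass_byp by (intro Collect_cong iff_exI conj_cong refl) simp_all
  qed
  also have "\<dots> = {{x, y} | x y. x \<in> half Q \<and> y \<in> half Q \<and> x \<noteq> y \<and> (x, y) \<in> string A u}"
    by (rule ends_eq[OF half_Q_links])
  finally show ?thesis .
qed

lemma join_Q_iff: "{x, y} \<in> joins Q \<longleftrightarrow> x \<in> half Q \<and> y \<in> half Q \<and> x \<noteq> y \<and> (x, y) \<in> string A u"
  unfolding joins_Q by (auto simp: doubleton_eq_iff intro: linked_sym)

lemma joins_QE:
  assumes "e \<in> joins Q"
  obtains x y where "e = {x, y}" "x \<in> half Q" "y \<in> half Q" "x \<noteq> y" "(x, y) \<in> string A u"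
  using assms unfolding joins_Q by blast

lemma string_unique:
  "\<lbrakk>(x, y) \<in> string A u; (x, z) \<in> string A u; x \<in> half Q; y \<in> half Q; z \<in> half Q; x \<noteq> y; x \<noteq> z\<rbrakk> \<Longrightarrow> y = z"
  by (rule end_unique) (use half_Q_links in blast)+

lemma matching_Q: "matching (joins Q)"
  unfolding matching_def
proof
  show "\<forall>e\<in>joins Q. card e = 2" by (auto elim!: joins_QE)
  show "disjoint (joins Q)"
  proof (rule disjointI)
    fix e e' assume e: "e \<in> joins Q" "e' \<in> joins Q" "e \<noteq> e'"
    show "e \<inter> e' = {}"
    proof (rule ccontr)
      assume "e \<inter> e' \<noteq> {}"
      then obtain x where x: "x \<in> e" "x \<in> e'" by blast
      from e(1) x(1) obtain y where y: "e = {x, y}" by (metis joins_QE insert_commute insertE singletonD)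
      from e(2) x(2) obtain z where z: "e' = {x, z}" by (metis joins_QE insert_commute insertE singletonD)
      show False using e y z string_unique[of x y z] by (auto simp: join_Q_iff)
    qed
  qed
qed

lemma new_vert_sub: "v \<in> new_verts A u \<Longrightarrow> v \<subseteq> half u"
  by (auto simp: new_verts_def in_ext)

lemma old_vert_disj: "v \<in> verts A \<Longrightarrow> v \<notin> verts u \<Longrightarrow> v \<inter> half u = {}"
  using vert_u by blast

text \<open>Such a vertex would belong to \<open>u\<close> and consist of external edges of
  \<open>u\<close> only, so its component would have no loop.\<close>

lemma new_vert_notin: "v \<in> new_verts A u \<Longrightarrow> v \<notin> verts A"
proof
  assume v: "v \<in> new_verts A u" "v \<in> verts A"
  then obtain K where K: "K \<in> comps u" "card (ext u \<inter> K) = 3" "v = ext u \<inter> K"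
    by (auto simp: new_verts_def)
  then have "v \<noteq> {}" by auto
  then obtain x where "x \<in> v" by blast
  then have "v \<in> verts u" using vert_u[OF v(2)] new_vert_sub[OF v(1)] by blast
  then show False using K fu by (auto simp: feynman_iff)
qed

lemma graph_Q: "graph Q"
proof (rule graphI)
  show "finite (half Q)" using half_Q_sub graph_finite[OF gA] finite_subset by blast
  show "\<Union>(verts Q) = half Q"
  proof
    show "\<Union>(verts Q) \<subseteq> half Q"
      using old_vert_disj vert_subset[OF gA] unfolding verts_quotient half_quotient by blast
    show "half Q \<subseteq> \<Union>(verts Q)"
      using vert_exists[OF gA] vert_subset[OF gu] unfolding verts_quotient half_quotient by blast
  qed
  show "{} \<notin> verts Q"
    using vert_nonempty[OF gA] by (auto simp: verts_quotient new_verts_def)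
  fix v v' x assume v: "v \<in> verts Q" "v' \<in> verts Q" "x \<in> v" "x \<in> v'"
  show "v = v'"
  proof (cases "x \<in> half u")
    case True
    then have "v \<in> new_verts A u" "v' \<in> new_verts A u"
      using v old_vert_disj unfolding verts_quotient by blast+
    then obtain K K' where K: "K \<in> comps u" "v = ext u \<inter> K" "K' \<in> comps u" "v' = ext u \<inter> K'"
      by (meson new_vertsE)
    have "K = K'" by (rule comp_disjoint[OF K(1,3), of x]) (use K v in auto)
    then show ?thesis using K by simp
  next
    case False
    then have "v \<in> verts A" "v' \<in> verts A"
      using v new_vert_sub unfolding verts_quotient by blast+
    then show ?thesis using v vert_unique[OF gA] by blast
  qed
next
  show "matching (joins Q)" by (rule matching_Q)
  show "e \<subseteq> half Q" if "e \<in> joins Q" for e using that by (auto elim!: joins_QE)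
qed

lemma outer_half: "e \<in> outer A u \<Longrightarrow> x \<in> e \<Longrightarrow> x \<in> half A"
  using join_subset[OF gA, of e] outer_joins[of e] by blast

section \<open>Strings and the components of the quotient\<close>

lemma string_range:
  assumes "(x, y) \<in> string A u" "x \<in> half Q"
  shows "y \<in> half A - half u \<or> y \<in> ext u"
  using assms
proof (induction rule: linked_induct)
  case base
  then show ?case by (auto simp: half_Q_iff)
next
  case (step y z s)
  then show ?case using outer_half[of s z] outer_ext[of s z] links_ext[of s] by blast
qed

lemma string_glinked: "string A u \<subseteq> glinked A"
proof (rule linked_least)
  fix s x y assume s: "s \<in> outer A u \<union> links u" "x \<in> s" "y \<in> s"
  show "(x, y) \<in> glinked A"
  proof (cases "s \<in> outer A u")
    case True
    then show ?thesis using s outer_joins[of s] linked_in[of s "verts A \<union> joins A"] by blast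
  next
    case False
    then obtain K where K: "K \<in> comps u" "s = ext u \<inter> K" using s by (auto simp: links_def)
    then have "(x, y) \<in> glinked u" using s comp_linked[of K u x y] by blast
    then show ?thesis using glinked_u_A by blast
  qed
qed

lemma string_in_Q: "(x, y) \<in> string A u \<Longrightarrow> x \<in> half Q \<Longrightarrow> y \<in> half Q \<Longrightarrow> (x, y) \<in> glinked Q"
proof (cases "x = y")
  case False
  assume "(x, y) \<in> string A u" "x \<in> half Q" "y \<in> half Q"
  then have "{x, y} \<in> joins Q" using False by (simp add: join_Q_iff)
  then show ?thesis using linked_in[of "{x, y}" "verts Q \<union> joins Q" x y] by blast
qed simp

lemma glinked_Q_A: "glinked Q \<subseteq> glinked A"
proof (rule linked_least)
  fix s x y assume s: "s \<in> verts Q \<union> joins Q" "x \<in> s" "y \<in> s"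
  then consider "s \<in> verts A" | "s \<in> new_verts A u" | "s \<in> joins Q" by (auto simp: verts_quotient)
  then show "(x, y) \<in> glinked A"
  proof cases
    case 1
    then show ?thesis using s linked_in[of s "verts A \<union> joins A"] by blast
  next
    case 2
    then obtain K where "K \<in> comps u" "s = ext u \<inter> K" by (auto simp: new_verts_def)
    then have "(x, y) \<in> glinked u" using s comp_linked[of K u x y] by blast
    then show ?thesis using glinked_u_A by blast
  next
    case 3
    then have "(x, y) \<in> string A u" using s by (auto elim!: joins_QE intro: linked_sym)
    then show ?thesis using string_glinked by blast
  qed
qed

lemma new_vert_linked:
  assumes "K \<in> comps u" "K \<notin> comps A" "card (ext u \<inter> K) = 3" "x \<in> ext u" "x \<in> K" "y \<in> ext u" "y \<in> K"
  shows "x \<in> half Q" "y \<in> half Q" "(x, y) \<in> glinked Q"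
  using assms half_Q_iff linked_in[of "ext u \<inter> K" "verts Q \<union> joins Q" x y] new_vertsI[OF assms(1-3)]
  by (auto simp: verts_quotient)

text \<open>An invariant along paths of \<open>A\<close>, parts of which are invisible in
  \<open>A / u\<close>: \<open>x'\<close> is the last half-edge of the quotient that was passed,
  \<open>h\<close> is reached from it along a string, and the path is either at \<open>h\<close> or
  inside the component of \<open>u\<close> that it entered at \<open>h\<close>.\<close>

lemma path_projects:
  assumes "(x, z) \<in> glinked A" "x \<in> half Q"
  shows "\<exists>x'\<in>half Q. (x, x') \<in> glinked Q \<and> (\<exists>h. (x', h) \<in> string A u \<and> (h = z \<or> h \<in> half u \<and> (h, z) \<in> glinked u))"
  using assms(1)
proof (induction rule: linked_induct)
  case base
  show ?case by (intro bexI[of _ x] conjI exI[of _ x] disjI1 linked_refl assms(2) refl)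
next
  case (step z z1 s)
  then obtain x' h where x': "x' \<in> half Q" "(x, x') \<in> glinked Q"
    and h: "(x', h) \<in> string A u" "h = z \<or> h \<in> half u \<and> (h, z) \<in> glinked u" by blast
  have hN: "h \<in> half A - half u \<or> h \<in> ext u" by (rule string_range[OF h(1) x'(1)])
  consider "s \<in> verts u \<union> joins u" | "s \<in> verts A - verts u" | "s \<in> outer A u"
    using step by (auto simp: outer_def)
  then show ?case
  proof cases
    case 1
    then have "(z, z1) \<in> glinked u" "z \<in> half u"
      using linked_in[OF 1 step(3,4)] cell_subset[OF gu 1] step by auto
    then have "h \<in> half u \<and> (h, z1) \<in> glinked u" using h(2) linked_trans[of h z _ z1] by blast
    then show ?thesis using x' h(1) by blast
  next
    case 2
    then have "z \<notin> half u" "z1 \<notin> half u" using step old_vert_disj[of s] by blast+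
    then have "h = z" using h(2) glinked_half[OF gu, of h z] by blast
    have "z \<in> half A" "z1 \<in> half A" using 2 step vert_subset[OF gA, of s] by blast+
    then have z: "z \<in> half Q" "z1 \<in> half Q" using \<open>z \<notin> half u\<close> \<open>z1 \<notin> half u\<close> by (auto simp: half_Q_iff)
    have "(x', z) \<in> glinked Q" using string_in_Q h(1) x'(1) z(1) \<open>h = z\<close> by simp
    moreover have "(z, z1) \<in> glinked Q"
      using 2 step linked_in[of s "verts Q \<union> joins Q" z z1] by (auto simp: verts_quotient)
    ultimately have "(x, z1) \<in> glinked Q" using x'(2) by (blast intro: linked_trans)
    then show ?thesis by (intro bexI[of _ z1] conjI exI[of _ z1] disjI1 linked_refl z(2) refl)
  next
    case 3
    have zz1: "(z, z1) \<in> string A u" by (rule linked_in[of s]) (use 3 step in auto)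
    show ?thesis
    proof (cases "h = z")
      case True
      then have "(x', z1) \<in> string A u" using h(1) zz1 by (blast intro: linked_trans)
      then show ?thesis using x' by blast
    next
      case False
      then have hz: "h \<in> half u" "(h, z) \<in> glinked u" using h(2) by auto
      then obtain K where K: "K \<in> comps u" "h \<in> K" using comp_exists[of h u] by blast
      then have "z \<in> K" using comp_linked_in[OF K(1,2)] hz by blast
      have ex: "h \<in> ext u" "z \<in> ext u"
        using hN hz outer_ext[OF 3 step(3)] glinked_half[OF gu hz(2)] by auto
      \<comment> \<open>The path enters the component at \<open>h\<close> and leaves it at
        \<open>z\<close>. With two legs the string simply continues through the component; with
        three legs the component is a vertex of the quotient, and \<open>z\<close> becomes the new
        last half-edge.\<close>
      from comp_ext_card[OF K(1)] show ?thesis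
      proof
        assume c: "card (ext u \<inter> K) = 2"
        then have "ext u \<inter> K \<in> links u" using K by (auto simp: links_def)
        then have "(h, z) \<in> string A u"
          using linked_in[of "ext u \<inter> K" "outer A u \<union> links u" h z] ex K \<open>z \<in> K\<close> by blast
        then have "(x', z1) \<in> string A u" using h(1) zz1 by (blast intro: linked_trans)
        then show ?thesis using x' by blast
      next
        assume c: "card (ext u \<inter> K) = 3"
        have "K \<notin> comps A"
        proof
          assume KA: "K \<in> comps A"
          have "(h, x') \<in> glinked A" using h(1) string_glinked by (blast intro: linked_sym)
          then have "x' \<in> K" using comp_linked_in[OF KA K(2)] by blast
          then show False using half_Q_comp[OF K(1) _ x'(1)] KA by blast
        qed
        note nv = new_vert_linked[OF K(1) this c ex(1) K(2) ex(2) \<open>z \<in> K\<close>]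
        have "(x', h) \<in> glinked Q" using string_in_Q[OF h(1) x'(1) nv(1)] .
        then have "(x, z) \<in> glinked Q" using x'(2) nv(3) by (blast intro: linked_trans)
        then show ?thesis using nv(2) zz1 by blast
      qed
    qed
  qed
qed

lemma glinked_Q_iff:
  assumes "x \<in> half Q" "y \<in> half Q"
  shows "(x, y) \<in> glinked Q \<longleftrightarrow> (x, y) \<in> glinked A"
proof
  assume "(x, y) \<in> glinked A"
  from path_projects[OF this assms(1)] obtain x' h where x': "x' \<in> half Q" "(x, x') \<in> glinked Q"
    and h: "(x', h) \<in> string A u" "h = y \<or> h \<in> half u \<and> (h, y) \<in> glinked u" by blast
  show "(x, y) \<in> glinked Q"
  proof (cases "h = y")
    case True
    then show ?thesis using string_in_Q[OF h(1) x'(1)] assms(2) x'(2) by (blast intro: linked_trans)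
  next
    case False
    then have hy: "h \<in> half u" "(h, y) \<in> glinked u" using h(2) by auto
    then obtain K where K: "K \<in> comps u" "h \<in> K" using comp_exists[of h u] by blast
    then have "y \<in> K" using comp_linked_in[OF K(1,2)] hy by blast
    then have y: "K \<notin> comps A" "card (ext u \<inter> K) = 3" "y \<in> ext u" using half_Q_comp[OF K(1) _ assms(2)] by blast+
    have "h \<in> ext u" using string_range[OF h(1) x'(1)] hy by blast
    note nv = new_vert_linked[OF K(1) y(1,2) this K(2) y(3) \<open>y \<in> K\<close>]
    show ?thesis using string_in_Q[OF h(1) x'(1) nv(1)] nv(3) x'(2) by (blast intro: linked_trans)
  qed
qed (use glinked_Q_A in blast)

lemma comps_Q_iff: "L' \<in> comps Q \<longleftrightarrow> (\<exists>L\<in>comps A. L' = L \<inter> half Q \<and> L \<inter> half Q \<noteq> {})"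
proof -
  have *: "glinked Q `` {x} = glinked A `` {x} \<inter> half Q" if "x \<in> half Q" for x
    using glinked_Q_iff[OF that] glinked_half[OF graph_Q _ that] by blast
  show ?thesis
  proof
    assume "L' \<in> comps Q"
    then obtain x where x: "x \<in> half Q" "L' = glinked Q `` {x}" by (auto simp: comps_iff)
    then have "L' = glinked A `` {x} \<inter> half Q" "x \<in> glinked A `` {x} \<inter> half Q" using *[OF x(1)] by auto
    then show "\<exists>L\<in>comps A. L' = L \<inter> half Q \<and> L \<inter> half Q \<noteq> {}"
    proof (intro bexI[of _ "glinked A `` {x}"] conjI)
      show "glinked A `` {x} \<in> comps A" using half_Q_sub x(1) unfolding comps_iff by blast
    qed blast+
  next
    assume "\<exists>L\<in>comps A. L' = L \<inter> half Q \<and> L \<inter> half Q \<noteq> {}"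
    then obtain L x where L: "L \<in> comps A" "L' = L \<inter> half Q" "x \<in> L" "x \<in> half Q" by blast
    then have "L' = glinked Q `` {x}" using comp_eq[OF L(1,3)] *[OF L(4)] by simp
    then show "L' \<in> comps Q" using L(4) by (auto simp: comps_iff)
  qed
qed

section \<open>External edges of the quotient, and when it is a Feynman graph\<close>

lemma trivalent_Q: "(\<And>v. v \<in> verts A \<Longrightarrow> card v = 3) \<Longrightarrow> v \<in> verts Q \<Longrightarrow> card v = 3"
  by (auto simp: verts_quotient new_verts_def)

text \<open>A string can meet a leg of \<open>A\<close> only on the far side of a component with two
  legs, which is what \<open>good\<close> forbids. The component is not a whole component of
  \<open>A\<close>, since it would then contain \<open>x\<close>.\<close>

lemma joined_string:
  assumes g: "good A u" and x: "x \<in> half Q" "x \<in> \<Union>(joins A)" and "(x, z) \<in> string A u"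
  shows "z \<in> \<Union>(joins A)"
  using assms(4)
proof (induction rule: linked_induct)
  case (step y z s)
  show ?case
  proof (cases "s \<in> outer A u")
    case True
    then show ?thesis using step outer_joins by blast
  next
    case False
    then obtain K where K: "K \<in> comps u" "s = ext u \<inter> K" "card (ext u \<inter> K) = 2"
      using step by (auto simp: links_def)
    have "K \<notin> comps A"
    proof
      assume KA: "K \<in> comps A"
      have "(y, x) \<in> glinked A" using step(1) string_glinked by (blast intro: linked_sym)
      then have "x \<in> K" using comp_linked_in[OF KA _ \<open>(y, x) \<in> glinked A\<close>] K(2) step by blast
      then show False using half_Q_comp[OF K(1) _ x(1)] KA by blast
    qed
    then have "s \<inter> ext A = {}" using g K unfolding good_def by blast
    moreover have "z \<in> half A" using step(4) K(2) half_sub by (auto simp: in_ext)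
    ultimately show ?thesis using step(4) by (auto simp: in_ext)
  qed
qed (fact x(2))

lemma string_finite: "x \<in> half A \<Longrightarrow> finite (string A u `` {x})"
proof (rule finite_subset[OF _ graph_finite[OF gA]])
  assume "x \<in> half A"
  then show "string A u `` {x} \<subseteq> half A" using string_glinked glinked_half[OF gA, of x] by blast
qed

text \<open>If the string out of a joined \<open>x\<close> had no second end, then every point of it
  would lie in an outer join and every point except \<open>x\<close> in a link, which
  \<open>no_lone_end\<close> excludes by parity.\<close>

lemma joined_Q:
  assumes g: "good A u" and x: "x \<in> half Q"
  shows "x \<in> \<Union>(joins Q) \<longleftrightarrow> x \<in> \<Union>(joins A)"
proof
  assume "x \<in> \<Union>(joins Q)"
  then obtain y where "(x, y) \<in> string A u" "x \<noteq> y" by (auto elim!: joins_QE intro: linked_sym)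
  then obtain s where "s \<in> outer A u \<union> links u" "x \<in> s" by (auto elim: linked_neq)
  then show "x \<in> \<Union>(joins A)" using half_Q_notin_links[OF x] outer_joins by blast
next
  assume xA: "x \<in> \<Union>(joins A)"
  show "x \<in> \<Union>(joins Q)"
  proof (rule ccontr)
    assume nx: "x \<notin> \<Union>(joins Q)"
    let ?Z = "string A u `` {x}"
    have Z: "z \<in> \<Union>(outer A u)" "z \<noteq> x \<Longrightarrow> z \<in> \<Union>(links u)" if z: "(x, z) \<in> string A u" for z
    proof -
      obtain e where e: "e \<in> joins A" "z \<in> e" using joined_string[OF g x xA z] by blast
      have N: "z \<in> half A - half u \<or> z \<in> ext u" by (rule string_range[OF z x])
      then have "z \<notin> \<Union>(joins u)" using join_subset[OF gu] by (auto simp: in_ext)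
      then show "z \<in> \<Union>(outer A u)" using outerI[OF e] e(2) by blast
      assume "z \<noteq> x"
      have "z \<notin> half Q"
      proof
        assume "z \<in> half Q"
        then have "{x, z} \<in> joins Q" using z x \<open>z \<noteq> x\<close> by (simp add: join_Q_iff)
        then show False using nx by blast
      qed
      then have zu: "z \<in> ext u" using N by (auto simp: half_Q_iff)
      then obtain K where K: "K \<in> comps u" "z \<in> K" using comp_exists[of z u] by (auto simp: in_ext)
      have "K \<notin> comps A"
      proof
        assume KA: "K \<in> comps A"
        have "(z, x) \<in> glinked A" using z string_glinked by (blast intro: linked_sym)
        then have "x \<in> K" using comp_linked_in[OF KA K(2)] by blast
        then show False using half_Q_comp[OF K(1) _ x] KA by blast
      qed
      then have "card (ext u \<inter> K) = 2"
        using comp_ext_card[OF K(1)] \<open>z \<notin> half Q\<close> zu K by (auto simp: half_Q_iff)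
      then show "z \<in> \<Union>(links u)" using K zu by (auto simp: links_def)
    qed
    show False
    proof (rule no_lone_end[of x ?Z])
      show "x \<notin> \<Union>(links u)" by (rule half_Q_notin_links[OF x])
      show "finite ?Z" using half_Q_sub x by (intro string_finite) blast
      show "?Z - {x} \<subseteq> \<Union>(links u)" using Z(2) by blast
      show "?Z \<subseteq> \<Union>(outer A u)" using Z(1) by blast
    qed (rule refl)
  qed
qed

text \<open>A leg of \<open>A\<close> inside \<open>u\<close> survives: its component is not
  deleted, because \<open>L\<close> meets the quotient, and by \<open>good\<close> it has three legs
  and turns into a vertex.\<close>

lemma ext_comp_in_Q:
  assumes g: "good A u" and L: "L \<in> comps A" "L \<inter> half Q \<noteq> {}"
  shows "ext Q \<inter> (L \<inter> half Q) = ext A \<inter> L"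
proof
  show "ext Q \<inter> (L \<inter> half Q) \<subseteq> ext A \<inter> L"
    using joined_Q[OF g] half_Q_sub by (auto simp: in_ext)
  show "ext A \<inter> L \<subseteq> ext Q \<inter> (L \<inter> half Q)"
  proof
    fix x assume x: "x \<in> ext A \<inter> L"
    have "x \<in> half Q"
    proof (cases "x \<in> half u")
      case True
      then have xe: "x \<in> ext u" using ext_A_u x by blast
      obtain K where K: "K \<in> comps u" "x \<in> K" using comp_exists[OF True] by blast
      have "K \<notin> comps A"
      proof
        assume KA: "K \<in> comps A"
        then have "K = L" using comp_disjoint[OF KA L(1), of x] K x by blast
        then show False using L(2) half_Q_comp[OF K(1)] KA by blast
      qed
      moreover from this have "card (ext u \<inter> K) \<noteq> 2" using g K x xe unfolding good_def by blast
      ultimately show ?thesis using comp_ext_card[OF K(1)] K xe by (auto simp: half_Q_iff)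
    qed (use x in \<open>auto simp: half_Q_iff in_ext\<close>)
    then show "x \<in> ext Q \<inter> (L \<inter> half Q)" using x joined_Q[OF g, of x] by (auto simp: in_ext)
  qed
qed

lemma feynman_Q:
  assumes g: "good A u" and fA: "feynman A"
  shows "feynman Q"
  unfolding feynman_iff
proof (intro conjI ballI)
  show "graph Q" by (rule graph_Q)
  show "card v = 3" if "v \<in> verts Q" for v
    using trivalent_Q that fA by (auto simp: feynman_iff)
  show "card (ext Q \<inter> K) \<in> {2, 3}" if K: "K \<in> comps Q" for K
  proof -
    obtain L where L: "L \<in> comps A" "K = L \<inter> half Q" "L \<inter> half Q \<noteq> {}"
      using K unfolding comps_Q_iff by blast
    then show ?thesis using ext_comp_in_Q[OF g L(1,3)] fA by (auto simp: feynman_iff)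
  qed
  show "\<not> v \<subseteq> ext Q" if v: "v \<in> verts Q" for v
  proof
    assume ve: "v \<subseteq> ext Q"
    have vA: "v \<inter> \<Union>(joins A) = {}"
    proof -
      have "x \<notin> \<Union>(joins A)" if "x \<in> v" for x
        using that ve joined_Q[OF g, of x] in_ext[of x Q] by blast
      then show ?thesis by blast
    qed
    show False
    proof (cases "v \<in> verts A")
      case True
      then have "v \<subseteq> ext A" using vA vert_subset[OF gA True] unfolding ext_def by blast
      then show False using True fA by (auto simp: feynman_iff)
    next
      case False
      then obtain K where K: "K \<in> comps u" "K \<notin> comps A" "card (ext u \<inter> K) = 3" "v = ext u \<inter> K"
        using v by (auto simp: verts_quotient elim: new_vertsE)
      obtain x where x: "x \<in> K" using comp_nonempty[OF K(1)] by blast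
      \<comment> \<open>None of the legs of \<open>K\<close> is joined in \<open>A\<close>, so
        nothing leads out of \<open>K\<close>; but then \<open>K\<close> would have been deleted
        instead of becoming a vertex.\<close>
      have "K \<in> comps A"
      proof (rule compI[OF x])
        show "x \<in> half A" using x comp_subset[OF gu K(1)] half_sub by blast
        show "(x, y) \<in> glinked A" if "y \<in> K" for y using comp_linked[OF K(1) x that] glinked_u_A by blast
        fix s assume s: "s \<in> verts A \<union> joins A" "s \<inter> K \<noteq> {}"
        then obtain y where y: "y \<in> s" "y \<in> K" by blast
        have yu: "y \<in> half u" using y comp_subset[OF gu K(1)] by blast
        have "s \<in> verts u \<union> joins u"
        proof (cases "s \<in> verts A")
          case True
          then show ?thesis using vert_u[OF True y(1) yu] by blast
        next
          case False
          then have sA: "s \<in> joins A" using s by blast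
          then have "y \<notin> v" using vA y by blast
          then have "y \<in> \<Union>(joins u)" using K(4) y yu by (auto simp: in_ext)
          then show ?thesis using join_u[OF sA y(1)] by blast
        qed
        then show "s \<subseteq> K" using comp_closed[OF K(1)] s(2) by blast
      qed
      then show False using K(2) by blast
    qed
  qed
qed

end

context contraction
begin

text \<open>
  An external edge of \<open>u\<close> in \<open>K\<close> that is joined in \<open>A\<close> is joined to another one, which leaves at
  most one external edge.
\<close>

lemma comp_common_ext:
  assumes fA: "feynman A" and K: "K \<in> comps u" "K \<in> comps A"
  shows "ext u \<inter> K = ext A \<inter> K"
proof
  show "ext A \<inter> K \<subseteq> ext u \<inter> K" using ext_A_u comp_subset[OF gu K(1)] by blast
  show "ext u \<inter> K \<subseteq> ext A \<inter> K"
  proof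
    fix x assume x: "x \<in> ext u \<inter> K"
    show "x \<in> ext A \<inter> K"
    proof (rule ccontr)
      assume "x \<notin> ext A \<inter> K"
      then have "x \<in> \<Union>(joins A)" using x half_sub by (auto simp: in_ext)
      then obtain y where y: "{x, y} \<in> joins A" "x \<noteq> y" by (rule join_partner[OF gA])
      have "y \<in> K" using comp_closed[OF K(2), of "{x, y}"] y x by blast
      have "y \<notin> \<Union>(joins u)" using join_u[OF y(1), of y] x by (auto simp: in_ext)
      then have "y \<in> ext u" using \<open>y \<in> K\<close> comp_subset[OF gu K(1)] by (auto simp: in_ext)
      have fin: "finite (ext u \<inter> K)"
        using graph_finite[OF gu] by (rule rev_finite_subset) (auto simp: in_ext)
      have "ext A \<inter> K \<subseteq> ext u \<inter> K - {x, y}"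
      proof -
        have "x \<notin> ext A" "y \<notin> ext A" using y(1) unfolding ext_def by blast+
        then show ?thesis using ext_A_u comp_subset[OF gu K(1)] by blast
      qed
      then have "card (ext A \<inter> K) \<le> card (ext u \<inter> K - {x, y})" using fin by (intro card_mono) auto
      also have "\<dots> = card (ext u \<inter> K) - 2"
        using x \<open>y \<in> K\<close> \<open>y \<in> ext u\<close> y(2) by (subst card_Diff_subset) auto
      also have "\<dots> \<le> 1" using comp_ext_card[OF K(1)] by auto
      finally show False using fA K(2) by (auto simp: feynman_iff)
    qed
  qed
qed

text \<open>
  If one external edge of a component \<open>K\<close> with two external edges is external in \<open>A\<close>, then
  removing the join at the other one separates \<open>K\<close> from the rest of \<open>A\<close>.
\<close>

lemma one_PI_good:
  assumes "one_PI A"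
  shows "good A u"
  unfolding good_def
proof (intro ballI impI)
  fix K assume K: "K \<in> comps u - comps A" "card (ext u \<inter> K) = 2"
  show "ext u \<inter> K \<inter> ext A = {}"
  proof (rule ccontr)
    assume "ext u \<inter> K \<inter> ext A \<noteq> {}"
    then obtain h where h: "h \<in> ext u" "h \<in> K" "h \<in> ext A" by blast
    obtain a b where ab: "ext u \<inter> K = {a, b}" "a \<noteq> b" using K(2) by (auto simp: card_2_iff)
    have "h \<in> {a, b}" using h ab(1) by blast
    then have "ext u \<inter> K = {h, if h = a then b else a}" "h \<noteq> (if h = a then b else a)"
      using ab by auto
    then obtain h' where h': "ext u \<inter> K = {h, h'}" "h \<noteq> h'" by blast
    have KA: "K \<subseteq> half A" using comp_subset[OF gu, of K] K half_sub by blast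
    have "h' \<in> ext u" "h' \<in> K" using h'(1) by blast+
    then have h'u: "h' \<in> half u" "h' \<notin> \<Union>(joins u)" by (simp_all add: in_ext)
    \<comment> \<open>The cells of \<open>A\<close> that meet \<open>K\<close> stay inside it, with
      the possible exception of the join at \<open>h'\<close>. That join is \<open>e\<close>; if
      \<open>h'\<close> is not joined, \<open>e\<close> is an arbitrary placeholder.\<close>
    have cl: "s \<subseteq> K" if s: "s \<in> verts A \<union> joins A" "s \<inter> K \<noteq> {}" "h' \<notin> \<Union>(joins A) \<or> s \<noteq> e" "h' \<in> \<Union>(joins A) \<Longrightarrow> e \<in> joins A \<and> h' \<in> e" for s e
    proof -
      obtain y where y: "y \<in> s" "y \<in> K" using s by blast
      have yu: "y \<in> half u" using y comp_subset[OF gu, of K] K by blast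
      have "s \<in> verts u \<union> joins u"
      proof (cases "s \<in> verts A")
        case True
        then show ?thesis using vert_u[OF True y(1) yu] by blast
      next
        case False
        then have sA: "s \<in> joins A" using s by blast
        show ?thesis
        proof (cases "y \<in> \<Union>(joins u)")
          case True
          then show ?thesis using join_u[OF sA y(1)] by blast
        next
          case F: False
          then have "y = h \<or> y = h'" using h' y yu by (auto simp: in_ext)
          then have "y = h'" using h(3) sA y by (auto simp: in_ext)
          then have "h' \<in> \<Union>(joins A)" using sA y by blast
          then have "s = e"
            using s(4) matching_unique[OF graph_matching[OF gA] sA, of e h'] y \<open>y = h'\<close> by blast
          then show ?thesis using s(3) \<open>h' \<in> \<Union>(joins A)\<close> by blast
        qed
      qed
      then show "s \<subseteq> K" using comp_closed[of K u s] K s(2) by blast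
    qed
    have linked: "(h, y) \<in> glinked A" if "y \<in> K" for y
      using comp_linked[of K u h y] K h that glinked_u_A by blast
    show False
    proof (cases "h' \<in> \<Union>(joins A)")
      case False
      have "K \<in> comps A"
        by (rule compI[of h]) (use h KA linked cl False in blast)+
      then show False using K by blast
    next
      case True
      then obtain k where k: "{h', k} \<in> joins A" "h' \<noteq> k" by (rule join_partner[OF gA])
      have "(h', k) \<in> linked (verts A \<union> (joins A - {{h', k}}))"
        using assms k(1) unfolding one_PI_iff[OF gA] by blast
      then have "k \<in> K"
      proof (rule linked_closed)
        show "h' \<in> K" using h' by blast
        fix s assume s: "s \<in> verts A \<union> (joins A - {{h', k}})" "s \<inter> K \<noteq> {}"
        show "s \<subseteq> K"
        proof (cases "s = {h', k}")
          case True
          then have "{h', k} \<in> verts A" using s by blast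
          then have "{h', k} \<in> verts u" using vert_u[of "{h', k}" h'] h'u by blast
          then show ?thesis using comp_closed[of K u s] K s(2) True by blast
        next
          case False
          show ?thesis by (rule cl[of s "{h', k}"]) (use s k False in auto)
        qed
      qed
      have "k \<notin> \<Union>(joins u)" using join_u[OF k(1), of k] h'u by blast
      then have "k \<in> ext u \<inter> K" using \<open>k \<in> K\<close> comp_subset[OF gu, of K] K by (auto simp: in_ext)
      then have "k = h" using h' k(2) by auto
      then show False using h(3) k(1) by (auto simp: in_ext)
    qed
  qed
qed

end

section \<open>Two nested subgraphs and the quotient of a quotient\<close>

locale tower =
  fixes A u w :: "'s graph"
  assumes gA: "graph A" and fu: "feynman u" and fw: "feynman w" and good: "good w u"
    and half_sub: "half w \<subseteq> half A" and verts_sub: "verts w \<subseteq> verts A" and joins_sub: "joins w \<subseteq> joins A"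
    and half_sub': "half u \<subseteq> half w" and verts_sub': "verts u \<subseteq> verts w" and joins_sub': "joins u \<subseteq> joins w"
begin

lemma gw: "graph w"
  using fw by (rule feynman_graph)

sublocale Aw: contraction A w
  by unfold_locales (fact gA fw half_sub verts_sub joins_sub)+

sublocale wu: contraction w u
  by unfold_locales (fact gw fu half_sub' verts_sub' joins_sub')+

sublocale Au: contraction A u
  by unfold_locales (use gA fu half_sub verts_sub joins_sub half_sub' verts_sub' joins_sub' in auto)

abbreviation "v \<equiv> wu.Q"

lemma feynman_v: "feynman v"
  by (rule wu.feynman_Q[OF good fw])

lemma comp_u_A_w:
  assumes K: "K \<in> comps u" "K \<in> comps A"
  shows "K \<in> comps w"
proof -
  obtain x where x: "x \<in> K" using comp_nonempty[OF K(1)] by blast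
  show ?thesis
  proof (rule compI[OF x])
    show "x \<in> half w" using x comp_subset[OF wu.gu K(1)] half_sub' by blast
    show "(x, y) \<in> glinked w" if "y \<in> K" for y using comp_linked[OF K(1) x that] wu.glinked_u_A by blast
    show "s \<subseteq> K" if "s \<in> verts w \<union> joins w" "s \<inter> K \<noteq> {}" for s
      using comp_closed[OF K(2), of s] that verts_sub joins_sub by blast
  qed
qed

lemma new_verts_w: "new_verts w u \<subseteq> new_verts A u"
  using comp_u_A_w by (auto simp: new_verts_def)

lemma half_v_sub: "half v \<subseteq> half Au.Q"
  using new_verts_w half_sub by (auto simp: half_quotient)

lemma verts_v_sub: "verts v \<subseteq> verts Au.Q"
  using new_verts_w verts_sub wu.old_vert_disj wu.vert_u
  by (auto simp: verts_quotient)

lemma string_w_A: "string w u \<subseteq> string A u"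
  by (rule linked_mono) (use joins_sub in \<open>auto simp: outer_def\<close>)

lemma joins_v_sub: "joins v \<subseteq> joins Au.Q"
proof
  fix e assume "e \<in> joins v"
  then obtain x y where "e = {x, y}" "x \<in> half v" "y \<in> half v" "x \<noteq> y" "(x, y) \<in> string w u"
    by (rule wu.joins_QE)
  then show "e \<in> joins Au.Q" using Au.join_Q_iff[of x y] half_v_sub string_w_A by blast
qed

sublocale Qv: contraction Au.Q v
  by unfold_locales (fact Au.graph_Q feynman_v half_v_sub verts_v_sub joins_v_sub)+

lemma subgraph_v: "subgraph v Au.Q"
  unfolding subgraph_def using feynman_v half_v_sub verts_v_sub joins_v_sub by blast

text \<open>Every component of \<open>w\<close> has a leg. If that leg lies in \<open>u\<close>,
  goodness forces its component in \<open>u\<close> to have three legs, so the leg survives the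
  contraction.\<close>

lemma comp_w_half_v:
  assumes K: "K \<in> comps w"
  shows "K \<inter> half v \<noteq> {} \<longleftrightarrow> K \<notin> comps u"
proof
  assume "K \<inter> half v \<noteq> {}"
  then show "K \<notin> comps u" using wu.half_Q_comp[of K] K by blast
next
  assume nK: "K \<notin> comps u"
  have "ext w \<inter> K \<noteq> {}" using fw K by (auto simp: feynman_iff)
  then obtain x where x: "x \<in> ext w" "x \<in> K" by blast
  have "x \<in> half v"
  proof (cases "x \<in> half u")
    case True
    then obtain K' where K': "K' \<in> comps u" "x \<in> K'" using comp_exists[of x u] by blast
    have xu: "x \<in> ext u" using wu.ext_A_u[OF True x(1)] .
    have nw: "K' \<notin> comps w" using comp_disjoint[OF _ K K'(2) x(2)] K'(1) nK by blast
    then have "card (ext u \<inter> K') \<noteq> 2" using good K' x xu unfolding good_def by blast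
    then show ?thesis using wu.comp_ext_card[OF K'(1)] nw K' xu unfolding wu.half_Q_iff by blast
  qed (use x in \<open>auto simp: wu.half_Q_iff in_ext\<close>)
  then show "K \<inter> half v \<noteq> {}" using x by blast
qed

lemma comps_v_iff: "K' \<in> comps v \<longleftrightarrow> (\<exists>K\<in>comps w - comps u. K' = K \<inter> half v)"
  unfolding wu.comps_Q_iff using comp_w_half_v by (metis Diff_iff)

lemma ext_v: "K \<in> comps w \<Longrightarrow> K \<notin> comps u \<Longrightarrow> ext v \<inter> (K \<inter> half v) = ext w \<inter> K"
  by (rule wu.ext_comp_in_Q[OF good]) (simp_all add: comp_w_half_v)

lemma ext_u_w: "K \<in> comps w \<Longrightarrow> K \<in> comps u \<Longrightarrow> ext u \<inter> K = ext w \<inter> K"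
  by (rule wu.comp_common_ext[OF fw])

lemma links_v: "links v = {ext w \<inter> K | K. K \<in> comps w \<and> K \<notin> comps u \<and> card (ext w \<inter> K) = 2}"
proof -
  have "l \<in> links v \<longleftrightarrow> (\<exists>K. K \<in> comps w \<and> K \<notin> comps u \<and> card (ext w \<inter> K) = 2 \<and> l = ext w \<inter> K)" for l
  proof
    assume "l \<in> links v"
    then obtain K' where K': "K' \<in> comps v" "card (ext v \<inter> K') = 2" "l = ext v \<inter> K'"
      by (auto simp: links_def)
    then obtain K where "K \<in> comps w" "K \<notin> comps u" "K' = K \<inter> half v" unfolding comps_v_iff by blast
    then show "\<exists>K. K \<in> comps w \<and> K \<notin> comps u \<and> card (ext w \<inter> K) = 2 \<and> l = ext w \<inter> K"
      using K' ext_v[of K] by auto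
  next
    assume "\<exists>K. K \<in> comps w \<and> K \<notin> comps u \<and> card (ext w \<inter> K) = 2 \<and> l = ext w \<inter> K"
    then obtain K where K: "K \<in> comps w" "K \<notin> comps u" "card (ext w \<inter> K) = 2" "l = ext w \<inter> K" by blast
    then have "K \<inter> half v \<in> comps v" unfolding comps_v_iff by blast
    then show "l \<in> links v" using K ext_v[OF K(1,2)] unfolding links_def by (metis (mono_tags, lifting) mem_Collect_eq)
  qed
  then show ?thesis by blast
qed

text \<open>By goodness the two legs are joined in \<open>w\<close> both or not at all, so no string
  passes between the inside and the outside of \<open>w\<close> at a link.\<close>

lemma link_inner:
  assumes K: "K \<in> comps u" "card (ext u \<inter> K) = 2" and x: "x \<in> ext u" "x \<in> K"
  shows "x \<in> \<Union>(joins w) \<longleftrightarrow> K \<notin> comps w"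
proof (cases "K \<in> comps w")
  case True
  then have "x \<in> ext w" using ext_u_w[OF True K(1)] x by blast
  then show ?thesis using True by (auto simp: in_ext)
next
  case False
  then have "x \<notin> ext w" using good K x unfolding good_def by blast
  moreover have "x \<in> half w" using x(1) half_sub' by (auto simp: in_ext)
  ultimately show ?thesis using False by (auto simp: in_ext)
qed

text \<open>Strings do not cross the boundary of \<open>w\<close>: a join of \<open>A\<close>
  belongs to \<open>w\<close> as soon as one of its ends is joined in \<open>w\<close>, and the
  links are covered by \<open>link_inner\<close>.\<close>

lemma string_inner:
  assumes "(x, z) \<in> string A u"
  shows "(x \<in> \<Union>(joins w) \<longleftrightarrow> z \<in> \<Union>(joins w)) \<and> (x \<in> \<Union>(joins w) \<longrightarrow> (x, z) \<in> string w u) \<and>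
    (x \<notin> \<Union>(joins w) \<longrightarrow> (x, z) \<in> string A w)"
  using assms
proof (induction rule: linked_induct)
  case (step y z s)
  have "(y \<in> \<Union>(joins w) \<longleftrightarrow> z \<in> \<Union>(joins w)) \<and> (y \<in> \<Union>(joins w) \<longrightarrow> s \<in> outer w u \<union> links u) \<and>
      (y \<notin> \<Union>(joins w) \<longrightarrow> s \<in> outer A w \<union> links w)"
  proof (cases "s \<in> outer A u")
    case True
    then have sA: "s \<in> joins A" by (rule Au.outer_joins)
    have "s \<in> joins w" if "t \<in> s" "t \<in> \<Union>(joins w)" for t
      using that Aw.join_u[OF sA] by blast
    then show ?thesis using step(3,4) True sA unfolding outer_def by blast
  next
    case False
    then obtain K where K: "K \<in> comps u" "card (ext u \<inter> K) = 2" "s = ext u \<inter> K"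
      using step by (auto simp: links_def)
    have "y \<in> \<Union>(joins w) \<longleftrightarrow> K \<notin> comps w" "z \<in> \<Union>(joins w) \<longleftrightarrow> K \<notin> comps w"
      using link_inner[OF K(1,2)] K(3) step(3,4) by blast+
    moreover have "s \<in> links u" using K by (auto simp: links_def)
    moreover have "s \<in> links w" if "K \<in> comps w"
      using that ext_u_w[OF that K(1)] K unfolding links_def by (metis (mono_tags, lifting) mem_Collect_eq)
    ultimately show ?thesis by blast
  qed
  then show ?case using step.IH step(3,4) linked_in[of s "outer w u \<union> links u" y z]
      linked_in[of s "outer A w \<union> links w" y z] linked_trans[of x y _ z] by blast
qed simp

lemma inner_half_v:
  assumes "x \<in> half Au.Q" "x \<in> \<Union>(joins w)"
  shows "x \<in> half v"
proof (cases "x \<in> half u")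
  case True
  then obtain K where K: "K \<in> comps u" "x \<in> K" using comp_exists[of x u] by blast
  have c: "card (ext u \<inter> K) = 3" "x \<in> ext u" using Au.half_Q_comp[OF K assms(1)] by auto
  have "K \<notin> comps w"
  proof
    assume "K \<in> comps w"
    then have "x \<in> ext w" using ext_u_w[OF _ K(1)] c K by blast
    then show False using assms(2) by (auto simp: in_ext)
  qed
  then show ?thesis using K c unfolding wu.half_Q_iff by blast
next
  case False
  then show ?thesis using assms(2) join_subset[OF gw] unfolding wu.half_Q_iff by blast
qed

text \<open>Such a string is a join of \<open>A / u\<close> or trivial, and a join at
  \<open>z\<close> cannot belong to \<open>v\<close>.\<close>

lemma string_not_join_v:
  assumes "(x, z) \<in> string A u" "x \<in> half Au.Q" "z \<in> half Au.Q" "z \<notin> \<Union>(joins v)"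
  shows "(x, z) \<in> string Au.Q v"
proof (cases "x = z")
  case False
  then have "{x, z} \<in> outer Au.Q v" using assms Au.join_Q_iff[of x z] by (auto simp: outer_def)
  then show ?thesis using linked_in[of "{x, z}" "outer Au.Q v \<union> links v" x z] by blast
qed simp

lemma string_Q_sub: "string Au.Q v \<subseteq> string A w"
proof (rule linked_least)
  fix s x y assume s: "s \<in> outer Au.Q v \<union> links v" "x \<in> s" "y \<in> s"
  show "(x, y) \<in> string A w"
  proof (cases "s \<in> links v")
    case True
    then have "s \<in> links w" unfolding links_v by (auto simp: links_def)
    then show ?thesis using s linked_in[of s "outer A w \<union> links w" x y] by blast
  next
    case False
    then have sQ: "s \<in> joins Au.Q" "s \<notin> joins v" using s by (auto simp: outer_def)
    show ?thesis
    proof (cases "x = y")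
      case ne: False
      have "s = {x, y}"
        using sQ(1) s(2,3) ne by (metis Au.joins_QE doubleton_eq_iff insertE singletonD)
      then have xy: "x \<in> half Au.Q" "y \<in> half Au.Q" "(x, y) \<in> string A u"
        using sQ Au.join_Q_iff[of x y] by auto
      \<comment> \<open>Otherwise the whole string would run inside \<open>w\<close> and
        \<open>{x, y}\<close> would be a join of \<open>v\<close>.\<close>
      have "x \<notin> \<Union>(joins w)"
      proof
        assume i: "x \<in> \<Union>(joins w)"
        then have "y \<in> \<Union>(joins w)" "(x, y) \<in> string w u" using string_inner[OF xy(3)] by blast+
        then have "{x, y} \<in> joins v"
          using inner_half_v i xy ne by (simp add: wu.join_Q_iff)
        then show False using sQ(2) \<open>s = {x, y}\<close> by blast
      qed
      then show ?thesis using string_inner[OF xy(3)] by blast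
    qed simp
  qed
qed

text \<open>A string relative to \<open>w\<close> is cut at those components of \<open>w\<close>
  that are not components of \<open>u\<close>. Between two cuts it is a string relative to
  \<open>u\<close>, hence a join of \<open>A / u\<close>. In the induction \<open>x'\<close> is the
  position of the last cut.\<close>

lemma string_Q_iff:
  assumes x: "x \<in> half Au.Q" "x \<notin> \<Union>(joins w)" and y: "y \<in> half Au.Q" "y \<notin> \<Union>(joins v)"
  shows "(x, y) \<in> string Au.Q v \<longleftrightarrow> (x, y) \<in> string A w"
proof
  assume "(x, y) \<in> string A w"
  then have "\<exists>x'\<in>half Au.Q. (x, x') \<in> string Au.Q v \<and> (x', y) \<in> string A u"
  proof (induction rule: linked_induct)
    case base
    show ?case by (intro bexI[of _ x] conjI linked_refl x)
  next
    case (step z z1 s)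
    then obtain x' where x': "x' \<in> half Au.Q" "(x, x') \<in> string Au.Q v" "(x', z) \<in> string A u" by blast
    have ext: "(x', z1) \<in> string A u" if "s \<in> outer A u \<union> links u"
      using linked_trans[OF x'(3) linked_in[OF that step(3,4)]] .
    show ?case
    proof (cases "s \<in> outer A w")
      case True
      then have "s \<in> outer A u" using joins_sub' by (auto simp: outer_def)
      then show ?thesis using ext x' by blast
    next
      case False
      then obtain K where K: "K \<in> comps w" "card (ext w \<inter> K) = 2" "s = ext w \<inter> K"
        using step by (auto simp: links_def)
      show ?thesis
      proof (cases "K \<in> comps u")
        case True
        then have "s \<in> links u" using K ext_u_w[OF K(1) True] unfolding links_def by (metis (mono_tags, lifting) mem_Collect_eq)
        then show ?thesis using ext x' by blast
      next
        case nu: False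
        then have s: "s = ext v \<inter> (K \<inter> half v)" "s \<in> links v"
          using K ext_v[OF K(1) nu] unfolding links_v by auto
        then have z: "z \<in> half Au.Q" "z1 \<in> half Au.Q" "z \<notin> \<Union>(joins v)"
          using step(3,4) half_v_sub by (auto simp: in_ext)
        have "(x', z) \<in> string Au.Q v" using string_not_join_v[OF x'(3,1) z(1,3)] .
        moreover have "(z, z1) \<in> string Au.Q v" by (rule linked_in[of s]) (use s(2) step(3,4) in auto)
        ultimately have "(x, z1) \<in> string Au.Q v" using x'(2) linked_trans by metis
        then show ?thesis by (intro bexI[of _ z1] conjI linked_refl z)
      qed
    qed
  qed
  then obtain x' where "x' \<in> half Au.Q" "(x, x') \<in> string Au.Q v" "(x', y) \<in> string A u" by blast
  then show "(x, y) \<in> string Au.Q v" using string_not_join_v[of x' y] y linked_trans by metis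
qed (use string_Q_sub in blast)

text \<open>The strings on both sides agree, so the only possible difference lies in the deletion of
  whole components: a component of \<open>w\<close> with three legs that becomes a component of
  \<open>A / u\<close> without being one of \<open>A\<close> would vanish on the left and give a
  vertex on the right. The assumption \<open>cond\<close> rules this out.\<close>

theorem quotient_quotient:
  assumes cond: "\<And>K. K \<in> comps w \<Longrightarrow> K \<notin> comps u \<Longrightarrow> K \<inter> half v \<in> comps Au.Q \<Longrightarrow> K \<in> comps A"
  shows "quotient_graph Au.Q v = quotient_graph A w"
proof -
  have comp_Q: "K \<inter> half v \<in> comps Au.Q \<longleftrightarrow> K \<in> comps A" if K: "K \<in> comps w" "K \<notin> comps u" for K
  proof
    assume KA: "K \<in> comps A"
    have "K \<inter> half Au.Q = K \<inter> half v"
    proof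
      show "K \<inter> half Au.Q \<subseteq> K \<inter> half v"
      proof
        fix x assume x: "x \<in> K \<inter> half Au.Q"
        show "x \<in> K \<inter> half v"
        proof (cases "x \<in> half u")
          case True
          then obtain K' where K': "K' \<in> comps u" "x \<in> K'" using comp_exists[of x u] by blast
          have "card (ext u \<inter> K') = 3" "x \<in> ext u" using Au.half_Q_comp[OF K'] x by auto
          moreover have "K' \<notin> comps w" using comp_disjoint[OF _ K(1) K'(2)] x K'(1) K(2) by blast
          ultimately have "x \<in> half v" using K' unfolding wu.half_Q_iff by blast
          then show ?thesis using x by blast
        next
          case False
          then have "x \<in> half v" using x comp_subset[OF gw K(1)] unfolding wu.half_Q_iff by blast
          then show ?thesis using x by blast
        qed
      qed
    qed (use half_v_sub in blast)
    then show "K \<inter> half v \<in> comps Au.Q"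
      using KA comp_w_half_v[OF K(1)] K(2) unfolding Au.comps_Q_iff by metis
  qed (rule cond[OF K])
  have verts: "verts Qv.Q = verts Aw.Q"
  proof -
    have "new_verts Au.Q v = {ext w \<inter> K | K. K \<in> comps w \<and> K \<notin> comps u \<and> K \<notin> comps A \<and> card (ext w \<inter> K) = 3}"
    proof -
      have "t \<in> new_verts Au.Q v \<longleftrightarrow> (\<exists>K. t = ext w \<inter> K \<and> K \<in> comps w \<and> K \<notin> comps u \<and> K \<notin> comps A \<and> card (ext w \<inter> K) = 3)" for t
      proof
        assume "t \<in> new_verts Au.Q v"
        then obtain K' where K': "K' \<in> comps v" "K' \<notin> comps Au.Q" "card (ext v \<inter> K') = 3" "t = ext v \<inter> K'"
          by (rule new_vertsE)
        then obtain K where "K \<in> comps w" "K \<notin> comps u" "K' = K \<inter> half v" unfolding comps_v_iff by blast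
        then show "\<exists>K. t = ext w \<inter> K \<and> K \<in> comps w \<and> K \<notin> comps u \<and> K \<notin> comps A \<and> card (ext w \<inter> K) = 3"
          using K' ext_v[of K] comp_Q[of K] by auto
      next
        assume "\<exists>K. t = ext w \<inter> K \<and> K \<in> comps w \<and> K \<notin> comps u \<and> K \<notin> comps A \<and> card (ext w \<inter> K) = 3"
        then obtain K where K: "t = ext w \<inter> K" "K \<in> comps w" "K \<notin> comps u" "K \<notin> comps A" "card (ext w \<inter> K) = 3" by blast
        have "K \<inter> half v \<in> comps v" unfolding comps_v_iff using K by blast
        then show "t \<in> new_verts Au.Q v"
          using new_vertsI[of "K \<inter> half v" v Au.Q] K ext_v[OF K(2,3)] comp_Q[OF K(2,3)] by simp
      qed
      then show ?thesis by blast
    qed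
    \<comment> \<open>Components common to \<open>u\<close> and \<open>w\<close> give vertices of
      \<open>A / u\<close> outside of \<open>v\<close>, which the second contraction leaves
      alone.\<close>
    moreover have "new_verts A u - new_verts w u = {ext w \<inter> K | K. K \<in> comps w \<and> K \<in> comps u \<and> K \<notin> comps A \<and> card (ext w \<inter> K) = 3}"
    proof -
      have "t \<in> new_verts A u - new_verts w u \<longleftrightarrow> (\<exists>K. t = ext w \<inter> K \<and> K \<in> comps w \<and> K \<in> comps u \<and> K \<notin> comps A \<and> card (ext w \<inter> K) = 3)" for t
      proof
        assume t: "t \<in> new_verts A u - new_verts w u"
        then obtain K where K: "K \<in> comps u" "K \<notin> comps A" "card (ext u \<inter> K) = 3" "t = ext u \<inter> K"
          by (blast elim: new_vertsE)
        then have "K \<in> comps w" using t new_vertsI[of K u w] by blast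
        then show "\<exists>K. t = ext w \<inter> K \<and> K \<in> comps w \<and> K \<in> comps u \<and> K \<notin> comps A \<and> card (ext w \<inter> K) = 3"
          using K ext_u_w[of K] by auto
      next
        assume "\<exists>K. t = ext w \<inter> K \<and> K \<in> comps w \<and> K \<in> comps u \<and> K \<notin> comps A \<and> card (ext w \<inter> K) = 3"
        then obtain K where K: "t = ext w \<inter> K" "K \<in> comps w" "K \<in> comps u" "K \<notin> comps A" "card (ext w \<inter> K) = 3" by blast
        then have t: "t = ext u \<inter> K" "card (ext u \<inter> K) = 3" using ext_u_w[of K] by auto
        have "t \<notin> new_verts w u"
        proof
          assume "t \<in> new_verts w u"
          then obtain K' where K': "K' \<in> comps u" "K' \<notin> comps w" "t = ext u \<inter> K'" by (rule new_vertsE)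
          have "t \<noteq> {}" using t by auto
          then obtain x where "x \<in> K" "x \<in> K'" using t K' by blast
          then have "K = K'" by (rule comp_disjoint[OF K(3) K'(1)])
          then show False using K K' by blast
        qed
        then show "t \<in> new_verts A u - new_verts w u" using new_vertsI[OF K(3,4)] t by simp
      qed
      then show ?thesis by blast
    qed
    moreover have "new_verts A w = {ext w \<inter> K | K. K \<in> comps w \<and> K \<notin> comps A \<and> card (ext w \<inter> K) = 3}"
      by (auto simp: new_verts_def)
    ultimately have "new_verts Au.Q v \<union> (new_verts A u - new_verts w u) = new_verts A w" by auto
    moreover have "verts Au.Q - verts v = (verts A - verts w) \<union> (new_verts A u - new_verts w u)"
      using Au.new_vert_notin verts_sub verts_sub' wu.new_vert_notin new_verts_w
      unfolding verts_quotient by blast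
    ultimately show ?thesis unfolding verts_quotient[of Au.Q v] verts_quotient[of A w] by blast
  qed
  have half: "half Qv.Q = half Aw.Q"
    using half_eq[OF Qv.graph_Q] half_eq[OF Aw.graph_Q] verts by simp
  have "(x, y) \<in> string Au.Q v \<longleftrightarrow> (x, y) \<in> string A w" if "x \<in> half Aw.Q" "y \<in> half Aw.Q" for x y
  proof (rule string_Q_iff)
    show "x \<in> half Au.Q" "y \<in> half Au.Q" using that half Qv.half_Q_sub by blast+
    show "x \<notin> \<Union>(joins w)" by (rule Aw.half_Q_unjoined[OF that(1)])
    show "y \<notin> \<Union>(joins v)" by (rule Qv.half_Q_unjoined) (use that half in simp)
  qed
  then have "joins Qv.Q = joins Aw.Q"
    unfolding Qv.joins_Q Aw.joins_Q half by (intro Collect_cong iff_exI conj_cong refl) simp_all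
  then show ?thesis using verts half by (intro graph.expand) simp
qed

text \<open>Goodness in \<open>A\<close> preserves legs, so \<open>K\<close> has the same legs as
  the component \<open>L\<close> of \<open>A\<close> over the same component of the quotient. All
  its legs are thus external in \<open>A\<close>, and no join leads out of \<open>K\<close>.\<close>

lemma comp_Q_good:
  assumes "good A u" "feynman A" "K \<in> comps w" "K \<notin> comps u" "K \<inter> half v \<in> comps Au.Q"
  shows "K \<in> comps A"
proof -
  have fQ: "feynman Au.Q" by (rule Au.feynman_Q[OF assms(1,2)])
  obtain L where L: "L \<in> comps A" "K \<inter> half v = L \<inter> half Au.Q" "L \<inter> half Au.Q \<noteq> {}"
    using assms(5) unfolding Au.comps_Q_iff by blast
  have "K \<inter> half v \<in> comps v" using assms(3,4) unfolding comps_v_iff by blast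
  then have "ext v \<inter> (K \<inter> half v) = ext Au.Q \<inter> (K \<inter> half v)"
    by (rule Qv.comp_common_ext[OF fQ _ assms(5)])
  then have ext: "ext w \<inter> K = ext A \<inter> L"
    using ext_v[OF assms(3,4)] Au.ext_comp_in_Q[OF assms(1) L(1,3)] L(2) by simp
  obtain x where x: "x \<in> K" using comp_nonempty[OF assms(3)] by blast
  show ?thesis
  proof (rule compI[OF x])
    show "x \<in> half A" using x comp_subset[OF gw assms(3)] half_sub by blast
    show "(x, y) \<in> glinked A" if "y \<in> K" for y using comp_linked[OF assms(3) x that] Aw.glinked_u_A by blast
    fix s assume s: "s \<in> verts A \<union> joins A" "s \<inter> K \<noteq> {}"
    then obtain y where y: "y \<in> s" "y \<in> K" by blast
    have yw: "y \<in> half w" using y comp_subset[OF gw assms(3)] by blast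
    have "s \<in> verts w \<union> joins w"
    proof (cases "s \<in> verts A")
      case True
      then show ?thesis using Aw.vert_u[OF True y(1) yw] by blast
    next
      case False
      then have sA: "s \<in> joins A" using s by blast
      then have "y \<notin> ext A" using y by (auto simp: in_ext)
      then have "y \<notin> ext w" using ext y by blast
      then have "y \<in> \<Union>(joins w)" using yw by (simp add: in_ext)
      then show ?thesis using Aw.join_u[OF sA y(1)] by blast
    qed
    then show "s \<subseteq> K" using comp_closed[OF assms(3)] s(2) by blast
  qed
qed

end

subsection \<open>Preimages of subgraphs of a quotient\<close>

lemma linked_avoid:
  assumes "(x, z) \<in> linked S" "\<And>t. t \<in> e \<Longrightarrow> (x, t) \<notin> linked S"
  shows "(x, z) \<in> linked (S - {e})"
  using assms(1)
proof (induction rule: linked_induct)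
  case (step y z s)
  have "s \<noteq> e" using step(1,3) assms(2)[of y] by blast
  then have "(y, z) \<in> linked (S - {e})" using linked_in[of s "S - {e}" y z] step by blast
  then show ?case using step.IH linked_trans by metis
qed simp

text \<open>Without its pair \<open>{x, h}\<close> the end \<open>x\<close> is isolated, which
  destroys the string from \<open>x\<close> to \<open>y\<close>. A string with other ends is
  disjoint from this one and never uses the pair.\<close>

lemma (in two_matchings) remove_end_edge:
  assumes x: "x \<notin> \<Union>M2" "y \<notin> \<Union>M2" "x \<noteq> y" "(x, y) \<in> linked (M1 \<union> M2)" "{x, h} \<in> M1"
    and x': "x' \<notin> \<Union>M2" "y' \<notin> \<Union>M2" "x' \<noteq> y'"
  shows "(x', y') \<in> linked ((M1 - {{x, h}}) \<union> M2) \<longleftrightarrow> (x', y') \<in> linked (M1 \<union> M2) \<and> {x', y'} \<noteq> {x, y}"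
proof
  assume c: "(x', y') \<in> linked ((M1 - {{x, h}}) \<union> M2)"
  have "linked ((M1 - {{x, h}}) \<union> M2) \<subseteq> linked (M1 \<union> M2)" by (rule linked_mono) blast
  moreover have "{x', y'} \<noteq> {x, y}"
  proof
    assume "{x', y'} = {x, y}"
    then have "(x, y) \<in> linked ((M1 - {{x, h}}) \<union> M2)" using c linked_sym by (auto simp: doubleton_eq_iff)
    then obtain s where s: "s \<in> (M1 - {{x, h}}) \<union> M2" "x \<in> s" using x(3) by (rule linked_neq)
    then have "s \<in> M1" "s \<noteq> {x, h}" using x(1) by blast+
    then show False using matching_unique[OF m1 _ x(5), of s x] s by blast
  qed
  ultimately show "(x', y') \<in> linked (M1 \<union> M2) \<and> {x', y'} \<noteq> {x, y}" using c by blast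
next
  assume c: "(x', y') \<in> linked (M1 \<union> M2) \<and> {x', y'} \<noteq> {x, y}"
  have ends: "z = x \<or> z = y" if "z \<notin> \<Union>M2" "(x, z) \<in> linked (M1 \<union> M2)" for z
    using end_unique[OF x(4) that(2) x(1,2) that(1) x(3)] by blast
  have "(x, x') \<notin> linked (M1 \<union> M2)"
  proof
    assume xx: "(x, x') \<in> linked (M1 \<union> M2)"
    then have "(x, y') \<in> linked (M1 \<union> M2)" using c linked_trans by metis
    then show False using ends[OF x'(1) xx] ends[OF x'(2)] x'(3) c by (auto simp: doubleton_eq_iff)
  qed
  have "(x', y') \<in> linked (M1 \<union> M2 - {{x, h}})"
  proof (rule linked_avoid)
    fix t assume "t \<in> {x, h}"
    then have "(x, t) \<in> linked (M1 \<union> M2)" using linked_in[of "{x, h}" "M1 \<union> M2" x t] x(5) by blast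
    then show "(x', t) \<notin> linked (M1 \<union> M2)"
      using \<open>(x, x') \<notin> linked (M1 \<union> M2)\<close> linked_sym linked_trans by metis
  qed (use c in blast)
  moreover have "linked (M1 \<union> M2 - {{x, h}}) \<subseteq> linked ((M1 - {{x, h}}) \<union> M2)" by (rule linked_mono) blast
  ultimately show "(x', y') \<in> linked ((M1 - {{x, h}}) \<union> M2)" by blast
qed

text \<open>Some half-edge of \<open>v\<close> is joined, necessarily to another half-edge of
  \<open>v\<close>, which would leave at most one leg.\<close>

lemma feynman_vert_not_comp:
  assumes f: "feynman G" and v: "v \<in> verts G"
  shows "v \<notin> comps G"
proof
  assume K: "v \<in> comps G"
  have g: "graph G" using f by (rule feynman_graph)
  obtain x where x: "x \<in> v" "x \<notin> ext G" using f v unfolding feynman_iff by blast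
  then have "x \<in> \<Union>(joins G)" using vert_subset[OF g v] by (auto simp: in_ext)
  then obtain y where y: "{x, y} \<in> joins G" "x \<noteq> y" by (rule join_partner[OF g])
  then have "y \<in> v" using comp_closed[OF K, of "{x, y}"] x by blast
  have c3: "card v = 3" using f v by (auto simp: feynman_iff)
  then have "finite v" by (simp add: card_ge_0_finite)
  have "ext G \<inter> v \<subseteq> v - {x, y}" using y(1) unfolding ext_def by blast
  then have "card (ext G \<inter> v) \<le> card (v - {x, y})" using \<open>finite v\<close> by (intro card_mono) auto
  also have "\<dots> = 1" using x \<open>y \<in> v\<close> y(2) c3 by (subst card_Diff_subset) auto
  finally show False using f K by (auto simp: feynman_iff)
qed

text \<open>The vertices of \<open>v\<close> that stand for components of \<open>u\<close> are
  dropped because the components themselves are put back.\<close>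

definition pre :: "'s graph \<Rightarrow> 's graph \<Rightarrow> 's graph \<Rightarrow> 's graph" where
  "pre A u v = Graph (half u \<union> half v) (verts u \<union> (verts v - new_verts A u))
     (joins u \<union> {e \<in> outer A u. \<exists>x\<in>\<Union>(joins v). \<exists>z\<in>e. (x, z) \<in> string A u})"

section \<open>The preimage of a subgraph of the quotient\<close>

locale preimage = contraction +
  fixes v
  assumes sub_v: "subgraph v Q"
begin

abbreviation "w \<equiv> pre A u v"

text \<open>The points on the strings that are joins of \<open>v\<close>. Together with the
  half-edges joined in \<open>u\<close> they will be the half-edges joined in the preimage.\<close>

definition "I = {z. \<exists>x\<in>\<Union>(joins v). (x, z) \<in> string A u}"

lemma v: "feynman v" "half v \<subseteq> half Q" "verts v \<subseteq> verts Q" "joins v \<subseteq> joins Q"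
  using sub_v by (auto simp: subgraph_def)

lemma gv: "graph v"
  using v(1) by (rule feynman_graph)

lemma I_trans: "z \<in> I \<Longrightarrow> (z, z') \<in> string A u \<Longrightarrow> z' \<in> I"
  unfolding I_def by (blast intro: linked_trans)

lemma I_cell: "s \<in> outer A u \<union> links u \<Longrightarrow> z \<in> s \<Longrightarrow> z' \<in> s \<Longrightarrow> z \<in> I \<Longrightarrow> z' \<in> I"
  using I_trans linked_in by metis

lemma joins_v_I: "x \<in> \<Union>(joins v) \<Longrightarrow> x \<in> I"
  unfolding I_def using linked_refl by fastforce

lemma IE:
  assumes "z \<in> I"
  obtains x y where "{x, y} \<in> joins v" "x \<in> half Q" "y \<in> half Q" "x \<noteq> y" "(x, y) \<in> string A u" "(x, z) \<in> string A u"
proof -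
  obtain x where x: "x \<in> \<Union>(joins v)" "(x, z) \<in> string A u" using assms by (auto simp: I_def)
  obtain y where y: "{x, y} \<in> joins v" using x(1) by (rule join_partner[OF gv])
  then have "{x, y} \<in> joins Q" using v(4) by blast
  then show ?thesis using that[of x y] x y unfolding join_Q_iff by blast
qed

text \<open>The string through \<open>z\<close> is a join of \<open>v\<close> and has both its ends
  in \<open>A / u\<close>, so \<open>string_joined\<close> applies.\<close>

lemma I_outer: "z \<in> I \<Longrightarrow> z \<in> \<Union>(outer A u)"
proof (elim IE)
  fix x y assume "x \<in> half Q" "y \<in> half Q" "x \<noteq> y" "(x, y) \<in> string A u" "(x, z) \<in> string A u"
  then show ?thesis using string_joined[of x y z] half_Q_notin_links by blast
qed

lemma I_range: "z \<in> I \<Longrightarrow> z \<in> half A - half u \<or> z \<in> ext u"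
proof (elim IE)
  fix x y assume "x \<in> half Q" "(x, z) \<in> string A u"
  then show ?thesis using string_range by blast
qed

text \<open>A string has no third end, so \<open>z\<close> is one of the two half-edges of the
  join.\<close>

lemma I_half_Q: "z \<in> I \<Longrightarrow> z \<in> half Q \<Longrightarrow> z \<in> \<Union>(joins v)"
proof (elim IE)
  fix x y assume *: "z \<in> half Q" "{x, y} \<in> joins v" "x \<in> half Q" "y \<in> half Q" "x \<noteq> y"
    "(x, y) \<in> string A u" "(x, z) \<in> string A u"
  then have "z = x \<or> z = y" using string_unique[of x y z] by blast
  then show ?thesis using *(2) by blast
qed

lemma I_half: "z \<in> I \<Longrightarrow> z \<in> half v \<or> z \<in> half u"
  using I_half_Q[of z] I_range[of z] join_subset[OF gv] half_Q_iff[of z] by (auto simp: in_ext)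

lemma half_w: "half w = half u \<union> half v"
  and verts_w: "verts w = verts u \<union> (verts v - new_verts A u)"
  by (simp_all add: pre_def)

lemma joins_w: "joins w = joins u \<union> {e \<in> outer A u. e \<inter> I \<noteq> {}}"
  by (auto simp: pre_def I_def)

lemma outer_w: "outer w u = {e \<in> outer A u. e \<inter> I \<noteq> {}}"
  unfolding outer_def[of w u] joins_w by (auto simp: outer_def)

lemma old_verts: "verts v - new_verts A u \<subseteq> verts A - verts u"
  using v(3) by (auto simp: verts_quotient)

lemma sub_A: "half w \<subseteq> half A" "verts w \<subseteq> verts A" "joins w \<subseteq> joins A"
  using half_sub half_Q_sub v(2) verts_sub old_verts joins_sub outer_joins
  by (auto simp: half_w verts_w joins_w)

lemma sub_u: "half u \<subseteq> half w" "verts u \<subseteq> verts w" "joins u \<subseteq> joins w"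
  by (auto simp: half_w verts_w joins_w)

lemma graph_w: "graph w"
proof (rule graphI)
  show "finite (half w)" using graph_finite[OF gA] sub_A finite_subset by blast
  show "\<Union>(verts w) = half w"
    unfolding half_w verts_w half_eq[OF gv] half_eq[OF gu]
    using new_vert_sub half_eq[OF gu] by blast
  show "{} \<notin> verts w" using sub_A vert_nonempty[OF gA] by blast
  show "t = t'" if "t \<in> verts w" "t' \<in> verts w" "x \<in> t" "x \<in> t'" for t t' x
    using vert_unique[OF gA, of t t' x] sub_A that by blast
  show "matching (joins w)" by (rule matching_subset[OF graph_matching[OF gA] sub_A(3)])
  show "e \<subseteq> half w" if e: "e \<in> joins w" for e
  proof (cases "e \<in> joins u")
    case True
    then show ?thesis using join_subset[OF gu] by (auto simp: half_w)
  next
    case False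
    then have "e \<in> outer A u" "e \<inter> I \<noteq> {}" using e by (auto simp: joins_w)
    then have "e \<subseteq> I" using I_cell[of e] by blast
    then show ?thesis using I_half unfolding half_w by blast
  qed
qed

sublocale wu: contraction w u
  by unfold_locales (fact graph_w fu sub_u)+

lemma joined_w: "z \<in> \<Union>(joins w) \<longleftrightarrow> z \<in> \<Union>(joins u) \<or> z \<in> I"
proof
  assume "z \<in> \<Union>(joins w)"
  then obtain e where e: "e \<in> joins w" "z \<in> e" by blast
  show "z \<in> \<Union>(joins u) \<or> z \<in> I"
  proof (cases "e \<in> joins u")
    case False
    then have "e \<in> outer A u" "e \<inter> I \<noteq> {}" using e by (auto simp: joins_w)
    then show ?thesis using I_cell[of e] e(2) by blast
  qed (use e in blast)
next
  assume "z \<in> \<Union>(joins u) \<or> z \<in> I"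
  then show "z \<in> \<Union>(joins w)"
  proof
    assume "z \<in> I"
    then obtain e where "e \<in> outer A u" "z \<in> e" using I_outer by blast
    then show ?thesis using \<open>z \<in> I\<close> by (auto simp: joins_w)
  qed (use sub_u in blast)
qed

lemma comp_u_A_w:
  assumes K: "K \<in> comps u" "K \<in> comps A"
  shows "K \<in> comps w"
proof -
  obtain x where x: "x \<in> K" using comp_nonempty[OF K(1)] by blast
  show ?thesis
  proof (rule compI[OF x])
    show "x \<in> half w" using x comp_subset[OF gu K(1)] sub_u by blast
    show "(x, y) \<in> glinked w" if "y \<in> K" for y using comp_linked[OF K(1) x that] wu.glinked_u_A by blast
    show "s \<subseteq> K" if "s \<in> verts w \<union> joins w" "s \<inter> K \<noteq> {}" for s
      using comp_closed[OF K(2), of s] that sub_A by blast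
  qed
qed

text \<open>The cells of \<open>w\<close> that could attach something to \<open>K\<close> are the
  added joins at its legs, and the ends of added joins lie in \<open>I\<close>.\<close>

lemma comp_w_if:
  assumes K: "K \<in> comps u" "ext u \<inter> K \<inter> I = {}"
  shows "K \<in> comps w"
proof -
  obtain x where x: "x \<in> K" using comp_nonempty[OF K(1)] by blast
  show ?thesis
  proof (rule compI[OF x])
    show "x \<in> half w" using x comp_subset[OF gu K(1)] sub_u by blast
    show "(x, y) \<in> glinked w" if "y \<in> K" for y using comp_linked[OF K(1) x that] wu.glinked_u_A by blast
    fix s assume s: "s \<in> verts w \<union> joins w" "s \<inter> K \<noteq> {}"
    then obtain y where y: "y \<in> s" "y \<in> K" by blast
    have yu: "y \<in> half u" using y comp_subset[OF gu K(1)] by blast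
    have "s \<in> verts u \<union> joins u"
    proof (cases "s \<in> verts w")
      case True
      then show ?thesis using wu.vert_u[OF True y(1) yu] by blast
    next
      case False
      then have sw: "s \<in> joins w" using s by blast
      have "y \<in> \<Union>(joins u)"
      proof (rule ccontr)
        assume n: "y \<notin> \<Union>(joins u)"
        then have "y \<in> I" using joined_w[of y] sw y by blast
        moreover have "y \<in> ext u" using n yu by (simp add: in_ext)
        ultimately show False using K(2) y by blast
      qed
      then show ?thesis using wu.join_u[OF sw y(1)] by blast
    qed
    then show "s \<subseteq> K" using comp_closed[OF K(1)] s(2) by blast
  qed
qed

lemma string_w: "z \<in> I \<Longrightarrow> (z, z') \<in> string A u \<Longrightarrow> (z, z') \<in> string w u"
proof -
  assume z: "z \<in> I" and "(z, z') \<in> string A u"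
  from this(2) show "(z, z') \<in> string w u"
  proof (induction rule: linked_induct)
    case (step y z' s)
    have "y \<in> I" using I_trans[OF z step(1)] .
    then have "s \<in> outer w u \<union> links u" using step(2,3) by (auto simp: outer_w)
    then show ?case using linked_in[OF _ step(3,4)] step.IH linked_trans by metis
  qed simp
qed

lemma string_w_A: "string w u \<subseteq> string A u"
  by (rule linked_mono) (auto simp: outer_w)

text \<open>If \<open>K\<close> were a component of \<open>w\<close>, then all joins of
  \<open>v\<close> at the vertex made from \<open>K\<close> would lead back to it, and this vertex
  alone would be a component of \<open>v\<close>.\<close>

lemma vert_v_not_comp:
  assumes K: "K \<in> comps u" "ext u \<inter> K \<in> verts v"
  shows "K \<notin> comps w"
proof
  assume Kw: "K \<in> comps w"
  let ?t = "ext u \<inter> K"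
  obtain x where x: "x \<in> ?t" using vert_nonempty[OF gv K(2)] by blast
  have tv: "?t \<subseteq> half v" using vert_subset[OF gv K(2)] .
  have "?t \<in> comps v"
  proof (rule compI[OF x])
    show "x \<in> half v" using x tv by blast
    show "(x, y) \<in> glinked v" if "y \<in> ?t" for y by (rule linked_in[of ?t]) (use K x that in auto)
    fix s assume s: "s \<in> verts v \<union> joins v" "s \<inter> ?t \<noteq> {}"
    then obtain a where a: "a \<in> s" "a \<in> ?t" by blast
    show "s \<subseteq> ?t"
    proof (cases "s \<in> verts v")
      case True
      then show ?thesis using vert_unique[OF gv True K(2)] a by blast
    next
      case False
      then have sv: "s \<in> joins v" using s by blast
      show ?thesis
      proof
        fix b assume b: "b \<in> s"
        show "b \<in> ?t"
        proof (cases "a = b")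
          case ne: False
          have "s = {a, b}" by (rule matching_partner[OF graph_matching[OF gv] sv a(1)]) (use b ne in auto)
          then have ab: "a \<in> half Q" "b \<in> half Q" "(a, b) \<in> string A u"
            using sv v(4) join_Q_iff[of a b] by auto
          have "a \<in> I" using joins_v_I sv a by blast
          then have "(a, b) \<in> glinked w" using string_w ab(3) wu.string_glinked by blast
          then have "b \<in> K" using comp_linked_in[OF Kw] a by blast
          then show ?thesis using half_Q_comp[OF K(1) _ ab(2)] by blast
        qed (use a in simp)
      qed
    qed
  qed
  then show False using feynman_vert_not_comp[OF v(1) K(2)] by blast
qed

text \<open>By \<open>comp_w_if\<close>, a component of \<open>u\<close> that is enlarged in
  \<open>w\<close> has a leg on a string of \<open>v\<close>, so the vertex made from it belongs to
  \<open>v\<close>. The converse is \<open>vert_v_not_comp\<close>.\<close>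

lemma new_verts_w: "new_verts w u = verts v \<inter> new_verts A u"
proof
  show "new_verts w u \<subseteq> verts v \<inter> new_verts A u"
  proof
    fix t assume "t \<in> new_verts w u"
    then obtain K where K: "K \<in> comps u" "K \<notin> comps w" "card (ext u \<inter> K) = 3" "t = ext u \<inter> K"
      by (rule new_vertsE)
    have KA: "K \<notin> comps A" using comp_u_A_w K by blast
    then have tA: "t \<in> new_verts A u" using new_vertsI[OF K(1) _ K(3)] K(4) by simp
    obtain z where z: "z \<in> t" "z \<in> I" using comp_w_if[OF K(1)] K by blast
    have "z \<in> half Q" using z(1) tA unfolding half_quotient by blast
    then have "z \<in> half v" using I_half_Q[OF z(2)] join_subset[OF gv] by blast
    then obtain t' where t': "t' \<in> verts v" "z \<in> t'" using vert_exists[OF gv] by blast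
    have "t = t'" by (rule vert_unique[OF graph_Q, of _ _ z]) (use t' v(3) tA z in \<open>auto simp: verts_quotient\<close>)
    then show "t \<in> verts v \<inter> new_verts A u" using t' tA by blast
  qed
  show "verts v \<inter> new_verts A u \<subseteq> new_verts w u"
  proof
    fix t assume t: "t \<in> verts v \<inter> new_verts A u"
    then obtain K where K: "K \<in> comps u" "card (ext u \<inter> K) = 3" "t = ext u \<inter> K"
      by (blast elim: new_vertsE)
    then have "K \<notin> comps w" using vert_v_not_comp[OF K(1)] t by blast
    then show "t \<in> new_verts w u" using new_vertsI[OF K(1) _ K(2)] K(3) by simp
  qed
qed

text \<open>Strings through \<open>I\<close> are the same in \<open>w\<close> as in
  \<open>A\<close>, and outside of \<open>I\<close> there are no outer joins of \<open>w\<close>, so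
  exactly the strings that were joins of \<open>v\<close> come back.\<close>

lemma quotient_pre: "quotient_graph w u = v"
proof -
  have verts: "verts wu.Q = verts v"
    unfolding verts_quotient new_verts_w using old_verts by (auto simp: verts_w)
  then have half: "half wu.Q = half v"
    using half_eq[OF wu.graph_Q] half_eq[OF gv] by simp
  have "joins wu.Q = joins v"
  proof
    show "joins wu.Q \<subseteq> joins v"
    proof
      fix e assume "e \<in> joins wu.Q"
      then obtain x y where e: "e = {x, y}" "x \<in> half wu.Q" "y \<in> half wu.Q" "x \<noteq> y" "(x, y) \<in> string w u"
        by (rule wu.joins_QE)
      from e(5,4) obtain s where s: "s \<in> outer w u \<union> links u" "x \<in> s" by (rule linked_neq)
      then have "s \<in> outer A u" "s \<inter> I \<noteq> {}" using wu.half_Q_notin_links[OF e(2)] by (auto simp: outer_w)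
      then have xI: "x \<in> I" using I_cell[of s] s(2) by blast
      have xy: "x \<in> half Q" "y \<in> half Q" "(x, y) \<in> string A u"
        using e half v(2) string_w_A by auto
      then obtain y' where y': "{x, y'} \<in> joins v" using I_half_Q[OF xI] by (meson join_partner[OF gv])
      have "{x, y} \<in> joins Q" using xy e(4) by (simp add: join_Q_iff)
      then have "y = y'" using y' v(4) matching_inj[OF matching_Q] by blast
      then show "e \<in> joins v" using y' e(1) by simp
    qed
    show "joins v \<subseteq> joins wu.Q"
    proof
      fix e assume e: "e \<in> joins v"
      then obtain x y where xy: "e = {x, y}" "x \<in> half Q" "y \<in> half Q" "x \<noteq> y" "(x, y) \<in> string A u"
        using v(4) by (blast elim: joins_QE)
      have "x \<in> I" using joins_v_I e xy(1) by blast
      then have "(x, y) \<in> string w u" using string_w xy(5) by blast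
      moreover have "x \<in> half v" "y \<in> half v" using join_subset[OF gv e] xy(1) by auto
      ultimately show "e \<in> joins wu.Q" using xy(1,4) half by (simp add: wu.join_Q_iff)
    qed
  qed
  then show ?thesis using verts half by (intro graph.expand) simp
qed

text \<open>A component with two legs that is enlarged in \<open>w\<close> lies on a string of
  \<open>v\<close>, so both its legs are in \<open>I\<close> and hence joined. This explains why
  \<open>tower\<close> asks for goodness of \<open>u\<close> in \<open>w\<close>: preimages have it
  in every Feynman graph.\<close>

lemma good_pre: "good w u"
  unfolding good_def
proof (intro ballI impI)
  fix K assume K: "K \<in> comps u - comps w" "card (ext u \<inter> K) = 2"
  obtain z where z: "z \<in> ext u" "z \<in> K" "z \<in> I" using comp_w_if[of K] K by blast
  have l: "ext u \<inter> K \<in> links u" using K by (auto simp: links_def)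
  have "y \<notin> ext w" if "y \<in> ext u \<inter> K" for y
  proof -
    have "y \<in> I" using I_cell[of "ext u \<inter> K" z y] l z that by blast
    then show ?thesis using joined_w[of y] by (auto simp: in_ext)
  qed
  then show "ext u \<inter> K \<inter> ext w = {}" by blast
qed

lemma feynman_pre: "feynman w"
  unfolding feynman_iff
proof (intro conjI ballI)
  show "graph w" by (rule graph_w)
  show "card t = 3" if "t \<in> verts w" for t
    using that fu v(1) by (auto simp: verts_w feynman_iff)
  show "\<not> t \<subseteq> ext w" if t: "t \<in> verts w" for t
  proof
    assume te: "t \<subseteq> ext w"
    show False
    proof (cases "t \<in> verts u")
      case True
      have "t \<subseteq> ext u" using te wu.ext_A_u vert_subset[OF gu True] by blast
      then show False using fu True by (auto simp: feynman_iff)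
    next
      case False
      then have tv: "t \<in> verts v" using t by (auto simp: verts_w)
      have "t \<subseteq> ext v"
      proof
        fix x assume x: "x \<in> t"
        then have "x \<notin> \<Union>(joins v)" using te joins_v_I[of x] joined_w[of x] by (auto simp: in_ext)
        then show "x \<in> ext v" using vert_subset[OF gv tv] x by (auto simp: in_ext)
      qed
      then show False using v(1) tv by (auto simp: feynman_iff)
    qed
  qed
  show "card (ext w \<inter> L) \<in> {2, 3}" if L: "L \<in> comps w" for L
  proof (cases "L \<inter> half v = {}")
    case False
    then have "L \<inter> half wu.Q \<noteq> {}" using quotient_pre by simp
    then have "ext wu.Q \<inter> (L \<inter> half wu.Q) = ext w \<inter> L" "L \<inter> half wu.Q \<in> comps wu.Q"
      using wu.ext_comp_in_Q[OF good_pre L] L unfolding wu.comps_Q_iff by blast+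
    then show ?thesis using v(1) unfolding quotient_pre feynman_iff by metis
  next
    case True
    \<comment> \<open>A component of \<open>w\<close> that does not meet \<open>v\<close> is a
      component of \<open>u\<close> with the same legs, because a string of \<open>v\<close> through
      one of them would lead into \<open>v\<close>.\<close>
    obtain x where x: "x \<in> L" using comp_nonempty[OF L] by blast
    have "x \<in> half u" using True x comp_subset[OF graph_w L] half_w by blast
    then obtain K where K: "K \<in> comps u" "x \<in> K" using comp_exists[of x u] by blast
    have KL: "K \<subseteq> L" by (rule wu.comp_u_sub[OF K L x])
    have KI: "ext u \<inter> K \<inter> I = {}"
    proof (rule ccontr)
      assume "ext u \<inter> K \<inter> I \<noteq> {}"
      then obtain z where z: "z \<in> K" "z \<in> I" by blast
      from z(2) obtain y y' where y: "{y, y'} \<in> joins v" "(y, z) \<in> string A u" by (rule IE)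
      have "y \<in> half v" "y \<in> I" using join_subset[OF gv y(1)] joins_v_I[of y] y(1) by blast+
      then have "(y, z) \<in> glinked w" using string_w y(2) wu.string_glinked by blast
      then have "y \<in> L" using comp_linked_in[OF L _ linked_sym] z(1) KL by (meson subsetD)
      then show False using \<open>y \<in> half v\<close> True by blast
    qed
    then have "K \<in> comps w" by (rule comp_w_if[OF K(1)])
    then have "K = L" by (rule comp_disjoint[OF _ L K(2) x])
    moreover have "ext w \<inter> K = ext u \<inter> K"
    proof
      show "ext w \<inter> K \<subseteq> ext u \<inter> K" using wu.ext_A_u comp_subset[OF gu K(1)] by blast
      have "z \<in> ext w" if "z \<in> ext u \<inter> K" for z
        using that KI joined_w[of z] sub_u by (auto simp: in_ext)
      then show "ext u \<inter> K \<subseteq> ext w \<inter> K" by blast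
    qed
    ultimately show ?thesis using fu K(1) by (auto simp: feynman_iff)
  qed
qed

sublocale tower A u w
  by unfold_locales (fact gA fu feynman_pre good_pre sub_A sub_u)+

end

section \<open>Recovering a subgraph from its quotient, and one-particle irreducibility\<close>

context tower
begin

text \<open>
  If a string of \<open>w\<close> did not leave \<open>u\<close>, then it would be closed, and together with the components
  of \<open>u\<close> on it it would form a component of \<open>w\<close> without external edges.
\<close>

lemma string_end:
  assumes e: "{a, b} \<in> outer w u"
  obtains x where "x \<in> half v" "(a, x) \<in> linked ((outer w u - {{a, b}}) \<union> links u)"
proof -
  let ?S = "(outer w u - {{a, b}}) \<union> links u"
  let ?Z = "linked ?S `` {a}"
  have "\<exists>x\<in>half v. x \<in> ?Z"
  proof (rule ccontr)
    assume "\<not> (\<exists>x\<in>half v. x \<in> ?Z)"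
    then have nZ: "x \<notin> half v" if "x \<in> ?Z" for x using that by blast
    have sub: "linked ?S \<subseteq> string w u" by (rule linked_mono) blast
    have ew: "{a, b} \<in> joins w" using e by (rule wu.outer_joins)
    have inner: "z \<in> \<Union>(joins w)" if "z \<in> ?Z" for z
      using string_inner[of a z] that sub string_w_A ew by blast
    have range: "z \<in> half w - half u \<or> z \<in> ext u" if "z \<in> ?Z" for z
    proof -
      have "(a, z) \<in> linked ?S" using that by simp
      then show ?thesis
      proof (induction rule: linked_induct)
        case base
        show ?case using wu.outer_half[OF e, of a] wu.outer_ext[OF e, of a] by blast
      next
        case (step y z s)
        then show ?case using wu.outer_half[of s z] wu.outer_ext[of s z] links_ext[of s] by blast
      qed
    qed
    have Zu: "z \<in> ext u" if z: "z \<in> ?Z" for z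
      using range[OF z] nZ[OF z] by (auto simp: wu.half_Q_iff)
    have Zlinks: "z \<in> \<Union>(links u)" if z: "z \<in> ?Z" for z
    proof -
      have "z \<in> half u" using Zu[OF z] by (simp add: in_ext)
      then obtain K where K: "K \<in> comps u" "z \<in> K" using comp_exists[of z u] by blast
      have "K \<notin> comps w"
      proof
        assume "K \<in> comps w"
        then have "z \<in> ext w" using ext_u_w[OF _ K(1)] K(2) Zu[OF z] by blast
        then show False using inner[OF z] by (auto simp: in_ext)
      qed
      then have "card (ext u \<inter> K) \<noteq> 3" using nZ[OF z] K Zu[OF z] unfolding wu.half_Q_iff by blast
      then have "card (ext u \<inter> K) = 2" using wu.comp_ext_card[OF K(1)] by blast
      then show ?thesis using K Zu[OF z] unfolding links_def by blast
    qed
    have aZ: "a \<in> ?Z" by simp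
    have closed: "s \<subseteq> ?Z" if s: "s \<in> ?S" "y \<in> s" "y \<in> ?Z" for s y
    proof
      fix t assume "t \<in> s"
      then show "t \<in> ?Z" using linked_trans[of a y ?S t] linked_in[OF s(1,2)] s(3) by blast
    qed
    have a_in: "a \<in> half w" using join_subset[OF gw ew] by blast
    have Zw: "?Z \<subseteq> half w" using range half_sub' by (auto simp: in_ext)
    show False
    proof (cases "b \<in> ?Z")
      case False
      \<comment> \<open>With \<open>{a, b}\<close> removed, \<open>a\<close> lies in no outer join,
        so it is an end with respect to the outer joins, and the parity argument applies with the
        two matchings exchanged.\<close>
      interpret M: two_matchings "links u" "outer w u - {{a, b}}"
        by unfold_locales (rule matching_links, rule matching_subset[OF wu.matching_outer], blast)
      show False
      proof (rule M.no_lone_end[of a ?Z])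
        show "a \<notin> \<Union>(outer w u - {{a, b}})"
          using matching_unique[OF wu.matching_outer _ e, of _ a] by blast
        show "finite ?Z" using Zw graph_finite[OF gw] finite_subset by blast
        show "?Z = linked (links u \<union> (outer w u - {{a, b}})) `` {a}" by (simp add: Un_commute)
        show "?Z \<subseteq> \<Union>(links u)" using Zlinks by blast
        show "?Z - {a} \<subseteq> \<Union>(outer w u - {{a, b}})"
        proof
          fix z assume z: "z \<in> ?Z - {a}"
          then obtain f where f: "f \<in> joins w" "z \<in> f" using inner by blast
          have "z \<notin> \<Union>(joins u)" using Zu z by (simp add: in_ext)
          then have "f \<in> outer w u" using wu.outerI[OF f] by blast
          moreover have "f \<noteq> {a, b}" using f(2) z False by blast
          ultimately show "z \<in> \<Union>(outer w u - {{a, b}})" using f(2) by blast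
        qed
      qed
    next
      case bZ: True
      let ?X = "\<Union>{K \<in> comps u. K \<inter> ?Z \<noteq> {}}"
      have ZX: "y \<in> ?X" if "y \<in> ?Z" for y
      proof -
        have "y \<in> half u" using Zu[OF that] by (simp add: in_ext)
        then obtain K where "K \<in> comps u" "y \<in> K" using comp_exists[of y u] by blast
        then show ?thesis using that by blast
      qed
      have XZ: "y \<in> ?Z" if y: "y \<in> ?X" "y \<in> ext u" for y
      proof -
        obtain K z where K: "K \<in> comps u" "y \<in> K" "z \<in> K" "z \<in> ?Z" using y by blast
        obtain l where l: "l \<in> links u" "z \<in> l" using Zlinks[OF K(4)] by blast
        then have "l = ext u \<inter> K" using link_comp[OF l K(1,3)] by blast
        then have "l \<subseteq> ?Z" "y \<in> l" using closed[OF _ l(2) K(4)] l(1) K(2) y(2) by blast+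
        then show ?thesis by blast
      qed
      have Xcl: "s \<subseteq> ?X" if s: "s \<in> verts w \<union> joins w" "s \<inter> ?X \<noteq> {}" for s
      proof -
        obtain y K where y: "y \<in> s" "y \<in> K" "K \<in> comps u" "K \<inter> ?Z \<noteq> {}" using s(2) by blast
        have yu: "y \<in> half u" using comp_subset[OF wu.gu y(3)] y(2) by blast
        show ?thesis
        proof (cases "s \<in> verts u \<union> joins u")
          case True
          then have "s \<subseteq> K" using comp_closed[OF y(3) True] y by blast
          then show ?thesis using y by blast
        next
          case False
          then have sw: "s \<in> joins w" using s(1) wu.vert_u[of s y] y(1) yu by blast
          then have so: "s \<in> outer w u" using False by (simp add: outer_def)
          then have "y \<in> ext u" using wu.outer_ext y(1) yu by blast
          then have yZ: "y \<in> ?Z" using XZ y by blast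
          have "s \<subseteq> ?Z"
          proof (cases "s = {a, b}")
            case True
            then show ?thesis using aZ bZ by blast
          next
            case False
            then show ?thesis using closed[of s y] so y(1) yZ by blast
          qed
          then show ?thesis using ZX by blast
        qed
      qed
      obtain L where L: "L \<in> comps w" "a \<in> L" using comp_exists[OF a_in] by blast
      have LX: "L \<subseteq> ?X" by (rule comp_least[OF L ZX[OF aZ]]) (fact Xcl)
      have "ext w \<inter> L \<noteq> {}" using fw L(1) by (auto simp: feynman_iff)
      then obtain y where y: "y \<in> ext w" "y \<in> L" by blast
      have "y \<in> ?X" using LX y(2) by blast
      moreover from this have "y \<in> half u" using comp_subset[OF wu.gu] by blast
      then have "y \<in> ext u" using wu.ext_A_u y(1) by blast
      ultimately have "y \<in> \<Union>(joins w)" using XZ inner by blast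
      then show False using y(1) by (simp add: in_ext)
    qed
  qed
  then show ?thesis using that by blast
qed

text \<open>The quotient remembers only strings with ends. Closed strings of joins would be lost, so
  every outer join of \<open>w\<close> must be shown to lie on a string with an end in
  \<open>v\<close>; this is the purpose of \<open>string_end\<close>.\<close>

lemma pre_quotient: "pre A u v = w"
proof -
  have vw: "half v \<subseteq> half w" by (rule wu.half_Q_sub)
  have half: "half u \<union> half v = half w"
    using vw half_sub' by (auto simp: wu.half_Q_iff)
  have "(verts w - verts u) \<inter> new_verts A u = {}"
    using Au.new_vert_notin verts_sub by blast
  then have verts: "verts u \<union> (verts v - new_verts A u) = verts w"
    using new_verts_w verts_sub' unfolding verts_quotient by blast
  have "{e \<in> outer A u. \<exists>x\<in>\<Union>(joins v). \<exists>z\<in>e. (x, z) \<in> string A u} = outer w u"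
  proof
    show "{e \<in> outer A u. \<exists>x\<in>\<Union>(joins v). \<exists>z\<in>e. (x, z) \<in> string A u} \<subseteq> outer w u"
    proof
      fix e assume "e \<in> {e \<in> outer A u. \<exists>x\<in>\<Union>(joins v). \<exists>z\<in>e. (x, z) \<in> string A u}"
      then obtain x z where e: "e \<in> outer A u" "x \<in> \<Union>(joins v)" "z \<in> e" "(x, z) \<in> string A u" by blast
      have "x \<in> half v" using e(2) join_subset[OF wu.graph_Q] by blast
      then have "x \<in> \<Union>(joins w)" using wu.joined_Q[OF good] e(2) by blast
      then have "z \<in> \<Union>(joins w)" using string_inner[OF e(4)] by blast
      then have "e \<in> joins w" using Aw.join_u[OF Au.outer_joins[OF e(1)] e(3)] by blast
      then show "e \<in> outer w u" using e(1) by (simp add: outer_def)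
    qed
    show "outer w u \<subseteq> {e \<in> outer A u. \<exists>x\<in>\<Union>(joins v). \<exists>z\<in>e. (x, z) \<in> string A u}"
    proof
      fix e assume e: "e \<in> outer w u"
      then obtain a b where ab: "e = {a, b}"
        using wu.matching_outer by (auto simp: matching_def card_2_iff)
      obtain x where x: "x \<in> half v" "(a, x) \<in> linked ((outer w u - {{a, b}}) \<union> links u)"
        using string_end e ab by blast
      have "linked ((outer w u - {{a, b}}) \<union> links u) \<subseteq> string A u"
        by (rule linked_mono) (use joins_sub in \<open>auto simp: outer_def\<close>)
      then have ax: "(a, x) \<in> string A u" using x(2) by blast
      have "a \<in> \<Union>(joins w)" using wu.outer_joins[OF e] ab by blast
      then have "x \<in> \<Union>(joins w)" using string_inner[OF ax] by blast
      then have "x \<in> \<Union>(joins v)" using wu.joined_Q[OF good x(1)] by blast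
      moreover have "(x, a) \<in> string A u" using ax by (rule linked_sym)
      moreover have "e \<in> outer A u" using e joins_sub by (auto simp: outer_def)
      ultimately show "e \<in> {e \<in> outer A u. \<exists>x\<in>\<Union>(joins v). \<exists>z\<in>e. (x, z) \<in> string A u}"
        using ab by blast
    qed
  qed
  then have joins: "joins u \<union> {e \<in> outer A u. \<exists>x\<in>\<Union>(joins v). \<exists>z\<in>e. (x, z) \<in> string A u} = joins w"
    using joins_sub' by (auto simp: outer_def)
  show ?thesis unfolding pre_def half verts joins by simp
qed

text \<open>
  Removing from \<open>w\<close> the first join of a string does not change the components, and it changes the
  quotient only by removing the join that is given by the string.
\<close>

lemma one_PI_quotient:
  assumes "one_PI w"
  shows "one_PI v"
  unfolding one_PI_def
proof
  fix e assume "e \<in> joins v"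
  then obtain x y where e: "e = {x, y}" "x \<in> half v" "y \<in> half v" "x \<noteq> y" "(x, y) \<in> string w u"
    by (rule wu.joins_QE)
  obtain h where h: "{x, h} \<in> outer w u"
    using wu.reach_end[OF e(5) wu.half_Q_notin_links[OF e(2)] wu.half_Q_notin_links[OF e(3)] e(4)] by blast
  let ?w = "Graph (half w) (verts w) (joins w - {{x, h}})"
  have hw: "{x, h} \<in> joins w" "{x, h} \<notin> joins u" using h by (auto simp: outer_def)
  have comps: "comps ?w = comps w" using assms hw(1) by (auto simp: one_PI_def)
  interpret w': contraction ?w u
  proof unfold_locales
    show "graph ?w" using gw by (auto simp: graph_def disjoint_def)
  qed (use fu half_sub' verts_sub' joins_sub' hw(2) in auto)
  have nv: "new_verts ?w u = new_verts w u" by (simp add: new_verts_def comps)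
  have half: "half w'.Q = half v" by (simp add: half_quotient nv)
  have verts: "verts w'.Q = verts v" by (simp add: verts_quotient nv)
  have outer: "outer ?w u = outer w u - {{x, h}}" by (auto simp: outer_def)
  have joins: "joins w'.Q = joins v - {e}"
  proof -
    have "(x', y') \<in> string ?w u \<longleftrightarrow> (x', y') \<in> string w u \<and> {x', y'} \<noteq> e"
      if "x' \<in> half v" "y' \<in> half v" "x' \<noteq> y'" for x' y'
      unfolding outer e(1)
      by (rule wu.remove_end_edge[OF _ _ e(4,5) h])
        (use wu.half_Q_notin_links e(2,3) that in blast)+
    then have "f \<in> joins w'.Q \<longleftrightarrow> f \<in> joins v - {e}" for f
      unfolding w'.joins_Q wu.joins_Q half by blast
    then show ?thesis by blast
  qed
  have "w'.Q = Graph (half v) (verts v) (joins v - {e})"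
    by (rule graph.expand) (simp add: half verts joins)
  then show "comps (Graph (half v) (verts v) (joins v - {e})) = comps v"
    using w'.comps_Q_iff wu.comps_Q_iff comps half by auto
qed

text \<open>For a join of \<open>u\<close> a detour exists in \<open>u\<close>. An outer join
  \<open>{x, y}\<close> lies on a string of \<open>v\<close>: along the rest of this string
  \<open>x\<close> and \<open>y\<close> still reach its ends \<open>p\<close> and \<open>q\<close>,
  and these are linked in \<open>v\<close> without the join \<open>{p, q}\<close>. That detour is
  then lifted to \<open>w\<close>.\<close>

lemma one_PI_preimage:
  assumes u: "one_PI u" and v: "one_PI v"
  shows "one_PI w"
  unfolding one_PI_iff[OF gw]
proof (intro ballI)
  fix e x y assume e: "e \<in> joins w" "x \<in> e" "y \<in> e"
  let ?D = "linked (verts w \<union> (joins w - {e}))"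
  show "(x, y) \<in> ?D"
  proof (cases "e \<in> joins u")
    case True
    then have "(x, y) \<in> linked (verts u \<union> (joins u - {e}))"
      using u e unfolding one_PI_iff[OF wu.gu] by blast
    moreover have "linked (verts u \<union> (joins u - {e})) \<subseteq> ?D"
      by (rule linked_mono) (use verts_sub' joins_sub' in blast)
    ultimately show ?thesis by blast
  next
    case False
    show ?thesis
    proof (cases "x = y")
      case ne: False
      have xy: "e = {x, y}"
        by (rule matching_partner[OF graph_matching[OF gw] e(1,2)]) (use e(3) ne in auto)
      have eo: "{x, y} \<in> outer w u" "{y, x} \<in> outer w u"
        using e(1) False xy by (auto simp: outer_def insert_commute)
      let ?S = "linked ((outer w u - {{x, y}}) \<union> links u)"
      obtain p where p: "p \<in> half v" "(x, p) \<in> ?S" using string_end[OF eo(1)] by blast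
      obtain q where q: "q \<in> half v" "(y, q) \<in> ?S"
        using string_end[OF eo(2)] by (auto simp: insert_commute)
      have uD: "glinked u \<subseteq> ?D"
        by (rule linked_mono) (use verts_sub' joins_sub' False in blast)
      have SD: "?S \<subseteq> ?D"
      proof (rule linked_least)
        fix s a b assume s: "s \<in> (outer w u - {{x, y}}) \<union> links u" "a \<in> s" "b \<in> s"
        show "(a, b) \<in> ?D"
        proof (cases "s \<in> links u")
          case True
          then obtain K where K: "K \<in> comps u" "s = ext u \<inter> K" by (auto simp: links_def)
          then show ?thesis using comp_linked[of K u a b] s uD by blast
        next
          case False
          then have "s \<in> verts w \<union> (joins w - {e})" using s(1) xy by (auto simp: outer_def)
          then show ?thesis using linked_in s by metis
        qed
      qed
      have Sst: "?S \<subseteq> string w u" by (rule linked_mono) blast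
      have xyst: "(x, y) \<in> string w u" using linked_in[of "{x, y}" "outer w u \<union> links u"] eo(1) by blast
      have pst: "(p, x) \<in> string w u" by (rule linked_sym[OF subsetD[OF Sst p(2)]])
      have qst: "(y, q) \<in> string w u" using q(2) Sst by blast
      have pq: "(p, q) \<in> string w u" using linked_trans[OF pst linked_trans[OF xyst qst]] .
      have "(p, q) \<in> ?D"
      proof (cases "p = q")
        case pq_ne: False
        let ?f = "{p, q}"
        have "?f \<in> joins v" using p q pq pq_ne by (simp add: wu.join_Q_iff)
        then have "(p, q) \<in> linked (verts v \<union> (joins v - {?f}))"
          using v unfolding one_PI_iff[OF wu.graph_Q] by blast
        moreover have "linked (verts v \<union> (joins v - {?f})) \<subseteq> ?D"
        proof (rule linked_least)
          fix s a b assume s: "s \<in> verts v \<union> (joins v - {?f})" "a \<in> s" "b \<in> s"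
          then consider "s \<in> verts w" | "s \<in> new_verts w u" | "s \<in> joins v" "s \<noteq> ?f"
            by (auto simp: verts_quotient)
          then show "(a, b) \<in> ?D"
          proof cases
            case 1
            then show ?thesis using linked_in[of s "verts w \<union> (joins w - {e})" a b] s by blast
          next
            case 2
            then obtain K where K: "K \<in> comps u" "s = ext u \<inter> K" by (rule new_vertsE)
            then show ?thesis using comp_linked[of K u a b] s uD by blast
          next
            case 3
            show ?thesis
            proof (cases "a = b")
              case ab_ne: False
              have ab: "s = {a, b}"
                by (rule matching_partner[OF wu.matching_Q 3(1) s(2)]) (use s(3) ab_ne in auto)
              then have abs: "a \<in> half v" "b \<in> half v" "(a, b) \<in> string w u"
                using 3(1) wu.join_Q_iff[of a b] by auto
              have ends: "t = p \<or> t = q" if "(p, t) \<in> string w u" "t \<in> half v" for t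
                using wu.string_unique[OF pq that(1) p(1) q(1) that(2) pq_ne] by blast
              have npa: "(p, a) \<notin> string w u"
              proof
                assume pa: "(p, a) \<in> string w u"
                then have "(p, b) \<in> string w u" using abs(3) linked_trans by metis
                then show False using ends[OF pa abs(1)] ends[OF _ abs(2)] ab_ne 3(2) ab by auto
              qed
              \<comment> \<open>The string of another join of \<open>v\<close> is disjoint from the
                string from \<open>p\<close> to \<open>q\<close>, so it does not use the removed
                join.\<close>
              have "(a, b) \<in> linked (outer w u \<union> links u - {{x, y}})"
              proof (rule linked_avoid[OF abs(3)])
                fix t assume "t \<in> {x, y}"
                then have "(p, t) \<in> string w u" using pst linked_trans[OF pst xyst] by blast
                then show "(a, t) \<notin> string w u" using npa linked_sym linked_trans by metis
              qed
              moreover have "linked (outer w u \<union> links u - {{x, y}}) \<subseteq> ?S"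
                by (rule linked_mono) blast
              ultimately show ?thesis using SD by blast
            qed simp
          qed
        qed
        ultimately show ?thesis by blast
      qed simp
      moreover have "(x, p) \<in> ?D" "(q, y) \<in> ?D"
        by (rule subsetD[OF SD p(2)], rule linked_sym[OF subsetD[OF SD q(2)]])
      ultimately show ?thesis using linked_trans by metis
    qed simp
  qed
qed

end

subsection \<open>Disjoint unions\<close>

definition gunion :: "'s graph \<Rightarrow> 's graph \<Rightarrow> 's graph" where
  "gunion G H = Graph (half G \<union> half H) (verts G \<union> verts H) (joins G \<union> joins H)"

definition grestrict :: "'s graph \<Rightarrow> 's set \<Rightarrow> 's graph" where
  "grestrict G X = Graph (half G \<inter> X) {v \<in> verts G. v \<subseteq> X} {e \<in> joins G. e \<subseteq> X}"

lemma gunion_simps [simp]: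
  "half (gunion G H) = half G \<union> half H" "verts (gunion G H) = verts G \<union> verts H"
  "joins (gunion G H) = joins G \<union> joins H"
  by (simp_all add: gunion_def)

lemma grestrict_simps [simp]:
  "half (grestrict G X) = half G \<inter> X" "verts (grestrict G X) = {v \<in> verts G. v \<subseteq> X}"
  "joins (grestrict G X) = {e \<in> joins G. e \<subseteq> X}"
  by (simp_all add: grestrict_def)

lemma gunion_commute: "gunion G H = gunion H G"
  by (auto simp: gunion_def)

lemma gunion_empty [simp]: "gunion G (Graph {} {} {}) = G" "gunion (Graph {} {} {}) G = G"
  by (auto simp: gunion_def intro: graph.expand)

lemma gunion_grestrict:
  assumes g: "graph G" and X: "\<And>s. s \<in> verts G \<union> joins G \<Longrightarrow> s \<inter> X \<noteq> {} \<Longrightarrow> s \<subseteq> X"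
  shows "G = gunion (grestrict G X) (grestrict G (- X))"
proof (rule graph.expand, intro conjI)
  show "half G = half (gunion (grestrict G X) (grestrict G (- X)))" by auto
  show "verts G = verts (gunion (grestrict G X) (grestrict G (- X)))" using X by (simp, blast)
  show "joins G = joins (gunion (grestrict G X) (grestrict G (- X)))" using X by (simp, blast)
qed

lemma graph_grestrict:
  assumes g: "graph G" and X: "\<And>s. s \<in> verts G \<union> joins G \<Longrightarrow> s \<inter> X \<noteq> {} \<Longrightarrow> s \<subseteq> X"
  shows "graph (grestrict G X)"
proof (rule graphI)
  show "finite (half (grestrict G X))" using graph_finite[OF g] by simp
  show "\<Union>(verts (grestrict G X)) = half (grestrict G X)"
  proof
    show "\<Union>(verts (grestrict G X)) \<subseteq> half (grestrict G X)" using vert_subset[OF g] by auto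
    show "half (grestrict G X) \<subseteq> \<Union>(verts (grestrict G X))"
    proof
      fix x assume x: "x \<in> half (grestrict G X)"
      then obtain v where v: "v \<in> verts G" "x \<in> v" using vert_exists[OF g, of x] by auto
      then have "v \<subseteq> X" using X[of v] x by auto
      then show "x \<in> \<Union>(verts (grestrict G X))" using v by auto
    qed
  qed
  show "{} \<notin> verts (grestrict G X)" using vert_nonempty[OF g] by auto
  show "v = v'" if "v \<in> verts (grestrict G X)" "v' \<in> verts (grestrict G X)" "x \<in> v" "x \<in> v'" for v v' x
    using vert_unique[OF g, of v v' x] that by auto
  show "e \<subseteq> half (grestrict G X)" if "e \<in> joins (grestrict G X)" for e
    using join_subset[OF g, of e] that by auto
  show "matching (joins (grestrict G X))" by (rule matching_subset[OF graph_matching[OF g]]) auto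
qed

lemma linked_Un_left:
  assumes "x \<in> X" "\<Union>S \<subseteq> X" "\<Union>T \<inter> X = {}"
  shows "(x, y) \<in> linked (S \<union> T) \<longleftrightarrow> (x, y) \<in> linked S"
proof
  assume "(x, y) \<in> linked (S \<union> T)"
  then have "y \<in> X \<and> (x, y) \<in> linked S"
  proof (induction rule: linked_induct)
    case (step y z s)
    then have "s \<in> S" using assms(3) by blast
    then show ?case using linked_in[of s S y z] step linked_trans assms(2) by (metis UnionI subsetD)
  qed (use assms(1) in simp)
  then show "(x, y) \<in> linked S" by simp
next
  have "linked S \<subseteq> linked (S \<union> T)" by (rule linked_mono) blast
  then show "(x, y) \<in> linked S \<Longrightarrow> (x, y) \<in> linked (S \<union> T)" by blast
qed

locale disjoint_graphs =
  fixes G H :: "'s graph"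
  assumes gG: "graph G" and gH: "graph H" and disj: "half G \<inter> half H = {}"
begin

lemma swap: "disjoint_graphs H G"
  using gG gH disj by (simp add: disjoint_graphs_def Int_commute)

lemma graph_gunion: "graph (gunion G H)"
proof (rule graphI)
  show "finite (half (gunion G H))" using graph_finite[OF gG] graph_finite[OF gH] by simp
  show "\<Union>(verts (gunion G H)) = half (gunion G H)" using half_eq[OF gG] half_eq[OF gH] by auto
  show "{} \<notin> verts (gunion G H)" using vert_nonempty[OF gG] vert_nonempty[OF gH] by auto
  show "v = v'" if "v \<in> verts (gunion G H)" "v' \<in> verts (gunion G H)" "x \<in> v" "x \<in> v'" for v v' x
  proof (cases "x \<in> half G")
    case True
    then have "v \<in> verts G" "v' \<in> verts G" using that vert_subset[OF gH] disj by auto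
    then show ?thesis using vert_unique[OF gG _ _ that(3,4)] by blast
  next
    case False
    then have "v \<in> verts H" "v' \<in> verts H" using that vert_subset[OF gG] by auto
    then show ?thesis using vert_unique[OF gH _ _ that(3,4)] by blast
  qed
  show "e \<subseteq> half (gunion G H)" if "e \<in> joins (gunion G H)" for e
    using join_subset[OF gG, of e] join_subset[OF gH, of e] that by auto
  show "matching (joins (gunion G H))"
    unfolding matching_def
  proof
    show "\<forall>e\<in>joins (gunion G H). card e = 2"
      using graph_matching[OF gG] graph_matching[OF gH] by (auto simp: matching_def)
    show "disjoint (joins (gunion G H))"
    proof (rule disjointI)
      fix e e' assume e: "e \<in> joins (gunion G H)" "e' \<in> joins (gunion G H)" "e \<noteq> e'"
      show "e \<inter> e' = {}"
      proof (rule ccontr)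
        assume "e \<inter> e' \<noteq> {}"
        then obtain x where x: "x \<in> e" "x \<in> e'" by blast
        show False
        proof (cases "x \<in> half G")
          case True
          then have "e \<in> joins G" "e' \<in> joins G" using e x join_subset[OF gH] disj by auto
          then show False using matching_unique[OF graph_matching[OF gG] _ _ x] e(3) by blast
        next
          case False
          then have "e \<in> joins H" "e' \<in> joins H" using e x join_subset[OF gG] by auto
          then show False using matching_unique[OF graph_matching[OF gH] _ _ x] e(3) by blast
        qed
      qed
    qed
  qed
qed

lemma linked_gunion_left:
  assumes "x \<in> half G" "J \<subseteq> joins G" "J' \<subseteq> joins H"
  shows "(x, y) \<in> linked ((verts G \<union> verts H) \<union> (J \<union> J')) \<longleftrightarrow> (x, y) \<in> linked (verts G \<union> J)"
proof -
  have "(x, y) \<in> linked ((verts G \<union> J) \<union> (verts H \<union> J')) \<longleftrightarrow> (x, y) \<in> linked (verts G \<union> J)"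
  proof (rule linked_Un_left[OF assms(1)])
    show "\<Union>(verts G \<union> J) \<subseteq> half G" using cell_subset[OF gG] assms(2) by blast
    show "\<Union>(verts H \<union> J') \<inter> half G = {}" using cell_subset[OF gH] assms(3) disj by blast
  qed
  then show ?thesis by (simp add: Un_ac)
qed

lemma glinked_gunion_left: "x \<in> half G \<Longrightarrow> (x, y) \<in> glinked (gunion G H) \<longleftrightarrow> (x, y) \<in> glinked G"
  using linked_gunion_left[of x "joins G" "joins H"] by simp

lemma comps_gunion: "comps (gunion G H) = comps G \<union> comps H"
proof -
  have "glinked (gunion G H) `` {x} = glinked G `` {x}" if "x \<in> half G" for x
    using glinked_gunion_left[OF that] by blast
  moreover have "glinked (gunion G H) `` {x} = glinked H `` {x}" if "x \<in> half H" for x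
    using disjoint_graphs.glinked_gunion_left[OF swap that] by (auto simp: gunion_commute[of H G])
  ultimately show ?thesis unfolding comps_linked quotient_def by (simp add: UN_Un)
qed

lemma ext_gunion: "ext (gunion G H) = ext G \<union> ext H"
proof -
  have "\<Union>(joins G) \<subseteq> half G" "\<Union>(joins H) \<subseteq> half H"
    using join_subset[OF gG] join_subset[OF gH] by blast+
  then show ?thesis using disj unfolding ext_def gunion_simps by blast
qed

lemma ext_gunion_left: "X \<subseteq> half G \<Longrightarrow> ext (gunion G H) \<inter> X = ext G \<inter> X"
  using disj by (auto simp: ext_gunion in_ext)

lemma ext_gunion_right: "X \<subseteq> half H \<Longrightarrow> ext (gunion G H) \<inter> X = ext H \<inter> X"
  using disj by (auto simp: ext_gunion in_ext)

lemma feynman_gunion: "feynman (gunion G H) \<longleftrightarrow> feynman G \<and> feynman H"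
proof -
  have ve: "v \<subseteq> ext (gunion G H) \<longleftrightarrow> v \<subseteq> ext G" if "v \<in> verts G" for v
    using ext_gunion_left[of v] vert_subset[OF gG that] by blast
  have ve': "v \<subseteq> ext (gunion G H) \<longleftrightarrow> v \<subseteq> ext H" if "v \<in> verts H" for v
    using ext_gunion_right[of v] vert_subset[OF gH that] by blast
  have "ext (gunion G H) \<inter> K = ext G \<inter> K" if "K \<in> comps G" for K
    by (rule ext_gunion_left[OF comp_subset[OF gG that]])
  moreover have "ext (gunion G H) \<inter> K = ext H \<inter> K" if "K \<in> comps H" for K
    by (rule ext_gunion_right[OF comp_subset[OF gH that]])
  ultimately show ?thesis
    using ve ve' gG gH graph_gunion by (auto simp: feynman_iff comps_gunion ball_Un)
qed

text \<open>One half of \<open>one_PI_gunion\<close>, stated so that the other half follows by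
  exchanging \<open>G\<close> and \<open>H\<close>.\<close>

lemma one_PI_gunion_left:
  "(\<forall>e\<in>joins G. \<forall>x\<in>e. \<forall>y\<in>e. (x, y) \<in> linked ((verts G \<union> verts H) \<union> (joins G \<union> joins H - {e}))) \<longleftrightarrow> one_PI G"
proof -
  have "(x, y) \<in> linked ((verts G \<union> verts H) \<union> (joins G \<union> joins H - {e})) \<longleftrightarrow>
      (x, y) \<in> linked (verts G \<union> (joins G - {e}))" if e: "e \<in> joins G" "x \<in> e" for e x y
  proof -
    have x: "x \<in> half G" using join_subset[OF gG e(1)] e(2) by blast
    show ?thesis
      using linked_gunion_left[OF x, of "joins G - {e}" "joins H - {e}" y] by (simp add: Un_Diff Diff_subset)
  qed
  then show ?thesis unfolding one_PI_iff[OF gG] by blast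
qed

lemma one_PI_gunion: "one_PI (gunion G H) \<longleftrightarrow> one_PI G \<and> one_PI H"
  using one_PI_gunion_left disjoint_graphs.one_PI_gunion_left[OF swap]
  unfolding one_PI_iff[OF graph_gunion] gunion_simps ball_Un by (simp only: Un_commute)

end

text \<open>Every cell of \<open>s\<close> is a cell of \<open>A\<close> or of \<open>B\<close>, so
  cutting \<open>s\<close> along \<open>half A\<close> cuts no cell.\<close>

lemma subgraph_gunion_split:
  assumes "disjoint_graphs A B" "subgraph s (gunion A B)"
  obtains a b where "s = gunion a b" "subgraph a A" "subgraph b B" "disjoint_graphs a b"
proof -
  interpret disjoint_graphs A B by (fact assms(1))
  have s: "feynman s" "half s \<subseteq> half A \<union> half B" "verts s \<subseteq> verts A \<union> verts B" "joins s \<subseteq> joins A \<union> joins B"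
    using assms(2) by (auto simp: subgraph_def)
  have gs: "graph s" using s(1) by (rule feynman_graph)
  have cl: "t \<subseteq> half A" if "t \<in> verts s \<union> joins s" "t \<inter> half A \<noteq> {}" for t
    using that s cell_subset[OF gG, of t] cell_subset[OF gH, of t] disj by blast
  have cl': "t \<subseteq> - half A" if "t \<in> verts s \<union> joins s" "t \<inter> - half A \<noteq> {}" for t
    using that cl[OF that(1)] by blast
  let ?a = "grestrict s (half A)" and ?b = "grestrict s (- half A)"
  have eq: "s = gunion ?a ?b" by (rule gunion_grestrict[OF gs cl])
  interpret ab: disjoint_graphs ?a ?b
    by unfold_locales (rule graph_grestrict[OF gs cl], assumption+, rule graph_grestrict[OF gs cl'], assumption+, auto)
  have f: "feynman ?a" "feynman ?b" using ab.feynman_gunion s(1) eq by simp_all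
  have A: "t \<in> verts A" if t: "t \<in> verts s" "t \<subseteq> half A" for t
    using t s(3) vert_nonempty[OF gs t(1)] vert_subset[OF gH, of t] disj by blast
  have B: "t \<in> verts B" if t: "t \<in> verts s" "t \<subseteq> - half A" for t
    using t s(3) vert_nonempty[OF gs t(1)] vert_subset[OF gG, of t] by blast
  have ne: "t \<noteq> {}" if "t \<in> joins s" for t
    using graph_matching[OF gs] that by (auto simp: matching_def)
  have A': "t \<in> joins A" if t: "t \<in> joins s" "t \<subseteq> half A" for t
    using t s(4) ne[OF t(1)] join_subset[OF gH, of t] disj by blast
  have B': "t \<in> joins B" if t: "t \<in> joins s" "t \<subseteq> - half A" for t
    using t s(4) ne[OF t(1)] join_subset[OF gG, of t] by blast
  show ?thesis
    by (rule that[OF eq])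
      (use f s(2) A B A' B' in \<open>auto simp: subgraph_def ab.disjoint_graphs_axioms\<close>)
qed

lemma contraction_if_subgraph: "graph A \<Longrightarrow> subgraph u A \<Longrightarrow> contraction A u"
  by unfold_locales (auto simp: subgraph_def)

lemma subgraph_gunion:
  assumes "disjoint_graphs A B" "subgraph a A" "subgraph b B"
  shows "subgraph (gunion a b) (gunion A B)" "disjoint_graphs a b"
proof -
  interpret AB: disjoint_graphs A B by (fact assms(1))
  show "disjoint_graphs a b"
    by unfold_locales (use assms AB.disj in \<open>auto simp: subgraph_def feynman_graph\<close>)
  then show "subgraph (gunion a b) (gunion A B)"
    using disjoint_graphs.feynman_gunion[of a b] assms by (auto simp: subgraph_def)
qed

text \<open>Components, legs and strings never mix \<open>A\<close> and \<open>B\<close>, so each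
  ingredient of the quotient is a union of two parts.\<close>

lemma quotient_gunion:
  assumes AB: "disjoint_graphs A B" and a: "subgraph a A" and b: "subgraph b B"
  shows "quotient_graph (gunion A B) (gunion a b) = gunion (quotient_graph A a) (quotient_graph B b)"
proof -
  interpret AB: disjoint_graphs A B by (fact AB)
  interpret ab: disjoint_graphs a b by (rule subgraph_gunion(2)[OF assms])
  interpret a: contraction A a by (rule contraction_if_subgraph[OF AB.gG a])
  interpret b: contraction B b by (rule contraction_if_subgraph[OF AB.gH b])
  interpret c: contraction "gunion A B" "gunion a b"
    by (rule contraction_if_subgraph[OF AB.graph_gunion subgraph_gunion(1)[OF assms]])
  have cA: "K \<in> comps a \<Longrightarrow> K \<notin> comps B" for K
    using comp_nonempty[of K a] comp_subset[OF ab.gG, of K] comp_subset[OF AB.gH, of K] a.half_sub AB.disj by blast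
  have cB: "K \<in> comps b \<Longrightarrow> K \<notin> comps A" for K
    using comp_nonempty[of K b] comp_subset[OF ab.gH, of K] comp_subset[OF AB.gG, of K] b.half_sub AB.disj by blast
  have eA: "K \<in> comps a \<Longrightarrow> ext (gunion a b) \<inter> K = ext a \<inter> K" for K
    by (rule ab.ext_gunion_left[OF comp_subset[OF ab.gG]])
  have eB: "K \<in> comps b \<Longrightarrow> ext (gunion a b) \<inter> K = ext b \<inter> K" for K
    by (rule ab.ext_gunion_right[OF comp_subset[OF ab.gH]])
  have nv: "new_verts (gunion A B) (gunion a b) = new_verts A a \<union> new_verts B b"
  proof -
    have "t \<in> new_verts (gunion A B) (gunion a b) \<longleftrightarrow> t \<in> new_verts A a \<union> new_verts B b" for t
      unfolding new_verts_def AB.comps_gunion ab.comps_gunion using cA cB eA eB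
      by (auto; metis)
    then show ?thesis by blast
  qed
  have links: "links (gunion a b) = links a \<union> links b"
  proof -
    have "t \<in> links (gunion a b) \<longleftrightarrow> t \<in> links a \<union> links b" for t
      unfolding links_def ab.comps_gunion using eA eB by (auto; metis)
    then show ?thesis by blast
  qed
  have jdisj: "joins A \<inter> joins b = {}" "joins B \<inter> joins a = {}"
  proof -
    have "e \<noteq> {}" if "e \<in> joins A \<union> joins B" for e
      using that graph_matching[OF AB.gG] graph_matching[OF AB.gH] by (auto simp: matching_def)
    moreover have "e \<subseteq> half A \<inter> half B" if "e \<in> joins A \<inter> joins b \<union> joins B \<inter> joins a" for e
      using that join_subset[OF AB.gG, of e] join_subset[OF AB.gH, of e] a.joins_sub b.joins_sub by blast
    ultimately show "joins A \<inter> joins b = {}" "joins B \<inter> joins a = {}" using AB.disj by blast+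
  qed
  then have outer: "outer (gunion A B) (gunion a b) = outer A a \<union> outer B b"
    by (auto simp: outer_def)
  have half: "half c.Q = half a.Q \<union> half b.Q"
    unfolding half_quotient nv gunion_simps using a.half_sub b.half_sub AB.disj by blast
  have vdisj: "verts A \<inter> verts b = {}" "verts B \<inter> verts a = {}"
    using vert_nonempty[OF AB.gG] vert_nonempty[OF AB.gH] vert_subset[OF AB.gG] vert_subset[OF AB.gH]
      a.verts_sub b.verts_sub AB.disj by blast+
  then have verts: "verts c.Q = verts a.Q \<union> verts b.Q"
    unfolding verts_quotient nv gunion_simps by blast
  have rA: "\<Union>(outer A a \<union> links a) \<subseteq> half A"
  proof -
    have "ext a \<subseteq> half A" using a.half_sub by (auto simp: in_ext)
    then show ?thesis using a.outer_half links_ext[of _ a] by blast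
  qed
  have rB: "\<Union>(outer B b \<union> links b) \<subseteq> half B"
  proof -
    have "ext b \<subseteq> half B" using b.half_sub by (auto simp: in_ext)
    then show ?thesis using b.outer_half links_ext[of _ b] by blast
  qed
  have S: "outer (gunion A B) (gunion a b) \<union> links (gunion a b) = (outer A a \<union> links a) \<union> (outer B b \<union> links b)"
    unfolding outer links by blast
  have sA: "(x, y) \<in> string (gunion A B) (gunion a b) \<longleftrightarrow> (x, y) \<in> string A a" if "x \<in> half A" for x y
    unfolding S by (rule linked_Un_left[OF that rA]) (use rB AB.disj in blast)
  have sB: "(x, y) \<in> string (gunion A B) (gunion a b) \<longleftrightarrow> (x, y) \<in> string B b" if "x \<in> half B" for x y
    unfolding S Un_commute[of "outer A a \<union> links a"]
    by (rule linked_Un_left[OF that rB]) (use rA AB.disj in blast)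
  have stA: "y \<in> half A" if "(x, y) \<in> string A a" "x \<in> half A" for x y
    using that a.string_glinked glinked_half[OF AB.gG, of x y] by blast
  have stB: "y \<in> half B" if "(x, y) \<in> string B b" "x \<in> half B" for x y
    using that b.string_glinked glinked_half[OF AB.gH, of x y] by blast
  have "joins c.Q = joins a.Q \<union> joins b.Q"
  proof
    show "joins c.Q \<subseteq> joins a.Q \<union> joins b.Q"
    proof
      fix e assume "e \<in> joins c.Q"
      then obtain x y where e: "e = {x, y}" "x \<in> half c.Q" "y \<in> half c.Q" "x \<noteq> y" "(x, y) \<in> string (gunion A B) (gunion a b)"
        by (rule c.joins_QE)
      show "e \<in> joins a.Q \<union> joins b.Q"
      proof (cases "x \<in> half A")
        case True
        then have st: "(x, y) \<in> string A a" using sA e(5) by blast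
        then have "y \<in> half A" by (rule stA[OF _ True])
        then have "x \<in> half a.Q" "y \<in> half a.Q" using True e(2,3) b.half_Q_sub AB.disj unfolding half by blast+
        then show ?thesis using st e(1,4) a.join_Q_iff by simp
      next
        case False
        then have xB: "x \<in> half b.Q" "x \<in> half B" using e(2) a.half_Q_sub b.half_Q_sub unfolding half by blast+
        then have st: "(x, y) \<in> string B b" using sB e(5) by blast
        then have "y \<in> half B" by (rule stB[OF _ xB(2)])
        then have "y \<in> half b.Q" using e(3) a.half_Q_sub AB.disj unfolding half by blast
        then show ?thesis using st e(1,4) xB b.join_Q_iff by simp
      qed
    qed
    show "joins a.Q \<union> joins b.Q \<subseteq> joins c.Q"
    proof
      fix e assume "e \<in> joins a.Q \<union> joins b.Q"
      then show "e \<in> joins c.Q"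
      proof
        assume "e \<in> joins a.Q"
        then obtain x y where e: "e = {x, y}" "x \<in> half a.Q" "y \<in> half a.Q" "x \<noteq> y" "(x, y) \<in> string A a"
          by (rule a.joins_QE)
        then show ?thesis using sA[of x y] a.half_Q_sub half by (auto simp: c.join_Q_iff)
      next
        assume "e \<in> joins b.Q"
        then obtain x y where e: "e = {x, y}" "x \<in> half b.Q" "y \<in> half b.Q" "x \<noteq> y" "(x, y) \<in> string B b"
          by (rule b.joins_QE)
        then show ?thesis using sB[of x y] b.half_Q_sub half by (auto simp: c.join_Q_iff)
      qed
    qed
  qed
  then show ?thesis using half verts by (intro graph.expand) simp
qed

lemma feynman_empty: "feynman (Graph {} {} {})"
  by (auto simp: feynman_iff graph_def partition_on_def comps_iff)

lemma one_PI_empty: "one_PI (Graph {} {} {})"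
  by (simp add: one_PI_def)

lemma graph_empty_half: "graph G \<Longrightarrow> half G = {} \<Longrightarrow> G = Graph {} {} {}"
proof (rule graph.expand)
  assume g: "graph G" and h: "half G = {}"
  have "verts G = {}" using vert_nonempty[OF g] vert_subset[OF g] h by blast
  moreover have "joins G = {}"
    using graph_matching[OF g] join_subset[OF g] h by (force simp: matching_def)
  ultimately show "half G = half (Graph {} {} {}) \<and> verts G = verts (Graph {} {} {}) \<and> joins G = joins (Graph {} {} {})"
    using h by simp
qed

lemma subgraph_empty: "subgraph (Graph {} {} {}) G"
  by (simp add: subgraph_def feynman_empty)

text \<open>Without components there are no links, and a string is at most a single join.\<close>

lemma quotient_empty:
  assumes g: "graph G"
  shows "quotient_graph G (Graph {} {} {}) = G"
proof -
  interpret contraction G "Graph {} {} {}" by (rule contraction_if_subgraph[OF g subgraph_empty])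
  have nv: "new_verts G (Graph {} {} {}) = {}" by (auto simp: new_verts_def comps_iff)
  have l: "links (Graph {} {} {}) = {}" by (auto simp: links_def comps_iff)
  have half: "half Q = half G" and verts: "verts Q = verts G"
    by (simp_all add: half_quotient verts_quotient nv)
  have o: "outer G (Graph {} {} {}) = joins G" by (simp add: outer_def)
  have joined: "{x, y} \<in> joins G" if "(x, y) \<in> linked (joins G)" "x \<noteq> y" for x y
  proof -
    have "x = y \<or> {x, y} \<in> joins G"
      using that(1)
    proof (induction rule: linked_induct)
      case (step y z s)
      show ?case
      proof (cases "y = z")
        case False
        have s: "s = {y, z}"
          by (rule matching_partner[OF graph_matching[OF g] step(2,3)]) (use step(4) False in auto)
        from step.IH show ?thesis
        proof
          assume "{x, y} \<in> joins G"
          then have "{x, y} = s" using matching_unique[OF graph_matching[OF g] _ step(2), of "{x, y}" y] step(3) by blast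
          then show ?thesis using s by (auto simp: doubleton_eq_iff)
        qed (use s step in simp)
      qed (use step in simp)
    qed simp
    then show ?thesis using that by simp
  qed
  have "joins Q = joins G"
  proof
    show "joins Q \<subseteq> joins G" using joined by (auto simp: l o elim!: joins_QE)
    show "joins G \<subseteq> joins Q"
    proof
      fix e assume e: "e \<in> joins G"
      then obtain x y where xy: "e = {x, y}" "x \<noteq> y"
        using graph_matching[OF g] by (auto simp: matching_def card_2_iff)
      have "(x, y) \<in> linked (joins G)" by (rule linked_in[OF e]) (use xy in auto)
      then show "e \<in> joins Q" using xy join_subset[OF g e] half by (simp add: join_Q_iff l o)
    qed
  qed
  then show ?thesis using half verts by (intro graph.expand) simp
qed

lemma quotient_self: "quotient_graph G G = Graph {} {} {}"
proof -
  have "new_verts G G = {}" by (auto simp: new_verts_def)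
  then show ?thesis by (simp add: quotient_graph_def)
qed

subsection \<open>Relabeling\<close>

text \<open>Turns an isomorphism of labeled objects into a permutation of all labels, which acts on
  subobjects and quotients alike and has an inverse of the same kind. Outside of \<open>X\<close>
  the labels \<open>g\<close> X -
  X\<open>have to be filled up, for which there is room because\<close>X\<open>and\<close>g
  \<open>X\<close> have equal size.\<close>

lemma ex_bij_extension:
  assumes "finite X" "inj_on g X"
  obtains f :: "'s \<Rightarrow> 's" where "bij f" "\<And>x. x \<in> X \<Longrightarrow> f x = g x"
proof -
  let ?U = "X \<union> g ` X"
  have "card (?U - X) = card (?U - g ` X)"
    using assms by (simp add: card_Diff_subset card_image)
  then obtain h where h: "bij_betw h (?U - X) (?U - g ` X)"
    using finite_same_card_bij[of "?U - X" "?U - g ` X"] assms(1) by auto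
  have g: "bij_betw g X (g ` X)" using assms(2) by (simp add: inj_on_imp_bij_betw)
  define f where "f x = (if x \<in> X then g x else if x \<in> ?U then h x else x)" for x
  have "bij_betw f X (g ` X)" using g by (rule bij_betw_cong[THEN iffD1, rotated]) (simp add: f_def)
  moreover have "bij_betw f (?U - X) (?U - g ` X)"
    using h by (rule bij_betw_cong[THEN iffD1, rotated]) (auto simp: f_def)
  ultimately have "bij_betw f (X \<union> (?U - X)) (g ` X \<union> (?U - g ` X))"
    by (rule bij_betw_combine) auto
  moreover have "bij_betw f (- ?U) (- ?U)"
    by (rule bij_betw_cong[THEN iffD1, rotated, OF bij_betw_id]) (auto simp: f_def)
  ultimately have "bij_betw f (X \<union> (?U - X) \<union> - ?U) (g ` X \<union> (?U - g ` X) \<union> - ?U)"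
    by (rule bij_betw_combine) auto
  moreover have "X \<union> (?U - X) \<union> - ?U = UNIV" "g ` X \<union> (?U - g ` X) \<union> - ?U = UNIV" by auto
  ultimately have "bij f" by simp
  then show ?thesis using that by (simp add: f_def)
qed

lemma ex_bij_into:
  assumes "finite X" "finite Z" "card X \<le> card Z"
  obtains f :: "'s \<Rightarrow> 's" where "bij f" "f ` X \<subseteq> Z"
proof -
  obtain g where g: "inj_on g X" "g ` X \<subseteq> Z" using card_le_inj[OF assms] by blast
  obtain f where "bij f" "\<And>x. x \<in> X \<Longrightarrow> f x = g x" using ex_bij_extension[OF assms(1) g(1)] by blast
  then show ?thesis using that g(2) by (metis image_cong)
qed

text \<open>An infinite label set leaves room for a copy disjoint from \<open>Y\<close>.\<close>

lemma ex_bij_avoiding: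
  fixes X Y :: "'s::infinite set"
  assumes "finite X" "finite Y"
  obtains f where "bij f" "f ` X \<inter> Y = {}"
proof -
  have "infinite (- Y)" using assms(2) infinite_UNIV by (metis Compl_eq_Diff_UNIV Diff_infinite_finite)
  then obtain Z where "finite Z" "card Z = card X" "Z \<subseteq> - Y"
    using infinite_arbitrarily_large[of "- Y" "card X"] by blast
  then show ?thesis using ex_bij_into[of X Z] assms(1) that by (metis disjoint_eq_subset_Compl order.refl order.trans)
qed

section \<open>The action of label permutations on graphs\<close>

definition gmap :: "('s \<Rightarrow> 's) \<Rightarrow> 's graph \<Rightarrow> 's graph" where
  "gmap f G = Graph (f ` half G) ((`) f ` verts G) ((`) f ` joins G)"

lemma gmap_simps [simp]:
  "half (gmap f G) = f ` half G" "verts (gmap f G) = (`) f ` verts G" "joins (gmap f G) = (`) f ` joins G"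
  by (simp_all add: gmap_def)

lemma gmap_inv [simp]:
  assumes "bij f"
  shows "gmap (inv f) (gmap f G) = G" "gmap f (gmap (inv f) G) = G"
  using assms by (simp_all add: gmap_def image_image inv_f_f bij_is_inj surj_f_inv_f bij_is_surj)

lemma linked_image_from:
  assumes "inj f" "(a, b) \<in> linked ((`) f ` S)" "a = f x"
  shows "\<exists>y. b = f y \<and> (x, y) \<in> linked S"
  using assms(2)
proof (induction rule: linked_induct)
  case base
  show ?case using assms(3) by (intro exI[of _ x]) simp
next
  case (step b c s)
  obtain y where y1: "b = f y" "(x, y) \<in> linked S" using step.IH by blast
  obtain s' where "s' \<in> S" "s = f ` s'" using step(2) by blast
  note y = y1 this
  obtain z where z: "c = f z" "z \<in> s'" using step(4) y(4) by blast
  have "y \<in> s'" using step(3) y(1,4) assms(1) by (simp add: inj_image_mem_iff)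
  then have "(y, z) \<in> linked S" using linked_in y(3) z(2) by metis
  then show ?case using z y(2) linked_trans by metis
qed

lemma linked_image:
  assumes "inj f"
  shows "(f x, f y) \<in> linked ((`) f ` S) \<longleftrightarrow> (x, y) \<in> linked S"
proof
  assume "(f x, f y) \<in> linked ((`) f ` S)"
  from linked_image_from[OF assms this refl] show "(x, y) \<in> linked S" using assms by (auto dest: injD)
next
  assume "(x, y) \<in> linked S"
  then show "(f x, f y) \<in> linked ((`) f ` S)"
  proof (induction rule: linked_induct)
    case (step y z s)
    have "(f y, f z) \<in> linked ((`) f ` S)" by (rule linked_in[of "f ` s"]) (use step in auto)
    then show ?case using step.IH linked_trans by metis
  qed simp
qed

lemma linked_image_Image: "inj f \<Longrightarrow> linked ((`) f ` S) `` {f x} = f ` (linked S `` {x})"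
  using linked_image_from[of f "f x" _ S x] linked_image[of f x _ S] by auto

context
  fixes f :: "'s \<Rightarrow> 's"
  assumes f: "bij f"
begin

lemma inj_f: "inj f"
  using f by (rule bij_is_inj)

lemma inj_image_f: "inj ((`) f)"
  by (rule injI) (use inj_f in \<open>simp add: inj_image_eq_iff\<close>)

lemma comps_gmap: "comps (gmap f G) = (`) f ` comps G"
proof -
  have "glinked (gmap f G) `` {f x} = f ` (glinked G `` {x})" for x
    using linked_image_Image[OF inj_f, of "verts G \<union> joins G" x] by (simp add: image_Un)
  moreover have "comps G = (\<lambda>x. glinked G `` {x}) ` half G" for G :: "'s graph"
    by (auto simp: comps_iff)
  ultimately show ?thesis by (simp add: image_image)
qed

lemma ext_gmap: "ext (gmap f G) = f ` ext G"
  using inj_f by (simp add: ext_def image_set_diff image_Union)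

lemma ext_comp_gmap: "ext (gmap f G) \<inter> f ` K = f ` (ext G \<inter> K)"
  using inj_f by (simp add: ext_gmap image_Int)

lemma card_f: "card (f ` X) = card X"
  using inj_f by (meson card_image inj_on_subset subset_UNIV)

lemma graph_gmap:
  assumes g: "graph G"
  shows "graph (gmap f G)"
proof (rule graphI)
  show "finite (half (gmap f G))" using graph_finite[OF g] by simp
  show "\<Union>(verts (gmap f G)) = half (gmap f G)" using half_eq[OF g] by (simp add: image_Union)
  show "{} \<notin> verts (gmap f G)" using vert_nonempty[OF g] by auto
  show "v = v'" if v: "v \<in> verts (gmap f G)" "v' \<in> verts (gmap f G)" "x \<in> v" "x \<in> v'" for v v' x
  proof -
    obtain t t' where t: "t \<in> verts G" "v = f ` t" "t' \<in> verts G" "v' = f ` t'" using v by auto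
    then obtain y where "x = f y" "y \<in> t" using v by blast
    moreover then have "y \<in> t'" using t v inj_f by (simp add: inj_image_mem_iff)
    ultimately show ?thesis using vert_unique[OF g t(1,3)] t by blast
  qed
  show "e \<subseteq> half (gmap f G)" if "e \<in> joins (gmap f G)" for e using join_subset[OF g] that by auto
  have m: "matching (joins G)" by (rule graph_matching[OF g])
  show "matching (joins (gmap f G))"
    unfolding matching_def
  proof
    show "\<forall>e\<in>joins (gmap f G). card e = 2" using m by (auto simp: matching_def card_f)
    show "disjoint (joins (gmap f G))"
    proof (rule disjointI)
      fix e e' assume e: "e \<in> joins (gmap f G)" "e' \<in> joins (gmap f G)" "e \<noteq> e'"
      then obtain t t' where t: "t \<in> joins G" "e = f ` t" "t' \<in> joins G" "e' = f ` t'" by auto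
      then have "t \<inter> t' = {}" using e(3) matching_unique[OF m t(1,3)] by blast
      then show "e \<inter> e' = {}" using t inj_f by (simp flip: image_Int)
    qed
  qed
qed

lemma feynman_gmap:
  assumes "feynman G"
  shows "feynman (gmap f G)"
  using assms graph_gmap
  by (auto simp: feynman_iff comps_gmap ext_comp_gmap card_f)
    (auto simp: ext_gmap inj_image_subset_iff[OF inj_f])

lemma subgraph_gmap: "subgraph g G \<Longrightarrow> subgraph (gmap f g) (gmap f G)"
  by (auto simp: subgraph_def feynman_gmap)

lemma one_PI_gmap:
  assumes g: "graph G" and p: "one_PI G"
  shows "one_PI (gmap f G)"
  unfolding one_PI_iff[OF graph_gmap[OF g]]
proof (intro ballI)
  fix e x y assume "e \<in> joins (gmap f G)" "x \<in> e" "y \<in> e"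
  then obtain e' x' y' where e: "e = f ` e'" "e' \<in> joins G" "x' \<in> e'" "y' \<in> e'" "x = f x'" "y = f y'" by auto
  then have "(x', y') \<in> linked (verts G \<union> (joins G - {e'}))" using p unfolding one_PI_iff[OF g] by blast
  moreover have "verts (gmap f G) \<union> (joins (gmap f G) - {e}) = (`) f ` (verts G \<union> (joins G - {e'}))"
    using e inj_image_f by (simp add: image_Un image_set_diff)
  ultimately show "(x, y) \<in> linked (verts (gmap f G) \<union> (joins (gmap f G) - {e}))"
    using linked_image[OF inj_f, of x' y'] e by simp
qed

lemma quotient_gmap:
  assumes g: "graph A" and s: "subgraph u A"
  shows "quotient_graph (gmap f A) (gmap f u) = gmap f (quotient_graph A u)"
proof -
  interpret c: contraction A u by (rule contraction_if_subgraph[OF g s])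
  interpret d: contraction "gmap f A" "gmap f u"
    by (rule contraction_if_subgraph[OF graph_gmap[OF g] subgraph_gmap[OF s]])
  have cA: "f ` K \<in> comps (gmap f A) \<longleftrightarrow> K \<in> comps A" for K
    unfolding comps_gmap using inj_image_f by (simp add: inj_image_mem_iff)
  have nv: "new_verts (gmap f A) (gmap f u) = (`) f ` new_verts A u"
  proof -
    have "t \<in> new_verts (gmap f A) (gmap f u) \<longleftrightarrow> t \<in> (`) f ` new_verts A u" for t
    proof
      assume "t \<in> new_verts (gmap f A) (gmap f u)"
      then obtain K where K: "K \<in> comps (gmap f u)" "K \<notin> comps (gmap f A)"
        "card (ext (gmap f u) \<inter> K) = 3" "t = ext (gmap f u) \<inter> K" by (rule new_vertsE)
      then obtain K' where "K' \<in> comps u" "K = f ` K'" by (auto simp: comps_gmap)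
      then show "t \<in> (`) f ` new_verts A u"
        using K cA new_vertsI[of K' u A] by (auto simp: ext_comp_gmap card_f)
    next
      assume "t \<in> (`) f ` new_verts A u"
      then obtain t' where t': "t = f ` t'" "t' \<in> new_verts A u" by blast
      then obtain K where K: "K \<in> comps u" "K \<notin> comps A" "card (ext u \<inter> K) = 3" "t' = ext u \<inter> K"
        by (auto elim: new_vertsE)
      then have "f ` K \<in> comps (gmap f u)" by (simp add: comps_gmap)
      then show "t \<in> new_verts (gmap f A) (gmap f u)"
        using new_vertsI[of "f ` K" "gmap f u" "gmap f A"] K cA t' by (simp add: ext_comp_gmap card_f)
    qed
    then show ?thesis by blast
  qed
  have links: "links (gmap f u) = (`) f ` links u"
  proof -
    have l: "links u = (\<lambda>K. ext u \<inter> K) ` {K \<in> comps u. card (ext u \<inter> K) = 2}" for u :: "'s graph"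
      by (auto simp: links_def)
    have "{K \<in> comps (gmap f u). card (ext (gmap f u) \<inter> K) = 2} = (`) f ` {K \<in> comps u. card (ext u \<inter> K) = 2}"
      by (auto simp: comps_gmap ext_comp_gmap card_f)
    then show ?thesis unfolding l by (simp add: image_image ext_comp_gmap)
  qed
  have outer: "outer (gmap f A) (gmap f u) = (`) f ` outer A u"
    using inj_image_f by (simp add: outer_def image_set_diff)
  have half: "half d.Q = f ` half c.Q"
    unfolding half_quotient nv gmap_simps using inj_f by (simp add: image_Un image_set_diff image_Union)
  have verts: "verts d.Q = (`) f ` verts c.Q"
    unfolding verts_quotient nv gmap_simps using inj_image_f by (simp add: image_Un image_set_diff)
  have st: "(f x, f y) \<in> string (gmap f A) (gmap f u) \<longleftrightarrow> (x, y) \<in> string A u" for x y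
    using linked_image[OF inj_f, of x y "outer A u \<union> links u"] by (simp add: outer links image_Un)
  have "joins d.Q = (`) f ` joins c.Q"
  proof
    show "joins d.Q \<subseteq> (`) f ` joins c.Q"
    proof
      fix e assume "e \<in> joins d.Q"
      then obtain a b where e: "e = {a, b}" "a \<in> half d.Q" "b \<in> half d.Q" "a \<noteq> b" "(a, b) \<in> string (gmap f A) (gmap f u)"
        by (rule d.joins_QE)
      then obtain x y where xy: "a = f x" "b = f y" "x \<in> half c.Q" "y \<in> half c.Q" unfolding half by blast
      then have "{x, y} \<in> joins c.Q" using e st c.join_Q_iff by blast
      moreover have "e = f ` {x, y}" using e xy by simp
      ultimately show "e \<in> (`) f ` joins c.Q" by blast
    qed
    show "(`) f ` joins c.Q \<subseteq> joins d.Q"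
    proof
      fix e assume "e \<in> (`) f ` joins c.Q"
      then obtain e' where e': "e = f ` e'" "e' \<in> joins c.Q" by blast
      then obtain x y where xy: "e' = {x, y}" "x \<in> half c.Q" "y \<in> half c.Q" "x \<noteq> y" "(x, y) \<in> string A u"
        by (blast elim: c.joins_QE)
      then have "{f x, f y} \<in> joins d.Q"
        unfolding d.join_Q_iff half st using inj_f by (simp add: inj_eq)
      then show "e \<in> joins d.Q" using e' xy by simp
    qed
  qed
  then show ?thesis using half verts by (intro graph.expand) simp
qed

lemma graph_iso_gmap: "graph_iso G (gmap f G)" "graph_iso (gmap f G) G"
proof -
  show "graph_iso G (gmap f G)"
    unfolding graph_iso_def
    by (intro exI[of _ f]) (auto simp: inj_on_imp_bij_betw[OF inj_on_subset[OF inj_f subset_UNIV]])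
  have i: "inj (inv f)" using f by (simp add: bij_imp_bij_inv bij_is_inj)
  show "graph_iso (gmap f G) G"
    unfolding graph_iso_def
  proof (intro exI[of _ "inv f"] conjI)
    show "bij_betw (inv f) (half (gmap f G)) (half G)"
      using inj_on_imp_bij_betw[OF inj_on_subset[OF i subset_UNIV], of "f ` half G"]
      by (simp add: image_inv_f_f inj_f)
  qed (simp_all add: image_image image_inv_f_f inj_f)
qed

end

lemma graph_isoE:
  assumes "graph_iso G H" "graph G"
  obtains f where "bij f" "H = gmap f G"
proof -
  obtain g where g: "bij_betw g (half G) (half H)" "(`) g ` verts G = verts H" "(`) g ` joins G = joins H"
    using assms(1) by (auto simp: graph_iso_def)
  obtain f where f: "bij f" "\<And>x. x \<in> half G \<Longrightarrow> f x = g x"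
    using ex_bij_extension[OF graph_finite[OF assms(2)]] g(1) by (metis bij_betw_imp_inj_on)
  have "f ` half G = half H" using g(1) f(2) by (simp add: bij_betw_imp_surj_on)
  moreover have "(`) f ` verts G = (`) g ` verts G"
    using vert_subset[OF assms(2)] f(2) by (intro image_cong) (auto simp: subset_iff)
  moreover have "(`) f ` joins G = (`) g ` joins G"
    using join_subset[OF assms(2)] f(2) by (intro image_cong) (auto simp: subset_iff)
  ultimately have "H = gmap f G" using g by (intro graph.expand) simp
  then show ?thesis using that f(1) by blast
qed

lemma graph_iso_refl: "graph_iso G G"
  unfolding graph_iso_def by (rule exI[of _ id]) simp

lemma graph_iso_trans: "graph_iso G H \<Longrightarrow> graph_iso H K \<Longrightarrow> graph_iso G K"
proof -
  assume "graph_iso G H" "graph_iso H K"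
  then obtain g h where g: "bij_betw g (half G) (half H)" "(`) g ` verts G = verts H" "(`) g ` joins G = joins H"
    and h: "bij_betw h (half H) (half K)" "(`) h ` verts H = verts K" "(`) h ` joins H = joins K"
    by (auto simp: graph_iso_def)
  have "(`) (h \<circ> g) ` X = (`) h ` ((`) g ` X)" for X by (simp add: image_image comp_def)
  then have "(`) (h \<circ> g) ` verts G = verts K" "(`) (h \<circ> g) ` joins G = joins K" using g h by simp_all
  then show "graph_iso G K"
    unfolding graph_iso_def using bij_betw_trans[OF g(1) h(1)] by blast
qed

lemma graph_iso_sym: "graph_iso G H \<Longrightarrow> graph G \<Longrightarrow> graph_iso H G"
  using graph_isoE graph_iso_gmap(2) by metis

section \<open>The elimination action of an abstract category\<close>

lemma sum_apply: "(\<Sum>i\<in>I. F i) x = (\<Sum>i\<in>I. (F i x :: rat))"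
  by (induction I rule: infinite_finite_induct) auto

lemma scale_apply [simp]: "scale c f x = c * f x"
  by (simp add: scale_def)

text \<open>Tailored to \<open>LFG\<close>, where a quotient may fail to be an object: closure is
  required only of quotients whose class is in \<open>Iso C\<close>, since the functionals of the
  others vanish. For the same reason \<open>quot_quot\<close> asks for no more than some
  \<open>w\<close> with the right class, which is what invariance needs.\<close>

locale hall_category =
  fixes C :: "('o, 'u) hall_cat"
  assumes iso_refl: "A \<in> Obj C \<Longrightarrow> isom C A A"
    and iso_sym: "A \<in> Obj C \<Longrightarrow> B \<in> Obj C \<Longrightarrow> isom C A B \<Longrightarrow> isom C B A"
    and iso_trans: "A \<in> Obj C \<Longrightarrow> B \<in> Obj C \<Longrightarrow> D \<in> Obj C \<Longrightarrow> isom C A B \<Longrightarrow> isom C B D \<Longrightarrow> isom C A D"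
    and finite_Sub: "A \<in> Obj C \<Longrightarrow> finite (Sub C A)"
    and transport: "A \<in> Obj C \<Longrightarrow> B \<in> Obj C \<Longrightarrow> isom C A B \<Longrightarrow>
      \<exists>\<phi>. bij_betw \<phi> (Sub C A) (Sub C B) \<and> (\<forall>u\<in>Sub C A.
        cls C (sub_obj C B (\<phi> u)) = cls C (sub_obj C A u) \<and>
        cls C (quot_obj C B (\<phi> u)) = cls C (quot_obj C A u))"
    and quot_Obj: "A \<in> Obj C \<Longrightarrow> u \<in> Sub C A \<Longrightarrow> cls C (quot_obj C A u) \<in> Iso C \<Longrightarrow> quot_obj C A u \<in> Obj C"
    and quot_quot: "A \<in> Obj C \<Longrightarrow> u \<in> Sub C A \<Longrightarrow> quot_obj C A u \<in> Obj C \<Longrightarrow>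
      v \<in> Sub C (quot_obj C A u) \<Longrightarrow> cls C (quot_obj C (quot_obj C A u) v) \<in> Iso C \<Longrightarrow>
      \<exists>w\<in>Sub C A. cls C (quot_obj C A w) = cls C (quot_obj C (quot_obj C A u) v)"
begin

section \<open>Classes, representatives and bilinearity of the action\<close>

abbreviation "sub_cls A u \<equiv> cls C (sub_obj C A u)"
abbreviation "quot_cls A u \<equiv> cls C (quot_obj C A u)"

lemma cls_mem: "A \<in> Obj C \<Longrightarrow> A \<in> cls C A"
  by (simp add: cls_def iso_refl)

lemma cls_Iso: "A \<in> Obj C \<Longrightarrow> cls C A \<in> Iso C"
  by (simp add: Iso_def)

lemma cls_eq: "A \<in> Obj C \<Longrightarrow> B \<in> Obj C \<Longrightarrow> isom C A B \<Longrightarrow> cls C A = cls C B"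
  unfolding cls_def by (blast intro: iso_trans iso_sym)

lemma cls_memD: "A \<in> Obj C \<Longrightarrow> B \<in> cls C A \<Longrightarrow> B \<in> Obj C \<and> isom C A B \<and> cls C B = cls C A"
  using cls_eq[of A B] by (auto simp: cls_def)

lemma rep_cls:
  assumes "A \<in> Obj C"
  shows "rep (cls C A) \<in> Obj C" "isom C A (rep (cls C A))"
proof -
  have "rep (cls C A) \<in> cls C A" unfolding rep_def using cls_mem[OF assms] by (rule someI)
  then show "rep (cls C A) \<in> Obj C" "isom C A (rep (cls C A))" using cls_memD[OF assms] by blast+
qed

lemma rep_Iso:
  assumes "M \<in> Iso C"
  shows "rep M \<in> Obj C" "cls C (rep M) = M"
proof -
  obtain A where A: "A \<in> Obj C" "M = cls C A" using assms by (auto simp: Iso_def)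
  show "rep M \<in> Obj C" using rep_cls[OF A(1)] A(2) by simp
  show "cls C (rep M) = M" using cls_eq[OF A(1) rep_cls[OF A(1)]] A(2) by simp
qed

text \<open>Elements of the Hall algebra are supported in \<open>Iso C\<close>. This takes care of
  quotients that are not objects.\<close>

lemma phi_notin: "E \<notin> Iso C \<Longrightarrow> phi C E = 0"
  by (auto simp: phi_def Hall_def fun_eq_iff)

lemma sum_rep:
  assumes "A \<in> Obj C"
  shows "(\<Sum>u\<in>Sub C (rep (cls C A)). F (sub_cls (rep (cls C A)) u) (quot_cls (rep (cls C A)) u)) =
    (\<Sum>u\<in>Sub C A. F (sub_cls A u) (quot_cls A u))"
proof -
  obtain \<phi> where \<phi>: "bij_betw \<phi> (Sub C A) (Sub C (rep (cls C A)))"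
    "\<And>u. u \<in> Sub C A \<Longrightarrow> sub_cls (rep (cls C A)) (\<phi> u) = sub_cls A u \<and>
       quot_cls (rep (cls C A)) (\<phi> u) = quot_cls A u"
    using transport[OF assms rep_cls[OF assms]] by blast
  show ?thesis by (rule sum.reindex_bij_betw[OF \<phi>(1), symmetric, THEN trans]) (simp add: \<phi>(2))
qed

text \<open>The action uses only the values on indecomposable classes. Cutting \<open>f\<close> down
  to these allows one sum over all subobjects in place of a sum over classes.\<close>

definition weight :: "('o set \<Rightarrow> rat) \<Rightarrow> 'o set \<Rightarrow> rat" where
  "weight f A = (if A \<in> Indec C then f A else 0)"

text \<open>Up to the sign, the action of the indecomposable part of \<open>f\<close> on \<open>phi C B\<close>.\<close>

definition hact :: "('o set \<Rightarrow> rat) \<Rightarrow> 'o set \<Rightarrow> ('o set \<Rightarrow> rat) \<Rightarrow> rat" where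
  "hact f B = (\<Sum>u\<in>Sub C (rep B). scale (weight f (sub_cls (rep B) u)) (phi C (quot_cls (rep B) u)))"

lemma hact_add: "hact (f + g) B = hact f B + hact g B"
  by (auto simp: hact_def weight_def fun_eq_iff sum_apply algebra_simps sum.distrib[symmetric] intro!: sum.cong)

lemma hact_scale: "hact (scale c f) B = scale c (hact f B)"
  by (auto simp: hact_def weight_def fun_eq_iff sum_apply algebra_simps sum_distrib_left intro!: sum.cong)

text \<open>After exchanging the sums, each subobject is counted for exactly one class, its
  own.\<close>

lemma sum_elim:
  assumes f: "f \<in> Hall C" and B: "B \<in> Iso C"
  shows "(\<Sum>A\<in>{A \<in> Indec C. f A \<noteq> 0}. scale (f A) (elim C A B)) = - hact f B"
proof
  fix h
  let ?S = "{A \<in> Indec C. f A \<noteq> 0}" and ?U = "Sub C (rep B)"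
  have fS: "finite ?S" using f by (auto simp: Hall_def intro: rev_finite_subset)
  have fU: "finite ?U" by (rule finite_Sub[OF rep_Iso(1)[OF B]])
  let ?p = "\<lambda>u. phi C (quot_cls (rep B) u) h"
  have "(\<Sum>A\<in>?S. scale (f A) (elim C A B)) h =
      - (\<Sum>A\<in>?S. \<Sum>u\<in>?U. if sub_cls (rep B) u = A then f A * ?p u else 0)"
    by (auto simp: sum_apply elim_def sum_negf sum_distrib_left sum.inter_filter[OF fU] intro!: sum.cong)
  also have "(\<Sum>A\<in>?S. \<Sum>u\<in>?U. if sub_cls (rep B) u = A then f A * ?p u else 0) =
      (\<Sum>u\<in>?U. \<Sum>A\<in>?S. if sub_cls (rep B) u = A then f A * ?p u else 0)"
    by (rule sum.swap)
  also have "\<dots> = (\<Sum>u\<in>?U. weight f (sub_cls (rep B) u) * ?p u)"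
    by (rule sum.cong) (auto simp: sum.delta'[OF fS] weight_def)
  finally show "(\<Sum>A\<in>?S. scale (f A) (elim C A B)) h = (- hact f B) h"
    by (simp add: hact_def sum_apply)
qed

lemma act_hact:
  assumes f: "f \<in> Hall C"
  shows "act C f \<psi> = - (\<Sum>B\<in>{B \<in> Iso C. \<psi> (delta B) \<noteq> 0}. scale (\<psi> (delta B)) (hact f B))"
proof
  fix h
  let ?S = "{A \<in> Indec C. f A \<noteq> 0}" and ?T = "{B \<in> Iso C. \<psi> (delta B) \<noteq> 0}"
  have "act C f \<psi> h = (\<Sum>B\<in>?T. \<Sum>A\<in>?S. f A * \<psi> (delta B) * elim C A B h)"
    unfolding act_def sum_apply scale_apply by (rule sum.swap)
  also have "\<dots> = (\<Sum>B\<in>?T. \<psi> (delta B) * (\<Sum>A\<in>?S. scale (f A) (elim C A B)) h)"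
    by (intro sum.cong refl) (simp add: sum_apply sum_distrib_left algebra_simps)
  also have "\<dots> = (\<Sum>B\<in>?T. \<psi> (delta B) * (- hact f B) h)"
    by (intro sum.cong refl) (simp add: sum_elim[OF f])
  finally show "act C f \<psi> h = (- (\<Sum>B\<in>?T. scale (\<psi> (delta B)) (hact f B))) h"
    by (simp add: sum_apply sum_negf)
qed

text \<open>Lets several functionals share one index set, as additivity requires.\<close>

lemma act_superset:
  assumes "f \<in> Hall C" "finite D" "{B \<in> Iso C. \<psi> (delta B) \<noteq> 0} \<subseteq> D" "D \<subseteq> Iso C"
  shows "act C f \<psi> = - (\<Sum>B\<in>D. scale (\<psi> (delta B)) (hact f B))"
  unfolding act_hact[OF assms(1)]
  by (intro arg_cong[of _ _ uminus] sum.mono_neutral_left) (use assms in \<open>auto simp: fun_eq_iff\<close>)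

lemma phi_delta: "B \<in> Iso C \<Longrightarrow> phi C E (delta B) = (if E = B then 1 else 0)"
  by (auto simp: phi_def delta_in_Hall delta_apply)

lemma finite_support:
  assumes "\<psi> \<in> Hall_dual C"
  shows "finite {B \<in> Iso C. \<psi> (delta B) \<noteq> 0}"
  using assms unfolding Hall_dual_def
proof (induction rule: fun_space.span_induct_alt)
  case base
  then show ?case by simp
next
  case (step c x y)
  then obtain E where E: "E \<in> Iso C" "x = phi C E" by blast
  have "{B \<in> Iso C. (scale c x + y) (delta B) \<noteq> 0} \<subseteq> insert E {B \<in> Iso C. y (delta B) \<noteq> 0}"
    using E by (auto simp: phi_delta split: if_splits)
  then show ?case using step by (meson finite.insertI finite_subset)
qed

lemma act_add_right:
  assumes f: "f \<in> Hall C" and \<psi>: "\<psi> \<in> Hall_dual C" "\<chi> \<in> Hall_dual C"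
  shows "act C f (\<psi> + \<chi>) = act C f \<psi> + act C f \<chi>"
proof -
  let ?D = "{B \<in> Iso C. \<psi> (delta B) \<noteq> 0} \<union> {B \<in> Iso C. \<chi> (delta B) \<noteq> 0}"
  have D: "finite ?D" using finite_support \<psi> by simp
  have "act C f (\<psi> + \<chi>) = - (\<Sum>B\<in>?D. scale ((\<psi> + \<chi>) (delta B)) (hact f B))"
    by (rule act_superset[OF f D]) auto
  also have "\<dots> = - (\<Sum>B\<in>?D. scale (\<psi> (delta B)) (hact f B)) - (\<Sum>B\<in>?D. scale (\<chi> (delta B)) (hact f B))"
    by (auto simp: fun_eq_iff sum_apply algebra_simps sum.distrib)
  also have "\<dots> = act C f \<psi> + act C f \<chi>"
    using act_superset[OF f D, of \<psi>] act_superset[OF f D, of \<chi>] by auto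
  finally show ?thesis .
qed

lemma act_scale_right:
  assumes f: "f \<in> Hall C" and \<psi>: "\<psi> \<in> Hall_dual C"
  shows "act C f (scale c \<psi>) = scale c (act C f \<psi>)"
proof -
  let ?D = "{B \<in> Iso C. \<psi> (delta B) \<noteq> 0}"
  have "act C f (scale c \<psi>) = - (\<Sum>B\<in>?D. scale ((scale c \<psi>) (delta B)) (hact f B))"
    by (rule act_superset[OF f finite_support[OF \<psi>]]) auto
  also have "\<dots> = scale c (act C f \<psi>)"
    unfolding act_hact[OF f] by (auto simp: fun_eq_iff sum_apply algebra_simps sum_distrib_left)
  finally show ?thesis .
qed

lemma act_phi: "f \<in> Hall C \<Longrightarrow> B \<in> Iso C \<Longrightarrow> act C f (phi C B) = - hact f B"
  by (subst act_superset[of f "{B}"]) (auto simp: phi_delta fun_eq_iff split: if_splits)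

lemma phi_Hall_dual: "phi C E \<in> Hall_dual C"
proof (cases "E \<in> Iso C")
  case True
  then show ?thesis unfolding Hall_dual_def by (blast intro: fun_space.span_base)
next
  case False
  then show ?thesis unfolding Hall_dual_def by (simp add: phi_notin fun_space.span_zero)
qed

lemma act_sum:
  assumes "f \<in> Hall C" "finite I"
  shows "act C f (\<Sum>i\<in>I. scale (c i) (phi C (b i))) = (\<Sum>i\<in>I. scale (c i) (act C f (phi C (b i))))"
  using assms(2)
proof (induction I)
  case empty
  show ?case by (simp add: act_hact[OF assms(1)] fun_eq_iff)
next
  case (insert i I)
  have "(\<Sum>i\<in>I. scale (c i) (phi C (b i))) \<in> Hall_dual C"
    unfolding Hall_dual_def
    by (intro fun_space.span_sum fun_space.span_scale phi_Hall_dual[unfolded Hall_dual_def])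
  moreover have "scale (c i) (phi C (b i)) \<in> Hall_dual C"
    using phi_Hall_dual unfolding Hall_dual_def by (rule fun_space.span_scale)
  ultimately show ?case
    unfolding sum.insert[OF insert(1,2)]
    by (simp only: act_add_right[OF assms(1)] act_scale_right[OF assms(1) phi_Hall_dual] insert.IH)
qed

section \<open>The span of the quotients of an object\<close>

lemma Quot_Iso: "Quot C M \<subseteq> Iso C"
  by (auto simp: Quot_def)

lemma H_quot_Hall_dual: "H_quot C M \<subseteq> Hall_dual C"
  unfolding H_quot_def Hall_dual_def by (intro fun_space.span_mono image_mono Quot_Iso)

text \<open>The sum over subobjects of \<open>rep B\<close> is moved to the isomorphic quotient of
  \<open>rep M\<close>, where \<open>quot_quot\<close> applies. Classes outside \<open>Iso C\<close>
  contribute zero.\<close>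

lemma hact_H_quot:
  assumes M: "M \<in> Iso C" and B: "B \<in> Quot C M"
  shows "hact f B \<in> H_quot C M"
proof -
  let ?A = "rep M"
  have A: "?A \<in> Obj C" by (rule rep_Iso(1)[OF M])
  obtain u where u: "u \<in> Sub C ?A" "B = quot_cls ?A u" "B \<in> Iso C" using B by (auto simp: Quot_def)
  have Q: "quot_obj C ?A u \<in> Obj C" using quot_Obj[OF A u(1)] u by simp
  have "phi C (quot_cls (quot_obj C ?A u) v) \<in> H_quot C M" if v: "v \<in> Sub C (quot_obj C ?A u)" for v
  proof (cases "quot_cls (quot_obj C ?A u) v \<in> Iso C")
    case True
    then obtain w where "w \<in> Sub C ?A" "quot_cls ?A w = quot_cls (quot_obj C ?A u) v"
      using quot_quot[OF A u(1) Q v] by blast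
    then have "quot_cls (quot_obj C ?A u) v \<in> Quot C M" using True by (auto simp: Quot_def)
    then show ?thesis unfolding H_quot_def by (blast intro: fun_space.span_base)
  next
    case False
    then show ?thesis unfolding H_quot_def by (simp add: phi_notin fun_space.span_zero)
  qed
  then have "(\<Sum>v\<in>Sub C (quot_obj C ?A u). scale (weight f (sub_cls (quot_obj C ?A u) v))
      (phi C (quot_cls (quot_obj C ?A u) v))) \<in> H_quot C M"
    unfolding H_quot_def by (intro fun_space.span_sum fun_space.span_scale)
  then show ?thesis unfolding hact_def u(2) by (subst sum_rep[OF Q])
qed

lemma act_H_quot:
  assumes M: "M \<in> Iso C" and f: "f \<in> Hall C" and \<psi>: "\<psi> \<in> H_quot C M"
  shows "act C f \<psi> \<in> H_quot C M"
proof -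
  \<comment> \<open>Membership in \<open>Hall_dual C\<close> is carried through the induction
    because additivity of the action depends on finite support.\<close>
  have "\<psi> \<in> Hall_dual C \<and> act C f \<psi> \<in> H_quot C M"
    using \<psi> unfolding H_quot_def
  proof (induction rule: fun_space.span_induct_alt)
    case base
    have "act C f 0 = 0" by (simp add: act_hact[OF f] fun_eq_iff)
    then show ?case unfolding Hall_dual_def by (simp only: fun_space.span_zero simp_thms)
  next
    case (step c x y)
    then obtain E where E: "E \<in> Quot C M" "x = phi C E" by blast
    have EI: "E \<in> Iso C" using E Quot_Iso by blast
    have sx: "scale c x \<in> Hall_dual C"
      using phi_Hall_dual[of E] E unfolding Hall_dual_def by (simp add: fun_space.span_scale)
    have "act C f (scale c x + y) = scale c (- hact f E) + act C f y"
      using act_add_right[OF f sx] act_scale_right[OF f phi_Hall_dual] act_phi[OF f EI] step E by simp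
    moreover have "- hact f E \<in> fun_space.span (phi C ` Quot C M)"
      using hact_H_quot[OF M E(1)] unfolding H_quot_def by (rule fun_space.span_neg)
    ultimately have "act C f (scale c x + y) \<in> fun_space.span (phi C ` Quot C M)"
      using step by (metis fun_space.span_add fun_space.span_scale)
    moreover have "scale c x + y \<in> Hall_dual C"
      using sx step unfolding Hall_dual_def by (metis fun_space.span_add)
    ultimately show ?case by blast
  qed
  then show ?thesis by blast
qed

theorem finite_dim_H_quot:
  assumes M: "M \<in> Iso C"
  shows "finite_dim (H_quot C M)"
proof -
  have "finite (Quot C M)"
    by (rule finite_subset[of _ "quot_cls (rep M) ` Sub C (rep M)"])
      (auto simp: Quot_def finite_Sub[OF rep_Iso(1)[OF M]])
  then have fin: "finite (phi C ` Quot C M)" by simp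
  obtain B where B: "B \<subseteq> phi C ` Quot C M" "fun_space.independent B" "phi C ` Quot C M \<subseteq> fun_space.span B"
    using fun_space.maximal_independent_subset by blast
  have "fun_space.span B = H_quot C M"
    unfolding H_quot_def
    by (intro equalityI fun_space.span_mono B(1) fun_space.span_minimal[OF B(3)] fun_space.subspace_span)
  then show ?thesis unfolding finite_dim_def using B(2) finite_subset[OF B(1) fin] by blast
qed

theorem acts_on_H_quot:
  assumes M: "M \<in> Iso C"
  shows "acts_on C (H_quot C M)"
  unfolding acts_on_def
proof (intro conjI ballI allI)
  show "fun_space.subspace (H_quot C M)" by (simp add: H_quot_def)
  show "H_quot C M \<subseteq> Hall_dual C" by (rule H_quot_Hall_dual)
  have P: "X \<in> Hall C" if "X \<in> primitives C" for X using that by (simp add: primitives_def)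
  fix X assume X: "X \<in> primitives C"
  fix \<psi> assume \<psi>: "\<psi> \<in> H_quot C M"
  then have \<psi>': "\<psi> \<in> Hall_dual C" using H_quot_Hall_dual by blast
  show "act C X \<psi> \<in> H_quot C M" by (rule act_H_quot[OF M P[OF X] \<psi>])
  show "act C X (scale c \<psi>) = scale c (act C X \<psi>)" for c by (rule act_scale_right[OF P[OF X] \<psi>'])
  show "act C X (\<psi> + \<chi>) = act C X \<psi> + act C X \<chi>" if "\<chi> \<in> H_quot C M" for \<chi>
    by (rule act_add_right[OF P[OF X] \<psi>']) (use that H_quot_Hall_dual in blast)
  show "act C (scale c X) \<psi> = scale c (act C X \<psi>)" for c
  proof -
    have "scale c X \<in> Hall C"
      using P[OF X] by (auto simp: Hall_def intro: rev_finite_subset)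
    then show ?thesis
      using P[OF X] by (auto simp: act_hact hact_scale fun_eq_iff sum_apply algebra_simps sum_distrib_left)
  qed
  show "act C (X + Y) \<psi> = act C X \<psi> + act C Y \<psi>" if Y: "Y \<in> primitives C" for Y
  proof -
    have "{M. (X + Y) M \<noteq> 0} \<subseteq> {M. X M \<noteq> 0} \<union> {M. Y M \<noteq> 0}" by auto
    then have "X + Y \<in> Hall C"
      using P[OF X] P[OF Y] unfolding Hall_def by (auto intro: finite_subset)
    then show ?thesis
      using P[OF X] P[OF Y] by (auto simp: act_hact hact_add fun_eq_iff sum_apply algebra_simps sum.distrib)
  qed
qed

end

text \<open>Decomposability of an object itself, with disjoint labels fixed, so that the choice of
  representatives in \<open>oplus\<close> can be avoided.\<close>

definition decomp :: "('o, 'u) hall_cat \<Rightarrow> 'o \<Rightarrow> bool" where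
  "decomp C D \<longleftrightarrow> (\<exists>A\<in>Obj C. \<exists>B\<in>Obj C. A \<noteq> zero_obj C \<and> B \<noteq> zero_obj C \<and>
     disj_labels C A B \<and> D = disj_union C A B)"

text \<open>Beyond closure properties there are three inputs: \<open>size_of\<close> bounds the
  support of a product, \<open>towers\<close> expresses the correspondence of chains of subobjects
  up to isomorphism classes, and \<open>split\<close> lists the subobjects of a union on which a
  product of primitive elements can be nonzero.\<close>

locale hall_lie_category = hall_category +
  fixes size_of :: "'a \<Rightarrow> nat"
  assumes zero_Obj: "zero_obj C \<in> Obj C"
    and cls_zero: "cls C (zero_obj C) = {zero_obj C}"
    and disj_zero: "disj_labels C (zero_obj C) (zero_obj C)"
    and union_zero: "disj_union C (zero_obj C) (zero_obj C) = zero_obj C"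
    and sub_zero: "u \<in> Sub C (zero_obj C) \<Longrightarrow> sub_obj C (zero_obj C) u = zero_obj C"
    and sub_Obj: "A \<in> Obj C \<Longrightarrow> u \<in> Sub C A \<Longrightarrow> sub_obj C A u \<in> Obj C"
    and quot_Obj': "A \<in> Obj C \<Longrightarrow> u \<in> Sub C A \<Longrightarrow> quot_obj C A u \<in> Obj C"
    and union_Obj: "A \<in> Obj C \<Longrightarrow> B \<in> Obj C \<Longrightarrow> disj_labels C A B \<Longrightarrow> disj_union C A B \<in> Obj C"
    and union_iso: "A \<in> Obj C \<Longrightarrow> B \<in> Obj C \<Longrightarrow> A' \<in> Obj C \<Longrightarrow> B' \<in> Obj C \<Longrightarrow> isom C A A' \<Longrightarrow> isom C B B' \<Longrightarrow>
      disj_labels C A B \<Longrightarrow> disj_labels C A' B' \<Longrightarrow> isom C (disj_union C A B) (disj_union C A' B')"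
    and disj_rep: "A \<in> Obj C \<Longrightarrow> B \<in> Obj C \<Longrightarrow> \<exists>A'\<in>Obj C. isom C A A' \<and> disj_labels C A' B"
    and size_of_iso: "A \<in> Obj C \<Longrightarrow> B \<in> Obj C \<Longrightarrow> isom C A B \<Longrightarrow> size_of A = size_of B"
    and size_of_sub: "A \<in> Obj C \<Longrightarrow> u \<in> Sub C A \<Longrightarrow> size_of A \<le> size_of (sub_obj C A u) + size_of (quot_obj C A u)"
    and finite_size_of: "finite (cls C ` {A \<in> Obj C. size_of A \<le> n})"
    and towers: "A \<in> Obj C \<Longrightarrow> \<exists>\<Phi>. bij_betw \<Phi> (SIGMA u:Sub C A. Sub C (quot_obj C A u))
      (SIGMA w:Sub C A. Sub C (sub_obj C A w)) \<and> (\<forall>u\<in>Sub C A. \<forall>v\<in>Sub C (quot_obj C A u). \<forall>w t.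
        \<Phi> (u, v) = (w, t) \<longrightarrow>
          cls C (sub_obj C (sub_obj C A w) t) = cls C (sub_obj C A u) \<and>
          cls C (quot_obj C (sub_obj C A w) t) = cls C (sub_obj C (quot_obj C A u) v) \<and>
          cls C (quot_obj C A w) = cls C (quot_obj C (quot_obj C A u) v))"
    and split: "A \<in> Obj C \<Longrightarrow> B \<in> Obj C \<Longrightarrow> A \<noteq> zero_obj C \<Longrightarrow> B \<noteq> zero_obj C \<Longrightarrow> disj_labels C A B \<Longrightarrow>
      D = disj_union C A B \<Longrightarrow> \<exists>s\<in>Sub C D. \<exists>s'\<in>Sub C D. s \<noteq> s' \<and>
        cls C (sub_obj C D s) = cls C A \<and> cls C (quot_obj C D s) = cls C B \<and>
        cls C (sub_obj C D s') = cls C B \<and> cls C (quot_obj C D s') = cls C A \<and>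
        (\<forall>t\<in>Sub C D. t = s \<or> t = s' \<or> sub_obj C D t = zero_obj C \<or> quot_obj C D t = zero_obj C \<or>
           decomp C (sub_obj C D t) \<or> decomp C (quot_obj C D t))"
begin

text \<open>The choice made in \<open>oplus\<close> is harmless because unions of isomorphic objects
  are isomorphic.\<close>

lemma oplus_cls:
  assumes "A \<in> Obj C" "B \<in> Obj C" "disj_labels C A B"
  shows "oplus C (cls C A) (cls C B) = cls C (disj_union C A B)"
proof -
  let ?P = "\<lambda>(A', B'). A' \<in> cls C A \<and> B' \<in> cls C B \<and> disj_labels C A' B'"
  obtain A' B' where AB: "(SOME p. ?P p) = (A', B')" by fastforce
  have "?P (SOME p. ?P p)" by (rule someI[of ?P "(A, B)"]) (use assms cls_mem in auto)
  then have *: "A' \<in> cls C A" "B' \<in> cls C B" "disj_labels C A' B'" using AB by auto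
  note A' = cls_memD[OF assms(1) *(1)] and B' = cls_memD[OF assms(2) *(2)]
  have "cls C (disj_union C A B) = cls C (disj_union C A' B')"
    by (rule cls_eq) (use A' B' assms *(3) union_Obj union_iso in auto)
  then show ?thesis unfolding oplus_def using AB by simp
qed

lemma cls_nonzero: "A \<in> Obj C \<Longrightarrow> A \<noteq> zero_obj C \<Longrightarrow> cls C A \<noteq> cls C (zero_obj C)"
  using cls_mem cls_zero by auto

text \<open>The zero object is its own double, so primitivity gives \<open>X 0 = X 0 + X 0\<close>
  there.\<close>

lemma primitive_zero:
  assumes X: "X \<in> primitives C"
  shows "X (cls C (zero_obj C)) = 0"
proof -
  let ?z = "cls C (zero_obj C)"
  have "oplus C ?z ?z = ?z" using oplus_cls[OF zero_Obj zero_Obj disj_zero] union_zero by simp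
  moreover have "hall_comult C X ?z ?z = X ?z * delta ?z ?z + delta ?z ?z * X ?z"
    using X cls_Iso[OF zero_Obj] unfolding primitives_def by blast
  ultimately show ?thesis by (simp add: hall_comult_def delta_apply)
qed

lemma primitive_oplus:
  assumes X: "X \<in> primitives C" and "M \<in> Iso C" "N \<in> Iso C" "M \<noteq> cls C (zero_obj C)" "N \<noteq> cls C (zero_obj C)"
  shows "X (oplus C M N) = 0"
proof -
  let ?z = "cls C (zero_obj C)"
  have "hall_comult C X M N = X M * delta ?z N + delta ?z M * X N"
    using X assms unfolding primitives_def by blast
  then show ?thesis using assms by (simp add: hall_comult_def delta_apply)
qed

lemma primitive_decomp:
  assumes X: "X \<in> primitives C" and "decomp C D"
  shows "X (cls C D) = 0"
proof -
  obtain A B where AB: "A \<in> Obj C" "B \<in> Obj C" "A \<noteq> zero_obj C" "B \<noteq> zero_obj C" "disj_labels C A B" "D = disj_union C A B"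
    using assms(2) by (auto simp: decomp_def)
  have "X (oplus C (cls C A) (cls C B)) = 0"
    by (rule primitive_oplus[OF X]) (use AB cls_Iso cls_nonzero in auto)
  then show ?thesis using oplus_cls[OF AB(1,2,5)] AB(6) by simp
qed

lemma primitive_Hall: "X \<in> primitives C \<Longrightarrow> X \<in> Hall C"
  by (simp add: primitives_def)

lemma primitive_Indec: "X \<in> primitives C \<Longrightarrow> X A \<noteq> 0 \<Longrightarrow> A \<in> Indec C"
  using primitive_zero[of X] primitive_oplus[of X] primitive_Hall[of X]
  unfolding Indec_def Hall_def by blast

lemma weight_primitive: "X \<in> primitives C \<Longrightarrow> weight X = X"
  using primitive_Indec[of X] by (auto simp: weight_def fun_eq_iff)

section \<open>Products and brackets of primitive elements\<close>

lemma hall_mult_cls: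
  assumes "A \<in> Obj C"
  shows "hall_mult C f g (cls C A) = (\<Sum>u\<in>Sub C A. f (sub_cls A u) * g (quot_cls A u))"
  using sum_rep[OF assms, of "\<lambda>x y. f x * g y"] cls_Iso[OF assms] by (simp add: hall_mult_def)

text \<open>
  Only \<open>A\<close> and \<open>B\<close> themselves contribute to the product of two primitive elements on the union of
  \<open>A\<close> and \<open>B\<close>.
\<close>

lemma hall_mult_union:
  assumes X: "X \<in> primitives C" and Y: "Y \<in> primitives C"
    and AB: "A \<in> Obj C" "B \<in> Obj C" "A \<noteq> zero_obj C" "B \<noteq> zero_obj C" "disj_labels C A B"
  shows "hall_mult C X Y (cls C (disj_union C A B)) =
    X (cls C A) * Y (cls C B) + X (cls C B) * Y (cls C A)"
proof -
  let ?D = "disj_union C A B"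
  have D: "?D \<in> Obj C" using union_Obj AB by blast
  obtain s s' where s: "s \<in> Sub C ?D" "s' \<in> Sub C ?D" "s \<noteq> s'"
    "sub_cls ?D s = cls C A" "quot_cls ?D s = cls C B" "sub_cls ?D s' = cls C B" "quot_cls ?D s' = cls C A"
    "\<And>t. t \<in> Sub C ?D \<Longrightarrow> t = s \<or> t = s' \<or> sub_obj C ?D t = zero_obj C \<or> quot_obj C ?D t = zero_obj C \<or>
           decomp C (sub_obj C ?D t) \<or> decomp C (quot_obj C ?D t)"
    using split[OF AB refl] by blast
  have "X (sub_cls ?D t) * Y (quot_cls ?D t) = 0" if "t \<in> Sub C ?D - {s, s'}" for t
    using s(8)[of t] that primitive_zero[OF X] primitive_zero[OF Y]
      primitive_decomp[OF X, of "sub_obj C ?D t"] primitive_decomp[OF Y, of "quot_obj C ?D t"] by auto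
  then have "(\<Sum>t\<in>Sub C ?D. X (sub_cls ?D t) * Y (quot_cls ?D t)) =
      (\<Sum>t\<in>{s, s'}. X (sub_cls ?D t) * Y (quot_cls ?D t))"
    by (intro sum.mono_neutral_right finite_Sub[OF D]) (use s in auto)
  then show ?thesis unfolding hall_mult_cls[OF D] using s by simp
qed

lemma bracket_apply: "hall_bracket C X Y A = hall_mult C X Y A - hall_mult C Y X A"
  by (simp add: hall_bracket_def)

lemma hall_mult_zero:
  assumes X: "X \<in> primitives C"
  shows "hall_mult C X Y (cls C (zero_obj C)) = 0"
  unfolding hall_mult_cls[OF zero_Obj]
  by (rule sum.neutral) (simp add: sub_zero primitive_zero[OF X])

lemma bracket_Indec:
  assumes X: "X \<in> primitives C" and Y: "Y \<in> primitives C" and A: "hall_bracket C X Y A \<noteq> 0"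
  shows "A \<in> Indec C"
proof (rule ccontr)
  assume nI: "A \<notin> Indec C"
  have AI: "A \<in> Iso C" using A by (auto simp: bracket_apply hall_mult_def split: if_splits)
  have "A \<noteq> cls C (zero_obj C)"
    using A hall_mult_zero[OF X] hall_mult_zero[OF Y] by (auto simp: bracket_apply)
  then obtain M N where MN: "M \<in> Iso C" "N \<in> Iso C" "M \<noteq> cls C (zero_obj C)" "N \<noteq> cls C (zero_obj C)" "A = oplus C M N"
    using nI AI by (auto simp: Indec_def)
  obtain M1 N1 where M1: "M1 \<in> Obj C" "M = cls C M1" and N1: "N1 \<in> Obj C" "N = cls C N1"
    using MN by (auto simp: Iso_def)
  obtain M2 where M2: "M2 \<in> Obj C" "isom C M1 M2" "disj_labels C M2 N1"
    using disj_rep[OF M1(1) N1(1)] by blast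
  have M: "M = cls C M2" using cls_eq[OF M1(1) M2(1,2)] M1(2) by simp
  have nz: "M2 \<noteq> zero_obj C" "N1 \<noteq> zero_obj C" using M N1 MN by auto
  have "A = cls C (disj_union C M2 N1)" using oplus_cls[OF M2(1) N1(1) M2(3)] M N1 MN by simp
  then have "hall_bracket C X Y A = 0"
    using hall_mult_union[OF X Y M2(1) N1(1) nz M2(3)] hall_mult_union[OF Y X M2(1) N1(1) nz M2(3)]
    by (simp add: bracket_apply)
  then show False using A by simp
qed

text \<open>Where the product is nonzero, the size is at most the sum of the largest sizes in the
  two supports, and only finitely many classes have bounded size.\<close>

lemma hall_mult_Hall:
  assumes f: "f \<in> Hall C" and g: "g \<in> Hall C"
  shows "hall_mult C f g \<in> Hall C"
proof -
  let ?F = "{M. f M \<noteq> 0}" and ?G = "{M. g M \<noteq> 0}"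
  have fin: "finite ?F" "finite ?G" and sub: "?F \<subseteq> Iso C" "?G \<subseteq> Iso C" using f g by (auto simp: Hall_def)
  \<comment> \<open>Inserting 0 keeps \<open>Max\<close> meaningful when a support is empty.\<close>
  define n where "n = Max (insert 0 ((size_of \<circ> rep) ` ?F)) + Max (insert 0 ((size_of \<circ> rep) ` ?G))"
  have "{M. hall_mult C f g M \<noteq> 0} \<subseteq> cls C ` {A \<in> Obj C. size_of A \<le> n}"
  proof
    fix M assume "M \<in> {M. hall_mult C f g M \<noteq> 0}"
    then have M: "M \<in> Iso C" and "(\<Sum>u\<in>Sub C (rep M). f (sub_cls (rep M) u) * g (quot_cls (rep M) u)) \<noteq> 0"
      by (auto simp: hall_mult_def split: if_splits)
    from this(2) obtain u where u: "u \<in> Sub C (rep M)" "f (sub_cls (rep M) u) \<noteq> 0" "g (quot_cls (rep M) u) \<noteq> 0"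
      by (rule sum.not_neutral_contains_not_neutral) auto
    have rM: "rep M \<in> Obj C" by (rule rep_Iso(1)[OF M])
    have s: "sub_obj C (rep M) u \<in> Obj C" and q: "quot_obj C (rep M) u \<in> Obj C"
      using sub_Obj quot_Obj' rM u by blast+
    have "size_of (sub_obj C (rep M) u) = size_of (rep (sub_cls (rep M) u))"
      by (rule size_of_iso[OF s rep_cls[OF s]])
    also have "\<dots> \<le> Max (insert 0 ((size_of \<circ> rep) ` ?F))" using fin u(2) by (intro Max_ge) auto
    finally have 1: "size_of (sub_obj C (rep M) u) \<le> Max (insert 0 ((size_of \<circ> rep) ` ?F))" .
    have "size_of (quot_obj C (rep M) u) = size_of (rep (quot_cls (rep M) u))"
      by (rule size_of_iso[OF q rep_cls[OF q]])
    also have "\<dots> \<le> Max (insert 0 ((size_of \<circ> rep) ` ?G))" using fin u(3) by (intro Max_ge) auto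
    finally have "size_of (rep M) \<le> n" using 1 size_of_sub[OF rM u(1)] by (simp add: n_def)
    then show "M \<in> cls C ` {A \<in> Obj C. size_of A \<le> n}" using rM rep_Iso(2)[OF M] by (metis (mono_tags, lifting) image_eqI mem_Collect_eq)
  qed
  then have "finite {M. hall_mult C f g M \<noteq> 0}" using finite_size_of finite_subset by blast
  then show ?thesis by (auto simp: Hall_def hall_mult_def split: if_splits)
qed

lemma bracket_Hall:
  assumes "X \<in> primitives C" "Y \<in> primitives C"
  shows "hall_bracket C X Y \<in> Hall C"
proof -
  have h: "hall_mult C X Y \<in> Hall C" "hall_mult C Y X \<in> Hall C"
    using assms by (auto intro: hall_mult_Hall primitive_Hall)
  have "{M. hall_bracket C X Y M \<noteq> 0} \<subseteq> {M. hall_mult C X Y M \<noteq> 0} \<union> {M. hall_mult C Y X M \<noteq> 0}"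
    by (auto simp: bracket_apply)
  then show ?thesis using h unfolding Hall_def by (auto intro: finite_subset)
qed

lemma weight_bracket: "X \<in> primitives C \<Longrightarrow> Y \<in> primitives C \<Longrightarrow> weight (hall_bracket C X Y) = hall_bracket C X Y"
  using bracket_Indec[of X Y] by (auto simp: weight_def fun_eq_iff)

text \<open>Acting twice means summing over towers of subobjects.\<close>

lemma act_act_phi:
  assumes X: "X \<in> primitives C" and Y: "Y \<in> primitives C" and B: "B \<in> Iso C"
  shows "act C X (act C Y (phi C B)) =
    (\<Sum>w\<in>Sub C (rep B). scale (hall_mult C Y X (sub_cls (rep B) w)) (phi C (quot_cls (rep B) w)))"
proof -
  let ?A = "rep B"
  have A: "?A \<in> Obj C" by (rule rep_Iso(1)[OF B])
  have fA: "finite (Sub C ?A)" by (rule finite_Sub[OF A])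
  have XH: "X \<in> Hall C" and YH: "Y \<in> Hall C" using X Y by (auto intro: primitive_Hall)
  have Q: "quot_obj C ?A u \<in> Obj C" if "u \<in> Sub C ?A" for u using quot_Obj'[OF A that] .
  have S: "sub_obj C ?A u \<in> Obj C" if "u \<in> Sub C ?A" for u using sub_Obj[OF A that] .
  have *: "hact X (quot_cls ?A u) = (\<Sum>v\<in>Sub C (quot_obj C ?A u).
      scale (X (sub_cls (quot_obj C ?A u) v)) (phi C (quot_cls (quot_obj C ?A u) v)))" if "u \<in> Sub C ?A" for u
    unfolding hact_def weight_primitive[OF X] by (rule sum_rep[OF Q[OF that]])
  obtain \<Phi> where \<Phi>: "bij_betw \<Phi> (SIGMA u:Sub C ?A. Sub C (quot_obj C ?A u)) (SIGMA w:Sub C ?A. Sub C (sub_obj C ?A w))"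
    "\<And>u v w t. u \<in> Sub C ?A \<Longrightarrow> v \<in> Sub C (quot_obj C ?A u) \<Longrightarrow> \<Phi> (u, v) = (w, t) \<Longrightarrow>
       sub_cls (sub_obj C ?A w) t = sub_cls ?A u \<and> quot_cls (sub_obj C ?A w) t = sub_cls (quot_obj C ?A u) v \<and>
       quot_cls ?A w = quot_cls (quot_obj C ?A u) v"
    using towers[OF A] by blast
  have "act C X (act C Y (phi C B)) = act C X (\<Sum>u\<in>Sub C ?A. scale (- Y (sub_cls ?A u)) (phi C (quot_cls ?A u)))"
  proof -
    have "act C Y (phi C B) = (\<Sum>u\<in>Sub C ?A. scale (- Y (sub_cls ?A u)) (phi C (quot_cls ?A u)))"
      unfolding act_phi[OF YH B] hact_def weight_primitive[OF Y]
      by (simp add: fun_eq_iff sum_apply sum_negf)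
    then show ?thesis by simp
  qed
  also have "\<dots> = (\<Sum>u\<in>Sub C ?A. scale (- Y (sub_cls ?A u)) (act C X (phi C (quot_cls ?A u))))"
    by (rule act_sum[OF XH fA])
  also have "\<dots> = (\<Sum>u\<in>Sub C ?A. scale (Y (sub_cls ?A u)) (hact X (quot_cls ?A u)))"
    by (intro sum.cong refl) (simp add: act_phi[OF XH cls_Iso[OF Q]] fun_eq_iff)
  also have "\<dots> = (\<Sum>u\<in>Sub C ?A. \<Sum>v\<in>Sub C (quot_obj C ?A u).
      scale (Y (sub_cls ?A u) * X (sub_cls (quot_obj C ?A u) v)) (phi C (quot_cls (quot_obj C ?A u) v)))"
    by (intro sum.cong refl) (simp add: * fun_eq_iff sum_apply sum_distrib_left algebra_simps)
  also have "\<dots> = (\<Sum>(u, v)\<in>(SIGMA u:Sub C ?A. Sub C (quot_obj C ?A u)).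
      scale (Y (sub_cls ?A u) * X (sub_cls (quot_obj C ?A u) v)) (phi C (quot_cls (quot_obj C ?A u) v)))"
    by (rule sum.Sigma[OF fA]) (use finite_Sub Q in blast)
  \<comment> \<open>The towers are regrouped by the larger subobject \<open>w\<close>. Inside
    \<open>w\<close> the remaining sum, over the smaller subobject and its quotient, is the one that
    defines the product of \<open>Y\<close> and \<open>X\<close>.\<close>
  also have "\<dots> = (\<Sum>(w, t)\<in>(SIGMA w:Sub C ?A. Sub C (sub_obj C ?A w)).
      scale (Y (sub_cls (sub_obj C ?A w) t) * X (quot_cls (sub_obj C ?A w) t)) (phi C (quot_cls ?A w)))"
    by (rule sum.reindex_bij_betw[OF \<Phi>(1), THEN trans[rotated]], rule sum.cong)
      (auto split: prod.splits dest!: \<Phi>(2)[rotated 2])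
  also have "\<dots> = (\<Sum>w\<in>Sub C ?A. \<Sum>t\<in>Sub C (sub_obj C ?A w).
      scale (Y (sub_cls (sub_obj C ?A w) t) * X (quot_cls (sub_obj C ?A w) t)) (phi C (quot_cls ?A w)))"
    by (rule sum.Sigma[OF fA, symmetric]) (use finite_Sub S in blast)
  also have "\<dots> = (\<Sum>w\<in>Sub C ?A. scale (hall_mult C Y X (sub_cls ?A w)) (phi C (quot_cls ?A w)))"
    by (intro sum.cong refl) (simp add: hall_mult_cls[OF S] fun_eq_iff sum_apply sum_distrib_right)
  finally show ?thesis .
qed

theorem lie_representation_H_quot:
  assumes M: "M \<in> Iso C"
  shows "lie_representation C (H_quot C M)"
  unfolding lie_representation_def
proof (intro conjI ballI)
  show "acts_on C (H_quot C M)" by (rule acts_on_H_quot[OF M])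
  fix X Y \<psi> assume X: "X \<in> primitives C" and Y: "Y \<in> primitives C" and \<psi>: "\<psi> \<in> H_quot C M"
  have XH: "X \<in> Hall C" and YH: "Y \<in> Hall C" using X Y by (auto intro: primitive_Hall)
  have ZH: "hall_bracket C X Y \<in> Hall C" by (rule bracket_Hall[OF X Y])
  have dual: "\<chi> \<in> H_quot C M \<Longrightarrow> \<chi> \<in> Hall_dual C" for \<chi> using H_quot_Hall_dual by blast
  have "\<psi> \<in> H_quot C M \<and> act C (hall_bracket C X Y) \<psi> = act C X (act C Y \<psi>) - act C Y (act C X \<psi>)"
    using \<psi> unfolding H_quot_def
  proof (induction rule: fun_space.span_induct_alt)
    case base
    have "act C f 0 = 0" if "f \<in> Hall C" for f by (simp add: act_hact[OF that] fun_eq_iff)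
    then show ?case by (simp only: XH YH ZH fun_space.span_zero diff_self simp_thms)
  next
    case (step c x y)
    then obtain E where E: "E \<in> Quot C M" "x = phi C E" by blast
    have EI: "E \<in> Iso C" using E Quot_Iso by blast
    have y: "y \<in> H_quot C M" using step unfolding H_quot_def by blast
    have x: "x \<in> H_quot C M" using E unfolding H_quot_def by (blast intro: fun_space.span_base)
    then have sx: "scale c x \<in> H_quot C M" unfolding H_quot_def by (rule fun_space.span_scale)
    have lin: "act C f (scale c x' + y') = scale c (act C f x') + act C f y'"
      if "f \<in> Hall C" "x' \<in> H_quot C M" "y' \<in> H_quot C M" for f x' y'
    proof -
      have "scale c x' \<in> H_quot C M" using that(2) unfolding H_quot_def by (rule fun_space.span_scale)
      then show ?thesis using act_add_right[OF that(1)] act_scale_right[OF that(1)] dual that by metis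
    qed
    \<comment> \<open>Acting by \<open>Y\<close> first produces the product in the order
      \<open>Y\<close>, \<open>X\<close>. This reversal is absorbed by the minus sign in the
      action.\<close>
    have Z: "act C (hall_bracket C X Y) x = act C X (act C Y x) - act C Y (act C X x)"
      unfolding E(2) act_phi[OF ZH EI] hact_def weight_bracket[OF X Y] act_act_phi[OF X Y EI] act_act_phi[OF Y X EI]
      by (simp add: fun_eq_iff sum_apply bracket_apply algebra_simps sum_subtractf)
    have mem: "act C f x \<in> H_quot C M" "act C f y \<in> H_quot C M" if "f \<in> Hall C" for f
      using act_H_quot[OF M that] x y by auto
    have twice: "act C f (act C g (scale c x + y)) = scale c (act C f (act C g x)) + act C f (act C g y)"
      if "f \<in> Hall C" "g \<in> Hall C" for f g
      unfolding lin[OF that(2) x y] by (rule lin[OF that(1) mem(1)[OF that(2)] mem(2)[OF that(2)]])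
    have IH: "act C (hall_bracket C X Y) y = act C X (act C Y y) - act C Y (act C X y)"
      using step by blast
    have "act C (hall_bracket C X Y) (scale c x + y) =
        act C X (act C Y (scale c x + y)) - act C Y (act C X (scale c x + y))"
      unfolding lin[OF ZH x y] twice[OF XH YH] twice[OF YH XH] Z IH
      by (simp add: fun_eq_iff algebra_simps)
    moreover have "scale c x + y \<in> H_quot C M" using sx y unfolding H_quot_def by (rule fun_space.span_add)
    ultimately show ?case unfolding H_quot_def by blast
  qed
  then show "act C (hall_bracket C X Y) \<psi> = act C X (act C Y \<psi>) - act C Y (act C X \<psi>)" by blast
qed

end

section \<open>Rooted forests\<close>

text \<open>
  A cut is determined by the vertices that it separates from the roots, and these may be any set
  that is closed under descendants.
\<close>

definition down :: "'s forest \<Rightarrow> 's set \<Rightarrow> bool" where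
  "down F W \<longleftrightarrow> W \<subseteq> fverts F \<and> (\<forall>x y. (x, y) \<in> fedges F \<longrightarrow> y \<in> W \<longrightarrow> x \<in> W)"

definition frestrict :: "'s forest \<Rightarrow> 's set \<Rightarrow> 's forest" where
  "frestrict F W = Forest W (fedges F \<inter> W \<times> W)"

definition below :: "'s forest \<Rightarrow> 's cut \<Rightarrow> 's set" where
  "below F c = fverts F - root_part F c"

definition cut_of :: "'s forest \<Rightarrow> 's set \<Rightarrow> 's cut" where
  "cut_of F W = ({(x, y) \<in> fedges F. x \<in> W \<and> y \<notin> W}, froots F \<inter> W)"

lemma frestrict_simps [simp]: "fverts (frestrict F W) = W" "fedges (frestrict F W) = fedges F \<inter> W \<times> W"
  by (simp_all add: frestrict_def)

lemma frestrict_frestrict: "W' \<subseteq> W \<Longrightarrow> frestrict (frestrict F W) W' = frestrict F W'"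
  by (auto simp: frestrict_def)

lemma frestrict_self: "forest F \<Longrightarrow> frestrict F (fverts F) = F"
  by (auto simp: frestrict_def forest_def intro!: forest.expand)

lemma forest_frestrict: "forest F \<Longrightarrow> W \<subseteq> fverts F \<Longrightarrow> forest (frestrict F W)"
  unfolding forest_def
  by (auto intro: finite_subset single_valued_subset acyclic_subset)

lemma frestrict_empty [simp]: "frestrict F {} = Forest {} {}"
  by (simp add: frestrict_def)

lemma forest_zero_iff: "forest F \<Longrightarrow> F = Forest {} {} \<longleftrightarrow> fverts F = {}"
  by (cases F) (auto simp: forest_def)

locale rooted_forest =
  fixes F :: "'s forest"
  assumes F: "forest F"
begin

abbreviation "V \<equiv> fverts F"
abbreviation "E \<equiv> fedges F"

lemma finite_V: "finite V" and EV: "(x, y) \<in> E \<Longrightarrow> x \<in> V \<and> y \<in> V"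
  and parent_unique: "(x, y) \<in> E \<Longrightarrow> (x, z) \<in> E \<Longrightarrow> y = z" and acyclic_E: "acyclic E"
  using F by (auto simp: forest_def single_valued_def)

lemma finite_E: "finite E"
  by (rule finite_subset[of _ "V \<times> V"]) (use EV finite_V in auto)

lemma root_exists: "x \<in> V \<Longrightarrow> \<exists>r\<in>froots F. (x, r) \<in> E\<^sup>*"
proof (induction x rule: wf_induct_rule[OF finite_acyclic_wf_converse[OF finite_E acyclic_E]])
  case (1 x)
  show ?case
  proof (cases "x \<in> froots F")
    case False
    then obtain y where "(x, y) \<in> E" using 1(2) by (auto simp: froots_def)
    moreover from this obtain r where "r \<in> froots F" "(y, r) \<in> E\<^sup>*" using 1(1) EV by blast
    ultimately show ?thesis by (meson converse_rtrancl_into_rtrancl)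
  qed auto
qed

lemma leaf_exists: "x \<in> V \<Longrightarrow> \<exists>l\<in>fleaves F. (l, x) \<in> E\<^sup>*"
proof (induction x rule: wf_induct_rule[OF finite_acyclic_wf[OF finite_E acyclic_E]])
  case (1 x)
  show ?case
  proof (cases "x \<in> fleaves F")
    case False
    then obtain y where "(y, x) \<in> E" using 1(2) by (auto simp: fleaves_def)
    moreover from this obtain r where "r \<in> fleaves F" "(r, y) \<in> E\<^sup>*" using 1(1) EV by blast
    ultimately show ?thesis by (meson rtrancl_into_rtrancl)
  qed auto
qed

lemma down_rtrancl:
  assumes "down F W" "(x, y) \<in> E\<^sup>*" "y \<in> W"
  shows "x \<in> W"
  using assms(2,3) by (induction rule: converse_rtrancl_induct) (use assms(1) in \<open>auto simp: down_def\<close>)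

text \<open>On the way to the root a path leaves a descendant-closed set at most once and never
  returns, so it contains at most one crossing edge. In particular no root in \<open>W\<close> lies
  above a crossing edge.\<close>

lemma cut_of_cuts:
  assumes W: "down F W"
  shows "cut_of F W \<in> cuts F"
proof -
  have eq: "(u, v) = (u', v')"
    if e: "(u, v) \<in> E" "u \<in> W" "v \<notin> W" "(x, u) \<in> E\<^sup>*" "(u', v') \<in> E" "u' \<in> W" "v' \<notin> W" "(x, u') \<in> E\<^sup>*" for x u v u' v'
  proof -
    have *: "a = b" if "(a, b) \<in> E\<^sup>*" "(a, c) \<in> E" "c \<notin> W" "b \<in> W" for a b c
      using that(1)
    proof (cases rule: converse_rtranclE)
      case (step d)
      then have "d = c" using parent_unique that(2) by blast
      then show ?thesis using down_rtrancl[OF W, of c b] step that by blast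
    qed
    have "(u, u') \<in> E\<^sup>* \<or> (u', u) \<in> E\<^sup>*"
      by (rule single_valued_confluent[OF _ e(4,8)]) (auto intro: single_valuedI parent_unique)
    then have "u = u'" using * e by blast
    then show ?thesis using parent_unique e by blast
  qed
  show ?thesis
    unfolding cuts_def cut_of_def root_path_def
    using down_rtrancl[OF W] by (auto dest: eq)
qed

lemma root_part_cut_of:
  assumes W: "down F W"
  shows "root_part F (cut_of F W) = V - W"
proof -
  let ?E = "E - {(x, y) \<in> E. x \<in> W \<and> y \<notin> W}"
  \<comment> \<open>Once the crossing edges are removed, no path changes between \<open>W\<close>
    and its complement.\<close>
  have stay: "x \<in> W \<longleftrightarrow> y \<in> W" if "(x, y) \<in> ?E\<^sup>*" for x y
    using that by (induction rule: rtrancl_induct) (use W in \<open>auto simp: down_def\<close>)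
  have up: "(x, y) \<in> ?E\<^sup>* \<and> y \<notin> W" if "(x, y) \<in> E\<^sup>*" "x \<notin> W" for x y
    using that
  proof (induction rule: rtrancl_induct)
    case (step y z)
    then have "z \<notin> W" using W by (auto simp: down_def)
    moreover have "(y, z) \<in> ?E" using step by blast
    ultimately show ?case using step by (meson rtrancl.rtrancl_into_rtrancl)
  qed simp
  have "x \<in> root_part F (cut_of F W) \<longleftrightarrow> x \<in> V - W" for x
  proof
    assume "x \<in> root_part F (cut_of F W)"
    then obtain r where "x \<in> V" "r \<notin> W" "r \<in> froots F" "(x, r) \<in> ?E\<^sup>*"
      unfolding root_part_def cut_of_def by auto
    then show "x \<in> V - W" using stay by blast
  next
    assume x: "x \<in> V - W"
    then obtain r where r: "r \<in> froots F" "(x, r) \<in> E\<^sup>*" using root_exists by blast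
    then have "(x, r) \<in> ?E\<^sup>*" "r \<notin> W" using up[OF r(2)] x by auto
    then show "x \<in> root_part F (cut_of F W)"
      using x r unfolding root_part_def cut_of_def by auto
  qed
  then show ?thesis by blast
qed

lemma below_cut_of: "down F W \<Longrightarrow> below F (cut_of F W) = W"
  using root_part_cut_of[of W] by (auto simp: below_def down_def)

text \<open>The parent is unique, so the way from \<open>x\<close> to its root begins with the edge
  to \<open>y\<close>.\<close>

lemma root_part_step:
  assumes "(x, y) \<in> E"
  shows "x \<in> root_part F (S, Z) \<longleftrightarrow> (x, y) \<notin> S \<and> y \<in> root_part F (S, Z)"
proof
  assume "x \<in> root_part F (S, Z)"
  then obtain r where r: "r \<in> froots F" "r \<notin> Z" "(x, r) \<in> (E - S)\<^sup>*" by (auto simp: root_part_def)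
  from r(3) show "(x, y) \<notin> S \<and> y \<in> root_part F (S, Z)"
  proof (cases rule: converse_rtranclE)
    case base
    then show ?thesis using r(1) assms by (auto simp: froots_def)
  next
    case (step z)
    then have "z = y" using assms parent_unique by blast
    then show ?thesis using step r EV[OF assms] by (auto simp: root_part_def)
  qed
next
  assume y: "(x, y) \<notin> S \<and> y \<in> root_part F (S, Z)"
  then obtain r where r: "r \<in> froots F" "r \<notin> Z" "(y, r) \<in> (E - S)\<^sup>*" by (auto simp: root_part_def)
  have "(x, r) \<in> (E - S)\<^sup>*" using r(3) y assms by (meson DiffI converse_rtrancl_into_rtrancl)
  then show "x \<in> root_part F (S, Z)" using r EV[OF assms] by (auto simp: root_part_def)
qed

lemma root_part_root:
  assumes "r \<in> froots F"
  shows "r \<in> root_part F (S, Z) \<longleftrightarrow> r \<notin> Z"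
proof
  assume "r \<in> root_part F (S, Z)"
  then obtain r' where r': "r' \<notin> Z" "(r, r') \<in> (E - S)\<^sup>*" by (auto simp: root_part_def)
  from r'(2) have "r = r'" by (cases rule: converse_rtranclE) (use assms in \<open>auto simp: froots_def\<close>)
  then show "r \<notin> Z" using r' by simp
next
  assume "r \<notin> Z"
  then show "r \<in> root_part F (S, Z)" using assms by (auto simp: root_part_def froots_def)
qed

lemma down_below: "down F (below F c)"
proof (cases c)
  case (Pair S Z)
  show ?thesis unfolding down_def below_def Pair using root_part_step EV by blast
qed

text \<open>Above a cut edge there is neither another cut edge nor a fully cut root.\<close>

lemma cut_edge:
  assumes c: "(S, Z) \<in> cuts F" and e: "(u, v) \<in> S"
  shows "v \<in> root_part F (S, Z)"
proof -
  have uv: "(u, v) \<in> E" using c e by (auto simp: cuts_def)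
  have "(v, y) \<in> E\<^sup>* \<Longrightarrow> (v, y) \<in> (E - S)\<^sup>*" for y
  proof (induction rule: rtrancl_induct)
    case (step y z)
    have "(y, z) \<notin> S"
    proof
      assume yz: "(y, z) \<in> S"
      obtain l where l: "l \<in> fleaves F" "(l, u) \<in> E\<^sup>*" using leaf_exists EV[OF uv] by blast
      have uy: "(u, y) \<in> E\<^sup>+" using uv step(1) by (rule rtrancl_into_trancl2)
      then have ly: "(l, y) \<in> E\<^sup>*" using l(2) by (meson rtrancl_trans trancl_into_rtrancl)
      have "(u, v) \<in> S \<inter> root_path F l" "(y, z) \<in> S \<inter> root_path F l"
        using e yz uv step(2) l(2) ly by (auto simp: root_path_def)
      then have "(u, v) = (y, z)" using c l(1) unfolding cuts_def by blast
      then show False using uy acyclic_E by (auto simp: acyclic_def)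
    qed
    then show ?case using step by (meson DiffI rtrancl.rtrancl_into_rtrancl)
  qed simp
  moreover obtain r where r: "r \<in> froots F" "(v, r) \<in> E\<^sup>*" using root_exists EV[OF uv] by blast
  moreover have "r \<notin> Z" using c e r(2) unfolding cuts_def by blast
  ultimately show ?thesis using EV[OF uv] by (auto simp: root_part_def)
qed

text \<open>The cut edges are recovered as the crossing edges: by \<open>cut_edge\<close> the upper
  end of a cut edge is in the root part, by \<open>root_part_step\<close> the lower end is not, and
  an uncut edge has both ends on the same side.\<close>

lemma cut_of_below:
  assumes c: "c \<in> cuts F"
  shows "cut_of F (below F c) = c"
proof -
  obtain S Z where SZ: "c = (S, Z)" by fastforce
  have S: "S \<subseteq> E" and Z: "Z \<subseteq> froots F" using c SZ by (auto simp: cuts_def)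
  have "(x, y) \<in> E \<and> x \<in> below F c \<and> y \<notin> below F c \<longleftrightarrow> (x, y) \<in> S" for x y
    using root_part_step[of x y S Z] cut_edge[of S Z x y] c S EV[of x y] unfolding SZ below_def by blast
  then have "{(x, y) \<in> E. x \<in> below F c \<and> y \<notin> below F c} = S" by auto
  moreover have "froots F \<inter> below F c = Z"
    using root_part_root[of _ S Z] Z unfolding SZ below_def by (auto simp: froots_def)
  ultimately show ?thesis unfolding cut_of_def SZ by simp
qed

text \<open>All cut edges cross the boundary of \<open>below F c\<close>, so among the edges inside
  it there is none to remove.\<close>

lemma cut_P_frestrict: "c \<in> cuts F \<Longrightarrow> cut_P F c = frestrict F (below F c)"
proof -
  assume c: "c \<in> cuts F"
  have "fst (cut_of F (below F c)) \<inter> below F c \<times> below F c = {}" by (auto simp: cut_of_def)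
  then have "fst c \<inter> below F c \<times> below F c = {}" unfolding cut_of_below[OF c] .
  then show ?thesis by (auto simp: cut_P_def frestrict_def below_def Let_def)
qed

lemma cut_R_frestrict: "c \<in> cuts F \<Longrightarrow> cut_R F c = frestrict F (V - below F c)"
proof -
  assume c: "c \<in> cuts F"
  have "fst (cut_of F (below F c)) \<inter> (V - below F c) \<times> (V - below F c) = {}" by (auto simp: cut_of_def)
  then have "fst c \<inter> (V - below F c) \<times> (V - below F c) = {}" unfolding cut_of_below[OF c] .
  moreover have "root_part F c = V - below F c" by (auto simp: below_def root_part_def)
  ultimately show ?thesis by (auto simp: cut_R_def frestrict_def Let_def)
qed

lemma below_sub: "below F c \<subseteq> V"
  by (auto simp: below_def)

lemma finite_cuts: "finite (cuts F)"
proof (rule finite_subset)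
  show "cuts F \<subseteq> cut_of F ` Pow V" using cut_of_below below_sub by (metis PowI image_eqI subsetI)
qed (use finite_V in simp)

lemma forest_cut: "c \<in> cuts F \<Longrightarrow> forest (cut_P F c)" "c \<in> cuts F \<Longrightarrow> forest (cut_R F c)"
  by (simp_all add: cut_P_frestrict cut_R_frestrict forest_frestrict[OF F] below_sub)

end

section \<open>Relabeling and disjoint unions of forests\<close>

definition fmap :: "('s \<Rightarrow> 's) \<Rightarrow> 's forest \<Rightarrow> 's forest" where
  "fmap f F = Forest (f ` fverts F) (map_prod f f ` fedges F)"

lemma fmap_simps [simp]: "fverts (fmap f F) = f ` fverts F" "fedges (fmap f F) = map_prod f f ` fedges F"
  by (simp_all add: fmap_def)

lemma forest_iso_refl: "forest_iso F F"
  unfolding forest_iso_def by (rule exI[of _ id]) auto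

lemma forest_iso_sym:
  assumes "forest_iso F G"
  shows "forest_iso G F"
proof -
  obtain f where f: "bij_betw f (fverts F) (fverts G)"
    "\<And>x y. x \<in> fverts F \<Longrightarrow> y \<in> fverts F \<Longrightarrow> (x, y) \<in> fedges F \<longleftrightarrow> (f x, f y) \<in> fedges G"
    using assms by (auto simp: forest_iso_def)
  let ?g = "the_inv_into (fverts F) f"
  have "?g x \<in> fverts F" "f (?g x) = x" if "x \<in> fverts G" for x
    using that f(1) by (auto simp: bij_betw_def the_inv_into_into f_the_inv_into_f)
  then have "(x, y) \<in> fedges G \<longleftrightarrow> (?g x, ?g y) \<in> fedges F" if "x \<in> fverts G" "y \<in> fverts G" for x y
    using f(2)[of "?g x" "?g y"] that by simp
  then show ?thesis unfolding forest_iso_def using bij_betw_the_inv_into[OF f(1)] by blast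
qed

lemma forest_iso_trans:
  assumes "forest_iso F G" "forest_iso G H"
  shows "forest_iso F H"
proof -
  obtain f where f: "bij_betw f (fverts F) (fverts G)"
    "\<And>x y. x \<in> fverts F \<Longrightarrow> y \<in> fverts F \<Longrightarrow> (x, y) \<in> fedges F \<longleftrightarrow> (f x, f y) \<in> fedges G"
    using assms(1) by (auto simp: forest_iso_def)
  obtain g where g: "bij_betw g (fverts G) (fverts H)"
    "\<And>x y. x \<in> fverts G \<Longrightarrow> y \<in> fverts G \<Longrightarrow> (x, y) \<in> fedges G \<longleftrightarrow> (g x, g y) \<in> fedges H"
    using assms(2) by (auto simp: forest_iso_def)
  have "f x \<in> fverts G" if "x \<in> fverts F" for x using f(1) that by (auto simp: bij_betw_def)
  then show ?thesis
    unfolding forest_iso_def using bij_betw_trans[OF f(1) g(1)] f(2) g(2)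
    by (intro exI[of _ "g \<circ> f"]) auto
qed

context
  fixes f :: "'s \<Rightarrow> 's"
  assumes f: "bij f"
begin

lemma fmap_edge: "(f x, f y) \<in> fedges (fmap f F) \<longleftrightarrow> (x, y) \<in> fedges F"
  using bij_is_inj[OF f] by (auto simp: inj_eq)

lemma forest_iso_fmap: "forest_iso F (fmap f F)"
  unfolding forest_iso_def
proof (intro exI[of _ f] conjI ballI)
  show "bij_betw f (fverts F) (fverts (fmap f F))"
    using inj_on_subset[OF bij_is_inj[OF f] subset_UNIV] by (simp add: bij_betw_def)
qed (simp only: fmap_edge)

lemma forest_fmap:
  assumes "forest F"
  shows "forest (fmap f F)"
proof -
  interpret rooted_forest F by unfold_locales (fact assms)
  have "acyclic (map_prod f f ` E)"
  proof (rule acyclicI, intro allI notI)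
    fix a assume "(a, a) \<in> (map_prod f f ` E)\<^sup>+"
    moreover have "\<exists>x y. a = f x \<and> b = f y \<and> (x, y) \<in> E\<^sup>+" if "(a, b) \<in> (map_prod f f ` E)\<^sup>+" for a b
      using that
    proof (induction rule: trancl_induct)
      case (step b c)
      then obtain x y where xy: "a = f x" "b = f y" "(x, y) \<in> E\<^sup>+" by blast
      obtain y' z where "b = f y'" "c = f z" "(y', z) \<in> E" using step(2) by auto
      then have "(x, z) \<in> E\<^sup>+" "c = f z" using xy bij_is_inj[OF f] by (auto simp: inj_eq intro: trancl_into_trancl)
      then show ?case using xy by blast
    qed auto
    ultimately show False using acyclic_E bij_is_inj[OF f] by (fastforce simp: acyclic_def inj_eq)
  qed
  then show ?thesis
    unfolding forest_def using finite_V EV parent_unique bij_is_inj[OF f]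
    by (auto simp: single_valued_def inj_eq)
qed

lemma down_fmap: "down F W \<Longrightarrow> down (fmap f F) (f ` W)"
  unfolding down_def using bij_is_inj[OF f] by (auto simp: inj_eq)

lemma frestrict_fmap: "frestrict (fmap f F) (f ` W) = fmap f (frestrict F W)"
  using bij_is_inj[OF f] by (auto simp: frestrict_def fmap_def inj_eq)

end

lemma fmap_inv: "bij f \<Longrightarrow> fmap (inv f) (fmap f F) = F"
  by (rule forest.expand) (force simp: image_image inv_f_f bij_is_inj map_prod_def split_beta)

lemma forest_isoE:
  assumes "forest_iso F G" "forest F" "forest G"
  obtains f where "bij f" "G = fmap f F"
proof -
  obtain g where g: "bij_betw g (fverts F) (fverts G)"
    "\<And>x y. x \<in> fverts F \<Longrightarrow> y \<in> fverts F \<Longrightarrow> (x, y) \<in> fedges F \<longleftrightarrow> (g x, g y) \<in> fedges G"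
    using assms(1) by (auto simp: forest_iso_def)
  have "finite (fverts F)" using assms(2) by (simp add: forest_def)
  then obtain f where f: "bij f" "\<And>x. x \<in> fverts F \<Longrightarrow> f x = g x"
    using ex_bij_extension[of "fverts F" g] g(1) by (auto simp: bij_betw_def)
  have v: "f ` fverts F = fverts G" using g(1) f(2) by (auto simp: bij_betw_def)
  have "(a, b) \<in> fedges G \<longleftrightarrow> (a, b) \<in> map_prod f f ` fedges F" for a b
  proof
    assume ab: "(a, b) \<in> fedges G"
    then have "a \<in> fverts G" "b \<in> fverts G" using assms(3) by (auto simp: forest_def)
    then obtain x y where xy: "x \<in> fverts F" "y \<in> fverts F" "a = f x" "b = f y" using v by blast
    then have "(x, y) \<in> fedges F" using ab g(2)[of x y] f(2) by simp
    then show "(a, b) \<in> map_prod f f ` fedges F" using xy by force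
  next
    assume "(a, b) \<in> map_prod f f ` fedges F"
    then obtain x y where xy: "(x, y) \<in> fedges F" "a = f x" "b = f y" by auto
    then have "x \<in> fverts F" "y \<in> fverts F" using assms(2) by (auto simp: forest_def)
    then show "(a, b) \<in> fedges G" using xy g(2)[of x y] f(2) by simp
  qed
  then have "fedges G = map_prod f f ` fedges F" by auto
  then have "G = fmap f F" using v by (intro forest.expand) simp
  then show ?thesis using that f(1) by blast
qed

definition funion :: "'s forest \<Rightarrow> 's forest \<Rightarrow> 's forest" where
  "funion F G = Forest (fverts F \<union> fverts G) (fedges F \<union> fedges G)"

lemma LRF_simps [simp]:
  "Obj LRF = {F. forest F}" "isom LRF = forest_iso" "zero_obj LRF = Forest {} {}"
  "disj_labels LRF F G \<longleftrightarrow> fverts F \<inter> fverts G = {}" "disj_union LRF F G = funion F G"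
  "Sub LRF = cuts" "sub_obj LRF = cut_P" "quot_obj LRF = cut_R"
  by (simp_all add: LRF_def funion_def)

lemma forest_funion:
  assumes "forest F" "forest G" "fverts F \<inter> fverts G = {}"
  shows "forest (funion F G)"
proof -
  have "acyclic (fedges F \<union> fedges G)"
  proof (rule acyclicI, intro allI notI)
    fix x assume "(x, x) \<in> (fedges F \<union> fedges G)\<^sup>+"
    moreover have "(x, y) \<in> (fedges F)\<^sup>+ \<and> y \<in> fverts F \<or> (x, y) \<in> (fedges G)\<^sup>+ \<and> y \<in> fverts G"
      if "(x, y) \<in> (fedges F \<union> fedges G)\<^sup>+" for x y
      using that
    proof (induction rule: trancl_induct)
      case (base y)
      then show ?case using assms by (auto simp: forest_def)
    next
      case (step y z)
      then show ?case using assms unfolding forest_def by (blast intro: trancl_into_trancl)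
    qed
    ultimately have "(x, x) \<in> (fedges F)\<^sup>+ \<or> (x, x) \<in> (fedges G)\<^sup>+" by blast
    then show False using assms(1,2) by (auto simp: forest_def acyclic_def)
  qed
  then show ?thesis
    using assms unfolding forest_def funion_def by (auto simp: single_valued_def)
qed

lemma frestrict_funion:
  assumes "forest F" "forest G" "fverts F \<inter> fverts G = {}" "W \<subseteq> fverts F \<union> fverts G"
  shows "frestrict (funion F G) W = funion (frestrict F (W \<inter> fverts F)) (frestrict G (W \<inter> fverts G))"
proof -
  have "fedges F \<subseteq> fverts F \<times> fverts F" "fedges G \<subseteq> fverts G \<times> fverts G" using assms by (auto simp: forest_def)
  then have "(fedges F \<union> fedges G) \<inter> W \<times> W =
      fedges F \<inter> (W \<inter> fverts F) \<times> (W \<inter> fverts F) \<union> fedges G \<inter> (W \<inter> fverts G) \<times> (W \<inter> fverts G)"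
    by blast
  moreover have "W = W \<inter> fverts F \<union> W \<inter> fverts G" using assms(4) by blast
  ultimately show ?thesis by (simp add: frestrict_def funion_def)
qed

section \<open>The correspondence of cuts and closed sets applied to relabelings, towers and
  unions\<close>

lemma bij_below:
  assumes "forest F"
  shows "bij_betw (below F) (cuts F) {W. down F W}" "bij_betw (cut_of F) {W. down F W} (cuts F)"
proof -
  interpret rooted_forest F by unfold_locales (fact assms)
  show "bij_betw (below F) (cuts F) {W. down F W}"
    by (rule bij_betw_byWitness[of _ "cut_of F"])
      (auto simp: cut_of_below below_cut_of down_below cut_of_cuts)
  show "bij_betw (cut_of F) {W. down F W} (cuts F)"
    by (rule bij_betw_byWitness[of _ "below F"])
      (auto simp: cut_of_below below_cut_of down_below cut_of_cuts)
qed

text \<open>A relabeling acts on closed sets of vertices, and the correspondence with cuts carries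
  this action over to cuts.\<close>

lemma forest_transport:
  assumes "forest A" "forest B" "forest_iso A B"
  shows "\<exists>\<phi>. bij_betw \<phi> (cuts A) (cuts B) \<and>
    (\<forall>c\<in>cuts A. forest_iso (cut_P A c) (cut_P B (\<phi> c)) \<and> forest_iso (cut_R A c) (cut_R B (\<phi> c)))"
proof -
  obtain f where f: "bij f" "B = fmap f A" using assms(3,1,2) by (rule forest_isoE)
  interpret A: rooted_forest A by unfold_locales (fact assms(1))
  interpret B: rooted_forest B by unfold_locales (fact assms(2))
  have inv: "inv f ` f ` W = W" "f ` inv f ` W = W" for W
    using f(1) by (simp_all add: image_inv_f_f bij_is_inj image_f_inv_f bij_is_surj)
  have "bij_betw ((`) f) {W. down A W} {W. down B W}"
  proof (rule bij_betw_byWitness[of _ "(`) (inv f)"])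
    show "(`) f ` {W. down A W} \<subseteq> {W. down B W}" using down_fmap[OF f(1)] f(2) by blast
    show "(`) (inv f) ` {W. down B W} \<subseteq> {W. down A W}"
      using down_fmap[OF bij_imp_bij_inv[OF f(1)], of B] fmap_inv[OF f(1), of A] f(2) by auto
  qed (auto simp: inv)
  then have bij: "bij_betw (cut_of B \<circ> ((`) f \<circ> below A)) (cuts A) (cuts B)"
    using bij_below(1)[OF assms(1)] bij_below(2)[OF assms(2)] by (blast intro: bij_betw_trans)
  have "forest_iso (cut_P A c) (cut_P B (cut_of B (f ` below A c))) \<and>
      forest_iso (cut_R A c) (cut_R B (cut_of B (f ` below A c)))" if c: "c \<in> cuts A" for c
  proof -
    have W: "down B (f ` below A c)" using down_fmap[OF f(1) A.down_below] f(2) by simp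
    have "fverts B - f ` below A c = f ` (fverts A - below A c)"
      using bij_is_inj[OF f(1)] f(2) by (simp add: image_set_diff)
    then show ?thesis
      using A.cut_P_frestrict[OF c] A.cut_R_frestrict[OF c] B.cut_P_frestrict[OF B.cut_of_cuts[OF W]] B.cut_R_frestrict[OF B.cut_of_cuts[OF W]]
        B.below_cut_of[OF W] forest_iso_fmap[OF f(1)] frestrict_fmap[OF f(1), of A] f(2) by metis
  qed
  then show ?thesis using bij by (intro exI[of _ "cut_of B \<circ> ((`) f \<circ> below A)"]) auto
qed

text \<open>A tower is a pair of disjoint sets \<open>U\<close> and \<open>V\<close> such that \<open>U\<close> and \<open>U \<union> V\<close> are closed under descendants.\<close>

lemma forest_towers:
  assumes "forest A"
  shows "\<exists>\<Phi>. bij_betw \<Phi> (SIGMA u:cuts A. cuts (cut_R A u)) (SIGMA w:cuts A. cuts (cut_P A w)) \<and>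
    (\<forall>u\<in>cuts A. \<forall>v\<in>cuts (cut_R A u). \<forall>w t. \<Phi> (u, v) = (w, t) \<longrightarrow>
      cut_P (cut_P A w) t = cut_P A u \<and> cut_R (cut_P A w) t = cut_P (cut_R A u) v \<and>
      cut_R A w = cut_R (cut_R A u) v)"
proof -
  interpret A: rooted_forest A by unfold_locales (fact assms)
  let ?V = "fverts A"
  \<comment> \<open>In terms of vertex sets \<open>\<Phi>\<close> sends \<open>(U, V')\<close> to
    \<open>(U \<union> V', U)\<close>, and its inverse \<open>\<Psi>\<close> sends
    \<open>(W, U)\<close> to \<open>(U, W - U)\<close>.\<close>
  define \<Phi> where "\<Phi> = (\<lambda>(u, v). let U = below A u; W = U \<union> below (cut_R A u) v in (cut_of A W, cut_of (frestrict A W) U))"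
  define \<Psi> where "\<Psi> = (\<lambda>(w, t). let U = below (cut_P A w) t in (cut_of A U, cut_of (frestrict A (?V - U)) (below A w - U)))"
  have 1: "down A (U \<union> V') \<and> down (frestrict A (U \<union> V')) U \<and> V' \<subseteq> ?V - U"
    if "down A U" "down (frestrict A (?V - U)) V'" for U V'
  proof -
    have V': "V' \<subseteq> ?V - U" using that(2) by (simp add: down_def)
    have "x \<in> U \<union> V'" if xy: "(x, y) \<in> A.E" "y \<in> U \<union> V'" for x y
    proof (cases "x \<in> U \<or> y \<in> U")
      case True
      then show ?thesis using \<open>down A U\<close> xy(1) unfolding down_def by blast
    next
      case False
      then have "(x, y) \<in> fedges (frestrict A (?V - U))" "y \<in> V'" using xy A.EV[OF xy(1)] by auto
      then show ?thesis using \<open>down (frestrict A (?V - U)) V'\<close> unfolding down_def by blast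
    qed
    then show ?thesis using V' \<open>down A U\<close> unfolding down_def by auto
  qed
  have 2: "down A U \<and> down (frestrict A (?V - U)) (W - U) \<and> U \<subseteq> W"
    if "down A W" "down (frestrict A W) U" for U W
    using that unfolding down_def by auto
  have PR: "cut_P F (cut_of F W) = frestrict F W" "cut_R F (cut_of F W) = frestrict F (fverts F - W)"
    "cut_of F W \<in> cuts F" "below F (cut_of F W) = W" if "forest F" "down F W" for F W
  proof -
    interpret F: rooted_forest F by unfold_locales (fact that(1))
    show "cut_P F (cut_of F W) = frestrict F W" "cut_R F (cut_of F W) = frestrict F (fverts F - W)"
      "cut_of F W \<in> cuts F" "below F (cut_of F W) = W"
      using F.cut_P_frestrict F.cut_R_frestrict F.cut_of_cuts F.below_cut_of that(2) by auto
  qed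
  have cut: "down F (below F c) \<and> cut_of F (below F c) = c \<and> cut_P F c = frestrict F (below F c) \<and> cut_R F c = frestrict F (fverts F - below F c)"
    if "forest F" "c \<in> cuts F" for F c
  proof -
    interpret F: rooted_forest F by unfold_locales (fact that(1))
    show ?thesis using F.cut_P_frestrict F.cut_R_frestrict F.cut_of_below F.down_below that(2) by auto
  qed
  have ff: "forest (frestrict A W)" if "W \<subseteq> ?V" for W by (rule forest_frestrict[OF assms that])
  have \<Phi>: "(w, t) \<in> (SIGMA w:cuts A. cuts (cut_P A w)) \<and> \<Psi> (w, t) = (u, v) \<and>
      cut_P (cut_P A w) t = cut_P A u \<and> cut_R (cut_P A w) t = cut_P (cut_R A u) v \<and>
      cut_R A w = cut_R (cut_R A u) v"
    if u: "u \<in> cuts A" and v: "v \<in> cuts (cut_R A u)" and wt: "\<Phi> (u, v) = (w, t)" for u v w t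
  proof -
    define U where "U = below A u"
    define V' where "V' = below (cut_R A u) v"
    have cu: "down A U" "cut_of A U = u" "cut_P A u = frestrict A U" "cut_R A u = frestrict A (?V - U)"
      using cut[OF assms u] by (simp_all add: U_def)
    have fR: "forest (frestrict A (?V - U))" by (rule ff) blast
    have cv: "down (frestrict A (?V - U)) V'" "cut_of (frestrict A (?V - U)) V' = v"
      "cut_P (cut_R A u) v = frestrict (frestrict A (?V - U)) V'" "cut_R (cut_R A u) v = frestrict (frestrict A (?V - U)) (?V - U - V')"
      using cut[OF fR, of v] v cu(4) by (simp_all add: V'_def)
    note d = 1[OF cu(1) cv(1)]
    have wt': "w = cut_of A (U \<union> V')" "t = cut_of (frestrict A (U \<union> V')) U"
      using wt by (simp_all add: \<Phi>_def U_def V'_def Let_def)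
    have UV: "U \<union> V' \<subseteq> ?V" using d by (simp add: down_def)
    note w = PR[OF assms, of "U \<union> V'"] and t = PR[OF ff[OF UV], of U]
    have *: "?V - (U \<union> V') = ?V - U - V'" "U \<union> V' - U = V'" using d by auto
    have P: "cut_P A w = frestrict A (U \<union> V')" using w(1) d wt' by simp
    have "\<Psi> (w, t) = (u, v)"
      using w(4) t(4) d cu(2) cv(2) * P unfolding \<Psi>_def wt' by (simp add: Let_def)
    then show ?thesis using d w t cu cv * P wt' by (auto simp: frestrict_frestrict)
  qed
  have \<Psi>: "(u, v) \<in> (SIGMA u:cuts A. cuts (cut_R A u)) \<and> \<Phi> (u, v) = (w, t)"
    if w: "w \<in> cuts A" and t: "t \<in> cuts (cut_P A w)" and uv: "\<Psi> (w, t) = (u, v)" for u v w t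
  proof -
    define W where "W = below A w"
    define U where "U = below (cut_P A w) t"
    have cw: "down A W" "cut_of A W = w" "cut_P A w = frestrict A W"
      using cut[OF assms w] by (simp_all add: W_def)
    have fW: "forest (frestrict A W)" by (rule ff) (use cw(1) in \<open>simp add: down_def\<close>)
    have ct: "down (frestrict A W) U" "cut_of (frestrict A W) U = t"
      using cut[OF fW, of t] t cw(3) by (simp_all add: U_def)
    note d = 2[OF cw(1) ct(1)]
    have uv': "u = cut_of A U" "v = cut_of (frestrict A (?V - U)) (W - U)"
      using uv by (simp_all add: \<Psi>_def W_def U_def Let_def)
    have fR: "forest (frestrict A (?V - U))" by (rule ff) blast
    note u = PR[OF assms, of U] and v = PR[OF fR, of "W - U"]
    have R: "cut_R A u = frestrict A (?V - U)" using u(2) d uv' by simp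
    have *: "U \<union> (W - U) = W" using d by blast
    have "\<Phi> (u, v) = (w, t)"
      using u(4) v(4) d cw(2) ct(2) * R unfolding \<Phi>_def uv' by (simp add: Let_def)
    then show ?thesis using d u v R uv' by auto
  qed
  have "bij_betw \<Phi> (SIGMA u:cuts A. cuts (cut_R A u)) (SIGMA w:cuts A. cuts (cut_P A w))"
  proof (rule bij_betw_byWitness[of _ \<Psi>])
    show "\<forall>p\<in>(SIGMA u:cuts A. cuts (cut_R A u)). \<Psi> (\<Phi> p) = p" using \<Phi> by (metis (no_types, lifting) SigmaE surj_pair)
    show "\<forall>p\<in>(SIGMA w:cuts A. cuts (cut_P A w)). \<Phi> (\<Psi> p) = p" using \<Psi> by (metis (no_types, lifting) SigmaE surj_pair)
    show "\<Phi> ` (SIGMA u:cuts A. cuts (cut_R A u)) \<subseteq> (SIGMA w:cuts A. cuts (cut_P A w))"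
    proof
      fix p assume "p \<in> \<Phi> ` (SIGMA u:cuts A. cuts (cut_R A u))"
      then obtain u v where uv: "u \<in> cuts A" "v \<in> cuts (cut_R A u)" "\<Phi> (u, v) = (fst p, snd p)" by auto
      show "p \<in> (SIGMA w:cuts A. cuts (cut_P A w))" using \<Phi>[OF uv] by simp
    qed
    show "\<Psi> ` (SIGMA w:cuts A. cuts (cut_P A w)) \<subseteq> (SIGMA u:cuts A. cuts (cut_R A u))"
    proof
      fix p assume "p \<in> \<Psi> ` (SIGMA w:cuts A. cuts (cut_P A w))"
      then obtain w t where wt: "w \<in> cuts A" "t \<in> cuts (cut_P A w)" "\<Psi> (w, t) = (fst p, snd p)" by auto
      show "p \<in> (SIGMA u:cuts A. cuts (cut_R A u))" using \<Psi>[OF wt] by simp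
    qed
  qed
  then show ?thesis using \<Phi> by blast
qed

text \<open>If the vertices below the cut meet both \<open>A\<close> and \<open>B\<close>, the
  subobject is decomposable; if the remaining vertices meet both, the quotient is. In all other
  cases one of the two sets of vertices is that of \<open>A\<close> and the other that of
  \<open>B\<close>.\<close>

lemma forest_split:
  assumes A: "forest A" and B: "forest B" and nz: "A \<noteq> Forest {} {}" "B \<noteq> Forest {} {}"
    and disj: "fverts A \<inter> fverts B = {}" and D: "D = funion A B"
  shows "\<exists>s\<in>cuts D. \<exists>s'\<in>cuts D. s \<noteq> s' \<and> cut_P D s = A \<and> cut_R D s = B \<and> cut_P D s' = B \<and> cut_R D s' = A \<and>
    (\<forall>t\<in>cuts D. t = s \<or> t = s' \<or> cut_P D t = Forest {} {} \<or> cut_R D t = Forest {} {} \<or>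
       decomp (LRF :: ('s::infinite forest, 's cut) hall_cat) (cut_P D t) \<or> decomp (LRF :: ('s forest, 's cut) hall_cat) (cut_R D t))"
proof -
  interpret D: rooted_forest D by unfold_locales (simp add: D forest_funion A B disj)
  let ?a = "fverts A" and ?b = "fverts B"
  have V: "D.V = ?a \<union> ?b" by (simp add: D funion_def)
  have ne: "?a \<noteq> {}" "?b \<noteq> {}" using nz forest_zero_iff A B by auto
  have EA: "fedges A \<subseteq> ?a \<times> ?a" and EB: "fedges B \<subseteq> ?b \<times> ?b" using A B by (auto simp: forest_def)
  have da: "down D ?a" and db: "down D ?b"
    using EA EB disj by (auto simp: down_def D funion_def)
  have res: "frestrict D W = funion (frestrict A (W \<inter> ?a)) (frestrict B (W \<inter> ?b))" if "W \<subseteq> ?a \<union> ?b" for W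
    unfolding D by (rule frestrict_funion[OF A B disj that])
  have fun0: "funion F (Forest {} {}) = F" "funion (Forest {} {}) F = F" for F :: "'s forest"
    by (cases F; simp add: funion_def)+
  have ra: "frestrict D ?a = A" "frestrict D (D.V - ?b) = A" and rb: "frestrict D ?b = B" "frestrict D (D.V - ?a) = B"
  proof -
    have "D.V - ?b = ?a" "D.V - ?a = ?b" using V disj by auto
    then show "frestrict D ?a = A" "frestrict D (D.V - ?b) = A" "frestrict D ?b = B" "frestrict D (D.V - ?a) = B"
      using res[of ?a] res[of ?b] disj frestrict_self[OF A] frestrict_self[OF B] fun0 by (auto simp: Int_commute)
  qed
  have PR: "cut_P D (cut_of D W) = frestrict D W" "cut_R D (cut_of D W) = frestrict D (D.V - W)" if "down D W" for W
    using D.cut_P_frestrict D.cut_R_frestrict D.cut_of_cuts D.below_cut_of that by auto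
  have dec: "decomp (LRF :: ('s forest, 's cut) hall_cat) (frestrict D W)"
    if W: "W \<subseteq> ?a \<union> ?b" "W \<inter> ?a \<noteq> {}" "W \<inter> ?b \<noteq> {}" for W
    unfolding decomp_def
  proof (intro bexI conjI)
    show "frestrict A (W \<inter> ?a) \<noteq> zero_obj LRF" "frestrict B (W \<inter> ?b) \<noteq> zero_obj LRF"
      using W by (auto simp: frestrict_def)
    show "frestrict A (W \<inter> ?a) \<in> Obj LRF" "frestrict B (W \<inter> ?b) \<in> Obj LRF" using A B by (auto intro: forest_frestrict)
    show "disj_labels LRF (frestrict A (W \<inter> ?a)) (frestrict B (W \<inter> ?b))" using disj by auto
    show "frestrict D W = disj_union LRF (frestrict A (W \<inter> ?a)) (frestrict B (W \<inter> ?b))" using res[OF W(1)] by simp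
  qed
  have other: "t = cut_of D ?a \<or> t = cut_of D ?b \<or> cut_P D t = Forest {} {} \<or> cut_R D t = Forest {} {} \<or>
     decomp (LRF :: ('s forest, 's cut) hall_cat) (cut_P D t) \<or> decomp (LRF :: ('s forest, 's cut) hall_cat) (cut_R D t)"
    if t: "t \<in> cuts D" for t
  proof -
    let ?W = "below D t"
    have W: "?W \<subseteq> ?a \<union> ?b" using D.below_sub V by blast
    have t': "cut_of D ?W = t" "cut_P D t = frestrict D ?W" "cut_R D t = frestrict D (D.V - ?W)"
      using D.cut_of_below D.cut_P_frestrict D.cut_R_frestrict t by auto
    have two: ?thesis if "(D.V - ?W) \<inter> ?a \<noteq> {}" "(D.V - ?W) \<inter> ?b \<noteq> {}"
      using dec[of "D.V - ?W"] that V t' by auto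
    show ?thesis
    proof (cases "?W \<inter> ?a = {}")
      case True
      then have Wb: "?W \<subseteq> ?b" and a: "(D.V - ?W) \<inter> ?a \<noteq> {}" using W V ne by blast+
      show ?thesis
      proof (cases "(D.V - ?W) \<inter> ?b = {}")
        case True
        then have "?W = ?b" using Wb V by blast
        then show ?thesis using t' by simp
      qed (use two a in blast)
    next
      case Wa: False
      show ?thesis
      proof (cases "?W \<inter> ?b = {}")
        case True
        then have Wa: "?W \<subseteq> ?a" and b: "(D.V - ?W) \<inter> ?b \<noteq> {}" using W V ne by blast+
        show ?thesis
        proof (cases "(D.V - ?W) \<inter> ?a = {}")
          case True
          then have "?W = ?a" using Wa V by blast
          then show ?thesis using t' by simp
        qed (use two b in blast)
      next
        case False
        then show ?thesis using dec[OF W Wa] t' by simp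
      qed
    qed
  qed
  have "cut_of D ?a \<noteq> cut_of D ?b"
  proof
    assume "cut_of D ?a = cut_of D ?b"
    then have "?a = ?b" using D.below_cut_of[OF da] D.below_cut_of[OF db] by metis
    then show False using ne disj by simp
  qed
  moreover have "cut_P D (cut_of D ?a) = A" "cut_R D (cut_of D ?a) = B"
    "cut_P D (cut_of D ?b) = B" "cut_R D (cut_of D ?b) = A"
    using PR[OF da] PR[OF db] ra rb by simp_all
  ultimately show ?thesis using other D.cut_of_cuts[OF da] D.cut_of_cuts[OF db] by blast
qed

lemma forest_union_iso:
  assumes "forest A" "forest B" "forest A'" "forest B'" "forest_iso A A'" "forest_iso B B'"
    "fverts A \<inter> fverts B = {}" "fverts A' \<inter> fverts B' = {}"
  shows "forest_iso (funion A B) (funion A' B')"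
proof -
  obtain f where f: "bij_betw f (fverts A) (fverts A')"
    "\<And>x y. x \<in> fverts A \<Longrightarrow> y \<in> fverts A \<Longrightarrow> (x, y) \<in> fedges A \<longleftrightarrow> (f x, f y) \<in> fedges A'"
    using assms(5) by (auto simp: forest_iso_def)
  obtain g where g: "bij_betw g (fverts B) (fverts B')"
    "\<And>x y. x \<in> fverts B \<Longrightarrow> y \<in> fverts B \<Longrightarrow> (x, y) \<in> fedges B \<longleftrightarrow> (g x, g y) \<in> fedges B'"
    using assms(6) by (auto simp: forest_iso_def)
  let ?h = "\<lambda>x. if x \<in> fverts A then f x else g x"
  have bij: "bij_betw ?h (fverts A \<union> fverts B) (fverts A' \<union> fverts B')"
    by (rule bij_betw_disjoint_Un[OF f(1) g(1) assms(7,8)])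
  have E: "fedges F \<subseteq> fverts F \<times> fverts F" if "forest F" for F :: "'a forest" using that by (simp add: forest_def)
  have hA: "f x \<in> fverts A'" if "x \<in> fverts A" for x using f(1) that by (auto simp: bij_betw_def)
  have hB: "g x \<in> fverts B'" if "x \<in> fverts B" for x using g(1) that by (auto simp: bij_betw_def)
  have "(x, y) \<in> fedges A \<union> fedges B \<longleftrightarrow> (?h x, ?h y) \<in> fedges A' \<union> fedges B'"
    if "x \<in> fverts A \<union> fverts B" "y \<in> fverts A \<union> fverts B" for x y
  proof (cases "x \<in> fverts A"; cases "y \<in> fverts A")
    assume "x \<in> fverts A" "y \<in> fverts A"
    then show ?thesis using f(2)[of x y] hA[of x] E[OF assms(2)] E[OF assms(4)] assms(7,8) by auto
  next
    assume *: "x \<in> fverts A" "y \<notin> fverts A"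
    then have "y \<in> fverts B" using that by blast
    then show ?thesis using * hA[of x] hB[of y] E[OF assms(1)] E[OF assms(2)] E[OF assms(3)] E[OF assms(4)] assms(7,8) by auto
  next
    assume *: "x \<notin> fverts A" "y \<in> fverts A"
    then have "x \<in> fverts B" using that by blast
    then show ?thesis using * hA[of y] hB[of x] E[OF assms(1)] E[OF assms(2)] E[OF assms(3)] E[OF assms(4)] assms(7,8) by auto
  next
    assume *: "x \<notin> fverts A" "y \<notin> fverts A"
    then have "x \<in> fverts B" "y \<in> fverts B" using that by blast+
    then show ?thesis using * g(2)[of x y] hB[of x] E[OF assms(1)] E[OF assms(3)] assms(7,8) by auto
  qed
  then show ?thesis unfolding forest_iso_def using bij by (intro exI[of _ ?h]) (simp add: funion_def)
qed

lemma forest_iso_empty: "forest F \<Longrightarrow> forest_iso (Forest {} {}) F \<Longrightarrow> F = Forest {} {}"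
  using forest_zero_iff[of F] by (auto simp: forest_iso_def bij_betw_def)

lemma cls_LRF: "forest_iso F G \<Longrightarrow> cls LRF F = cls LRF G"
  using forest_iso_trans[of F G] forest_iso_trans[of G F] forest_iso_sym[of F G] by (auto simp: cls_def)

text \<open>Up to isomorphism all labels can be taken from one fixed set of \<open>n\<close>
  labels.\<close>

lemma finite_forest_classes:
  "finite (cls (LRF :: ('s::infinite forest, 's cut) hall_cat) ` {F \<in> Obj LRF. card (fverts F) \<le> n})"
proof -
  let ?C = "LRF :: ('s forest, 's cut) hall_cat"
  obtain Z :: "'s set" where Z: "finite Z" "card Z = n"
    using infinite_arbitrarily_large[OF infinite_UNIV, of n] by blast
  have "cls ?C ` {F \<in> Obj LRF. card (fverts F) \<le> n} \<subseteq> cls ?C ` ((\<lambda>(W, E). Forest W E) ` (Pow Z \<times> Pow (Z \<times> Z)))"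
  proof
    fix M assume "M \<in> cls ?C ` {F \<in> Obj LRF. card (fverts F) \<le> n}"
    then obtain F where F: "M = cls ?C F" "forest F" "card (fverts F) \<le> n" by auto
    have "finite (fverts F)" using F(2) by (simp add: forest_def)
    then obtain f where f: "bij f" "f ` fverts F \<subseteq> Z" using ex_bij_into[of "fverts F" Z] Z F(3) by auto
    let ?G = "fmap f F"
    have G: "forest ?G" by (rule forest_fmap[OF f(1) F(2)])
    have iso: "forest_iso F ?G" by (rule forest_iso_fmap[OF f(1)])
    have "cls ?C F = cls ?C ?G" using iso by (rule cls_LRF)
    moreover have "?G \<in> (\<lambda>(W, E). Forest W E) ` (Pow Z \<times> Pow (Z \<times> Z))"
    proof (rule image_eqI[of _ _ "(fverts ?G, fedges ?G)"])
      have "fverts ?G \<subseteq> Z" using f(2) by simp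
      moreover have "fedges ?G \<subseteq> fverts ?G \<times> fverts ?G" using G by (simp only: forest_def)
      ultimately show "(fverts ?G, fedges ?G) \<in> Pow Z \<times> Pow (Z \<times> Z)" by blast
    qed (simp add: fmap_def)
    ultimately show "M \<in> cls ?C ` ((\<lambda>(W, E). Forest W E) ` (Pow Z \<times> Pow (Z \<times> Z)))" using F(1) by blast
  qed
  then show ?thesis using Z(1) finite_subset by (meson finite_Pow_iff finite_SigmaI finite_imageI)
qed

theorem hall_LRF: "hall_lie_category (LRF :: ('s::infinite forest, 's cut) hall_cat) (\<lambda>F. card (fverts F))"
proof unfold_locales
  let ?C = "LRF :: ('s forest, 's cut) hall_cat"
  fix A B A' B' D :: "'s forest" and u v :: "'s cut"
  show "A \<in> Obj ?C \<Longrightarrow> isom ?C A A" by (simp add: forest_iso_refl)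
  show "isom ?C A B \<Longrightarrow> isom ?C B A" by (simp add: forest_iso_sym)
  show "isom ?C A B \<Longrightarrow> isom ?C B D \<Longrightarrow> isom ?C A D" by simp (rule forest_iso_trans)
  show "finite (Sub ?C A)" if "A \<in> Obj ?C"
    using rooted_forest.finite_cuts[of A] that by (simp add: rooted_forest_def)
  show "\<exists>\<phi>. bij_betw \<phi> (Sub ?C A) (Sub ?C B) \<and> (\<forall>u\<in>Sub ?C A.
        cls ?C (sub_obj ?C B (\<phi> u)) = cls ?C (sub_obj ?C A u) \<and>
        cls ?C (quot_obj ?C B (\<phi> u)) = cls ?C (quot_obj ?C A u))"
    if AB: "A \<in> Obj ?C" "B \<in> Obj ?C" "isom ?C A B"
  proof -
    obtain \<phi> where "bij_betw \<phi> (cuts A) (cuts B)"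
      "\<forall>c\<in>cuts A. forest_iso (cut_P A c) (cut_P B (\<phi> c)) \<and> forest_iso (cut_R A c) (cut_R B (\<phi> c))"
      using forest_transport[of A B] AB by auto
    then show ?thesis using cls_LRF by (intro exI[of _ \<phi>]) auto
  qed
  show *: "quot_obj ?C A u \<in> Obj ?C" if "A \<in> Obj ?C" "u \<in> Sub ?C A" for A u
    using rooted_forest.forest_cut[of A u] that by (simp add: rooted_forest_def)
  show "quot_obj ?C A u \<in> Obj ?C" if "A \<in> Obj ?C" "u \<in> Sub ?C A" by (rule *[OF that])
  show "sub_obj ?C A u \<in> Obj ?C" if "A \<in> Obj ?C" "u \<in> Sub ?C A"
    using rooted_forest.forest_cut[of A u] that by (simp add: rooted_forest_def)
  show "\<exists>\<Phi>. bij_betw \<Phi> (SIGMA u:Sub ?C A. Sub ?C (quot_obj ?C A u))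
      (SIGMA w:Sub ?C A. Sub ?C (sub_obj ?C A w)) \<and> (\<forall>u\<in>Sub ?C A. \<forall>v\<in>Sub ?C (quot_obj ?C A u). \<forall>w t.
        \<Phi> (u, v) = (w, t) \<longrightarrow>
          cls ?C (sub_obj ?C (sub_obj ?C A w) t) = cls ?C (sub_obj ?C A u) \<and>
          cls ?C (quot_obj ?C (sub_obj ?C A w) t) = cls ?C (sub_obj ?C (quot_obj ?C A u) v) \<and>
          cls ?C (quot_obj ?C A w) = cls ?C (quot_obj ?C (quot_obj ?C A u) v))" if A: "A \<in> Obj ?C"
  proof -
    obtain \<Phi> where \<Phi>: "bij_betw \<Phi> (SIGMA u:cuts A. cuts (cut_R A u)) (SIGMA w:cuts A. cuts (cut_P A w))"
      "\<And>u v w t. u \<in> cuts A \<Longrightarrow> v \<in> cuts (cut_R A u) \<Longrightarrow> \<Phi> (u, v) = (w, t) \<Longrightarrow>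
        cut_P (cut_P A w) t = cut_P A u \<and> cut_R (cut_P A w) t = cut_P (cut_R A u) v \<and>
        cut_R A w = cut_R (cut_R A u) v"
      using forest_towers[of A] A by (simp, metis)
    show ?thesis
      unfolding LRF_simps
    proof (intro exI[of _ \<Phi>] conjI[OF \<Phi>(1)] ballI allI impI)
      fix u v w t assume "u \<in> cuts A" "v \<in> cuts (cut_R A u)" "\<Phi> (u, v) = (w, t)"
      from \<Phi>(2)[OF this] show "cls ?C (cut_P (cut_P A w) t) = cls ?C (cut_P A u) \<and>
          cls ?C (cut_R (cut_P A w) t) = cls ?C (cut_P (cut_R A u) v) \<and>
          cls ?C (cut_R A w) = cls ?C (cut_R (cut_R A u) v)" by simp
    qed
  qed
  show "\<exists>w\<in>Sub ?C A. cls ?C (quot_obj ?C A w) = cls ?C (quot_obj ?C (quot_obj ?C A u) v)"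
    if A: "A \<in> Obj ?C" and u: "u \<in> Sub ?C A" and v: "v \<in> Sub ?C (quot_obj ?C A u)"
  proof -
    obtain \<Phi> where \<Phi>: "bij_betw \<Phi> (SIGMA u:cuts A. cuts (cut_R A u)) (SIGMA w:cuts A. cuts (cut_P A w))"
      "\<And>u v w t. u \<in> cuts A \<Longrightarrow> v \<in> cuts (cut_R A u) \<Longrightarrow> \<Phi> (u, v) = (w, t) \<Longrightarrow>
        cut_R A w = cut_R (cut_R A u) v"
      using forest_towers[of A] A by (simp, metis)
    have "\<Phi> (u, v) \<in> (SIGMA w:cuts A. cuts (cut_P A w))"
      using \<Phi>(1) u v by (intro bij_betw_apply[OF \<Phi>(1)]) simp
    then obtain w t where "w \<in> cuts A" "\<Phi> (u, v) = (w, t)" by auto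
    then show ?thesis using \<Phi>(2)[of u v w t] u v by (intro bexI[of _ w]) simp_all
  qed
  show "zero_obj ?C \<in> Obj ?C" by (simp add: forest_def acyclic_def)
  then show "cls ?C (zero_obj ?C) = {zero_obj ?C}"
    using forest_iso_empty by (auto simp: cls_def forest_iso_refl)
  show "disj_labels ?C (zero_obj ?C) (zero_obj ?C)" by simp
  show "disj_union ?C (zero_obj ?C) (zero_obj ?C) = zero_obj ?C" by (simp add: funion_def)
  show "sub_obj ?C (zero_obj ?C) u = zero_obj ?C" by (simp add: cut_P_def Let_def)
  show "disj_union ?C A B \<in> Obj ?C" if "A \<in> Obj ?C" "B \<in> Obj ?C" "disj_labels ?C A B"
    using that by (simp add: forest_funion)
  show "isom ?C (disj_union ?C A B) (disj_union ?C A' B')"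
    if "A \<in> Obj ?C" "B \<in> Obj ?C" "A' \<in> Obj ?C" "B' \<in> Obj ?C" "isom ?C A A'" "isom ?C B B'"
      "disj_labels ?C A B" "disj_labels ?C A' B'"
    using that by (simp add: forest_union_iso)
  show "\<exists>A'\<in>Obj ?C. isom ?C A A' \<and> disj_labels ?C A' B" if AB: "A \<in> Obj ?C" "B \<in> Obj ?C"
  proof -
    have "finite (fverts A)" "finite (fverts B)" using AB by (simp_all add: forest_def)
    then obtain f where f: "bij f" "f ` fverts A \<inter> fverts B = {}" by (rule ex_bij_avoiding)
    then show ?thesis
      using AB forest_fmap[OF f(1), of A] forest_iso_fmap[OF f(1), of A] by (intro bexI[of _ "fmap f A"]) auto
  qed
  show "card (fverts A) = card (fverts B)" if "isom ?C A B"
    using that by (auto simp: forest_iso_def bij_betw_same_card)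
  show "card (fverts A) \<le> card (fverts (sub_obj ?C A u)) + card (fverts (quot_obj ?C A u))"
    if A: "A \<in> Obj ?C" and u: "u \<in> Sub ?C A"
  proof -
    interpret A: rooted_forest A by unfold_locales (use A in simp)
    have "card A.V = card (below A u \<union> (A.V - below A u))" using A.below_sub by (simp add: Un_absorb1)
    also have "\<dots> \<le> card (below A u) + card (A.V - below A u)" by (rule card_Un_le)
    finally show ?thesis using u by (simp add: A.cut_P_frestrict A.cut_R_frestrict)
  qed
  show "finite (cls ?C ` {A \<in> Obj ?C. card (fverts A) \<le> n})" for n by (rule finite_forest_classes)
  show "\<exists>s\<in>Sub ?C D. \<exists>s'\<in>Sub ?C D. s \<noteq> s' \<and>
        cls ?C (sub_obj ?C D s) = cls ?C A \<and> cls ?C (quot_obj ?C D s) = cls ?C B \<and>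
        cls ?C (sub_obj ?C D s') = cls ?C B \<and> cls ?C (quot_obj ?C D s') = cls ?C A \<and>
        (\<forall>t\<in>Sub ?C D. t = s \<or> t = s' \<or> sub_obj ?C D t = zero_obj ?C \<or> quot_obj ?C D t = zero_obj ?C \<or>
           decomp ?C (sub_obj ?C D t) \<or> decomp ?C (quot_obj ?C D t))"
    if AB: "A \<in> Obj ?C" "B \<in> Obj ?C" "A \<noteq> zero_obj ?C" "B \<noteq> zero_obj ?C" "disj_labels ?C A B" "D = disj_union ?C A B"
  proof -
    obtain s s' where s: "s \<in> cuts D" "s' \<in> cuts D" "s \<noteq> s'" "cut_P D s = A" "cut_R D s = B" "cut_P D s' = B" "cut_R D s' = A"
      "\<forall>t\<in>cuts D. t = s \<or> t = s' \<or> cut_P D t = Forest {} {} \<or> cut_R D t = Forest {} {} \<or> decomp ?C (cut_P D t) \<or> decomp ?C (cut_R D t)"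
      using forest_split[of A B D] AB by auto
    then show ?thesis unfolding LRF_simps by (intro bexI[of _ s] bexI[of _ s'] conjI) simp_all
  qed
qed

section \<open>The categories of Feynman graphs\<close>

lemma subgraph_trans: "subgraph u w \<Longrightarrow> subgraph w A \<Longrightarrow> subgraph u A"
  by (auto simp: subgraph_def)

lemma subgraph_self: "feynman A \<Longrightarrow> subgraph A A"
  by (simp add: subgraph_def)

lemma towerI: "graph A \<Longrightarrow> subgraph w A \<Longrightarrow> subgraph u w \<Longrightarrow> good w u \<Longrightarrow> tower A u w"
  by unfold_locales (auto simp: subgraph_def)

lemma good_if_one_PI: "graph A \<Longrightarrow> subgraph u A \<Longrightarrow> one_PI A \<Longrightarrow> good A u"
  by (rule contraction.one_PI_good[OF contraction_if_subgraph])

lemma one_PI_quotient_graph: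
  assumes "feynman A" "one_PI A" "subgraph u A"
  shows "feynman (quotient_graph A u)" "one_PI (quotient_graph A u)"
proof -
  \<comment> \<open>With \<open>w = A\<close> the quotient \<open>v\<close> of the tower is
    \<open>A / u\<close> itself.\<close>
  interpret tower A u A
    by (rule towerI) (use assms in \<open>auto simp: feynman_graph subgraph_self intro: good_if_one_PI\<close>)
  show "feynman (quotient_graph A u)" by (rule feynman_v)
  show "one_PI (quotient_graph A u)" by (rule one_PI_quotient[OF assms(2)])
qed

text \<open>By \<open>comp_w_half_v\<close> every component of \<open>A\<close> is then a component
  of \<open>u\<close>. A join of \<open>A\<close> missing in \<open>u\<close> would end in a leg of
  \<open>u\<close>, but on common components the legs of \<open>u\<close> are legs of
  \<open>A\<close>.\<close>

lemma quotient_empty_imp: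
  assumes fA: "feynman A" and u: "subgraph u A" and g: "good A u" and e: "half (quotient_graph A u) = {}"
  shows "u = A"
proof -
  interpret tower A u A
    by (rule towerI) (use assms in \<open>auto simp: feynman_graph subgraph_self\<close>)
  have K: "K \<in> comps u" if "K \<in> comps A" for K
    using comp_w_half_v[OF that] e by simp
  have half: "half u = half A"
  proof
    show "half A \<subseteq> half u"
    proof
      fix x assume "x \<in> half A"
      then obtain K where "K \<in> comps A" "x \<in> K" using comp_exists[of x A] by blast
      then show "x \<in> half u" using K comp_subset[OF wu.gu] by blast
    qed
  qed (rule half_sub')
  have verts: "verts u = verts A"
  proof
    show "verts A \<subseteq> verts u"
    proof
      fix v assume v: "v \<in> verts A"
      obtain x where "x \<in> v" using vert_nonempty[OF gA v] by blast
      then show "v \<in> verts u" using wu.vert_u[OF v, of x] vert_subset[OF gA v] half by blast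
    qed
  qed (rule verts_sub')
  have "joins u = joins A"
  proof
    show "joins A \<subseteq> joins u"
    proof
      fix j assume j: "j \<in> joins A"
      show "j \<in> joins u"
      proof (rule ccontr)
        assume "j \<notin> joins u"
        then have o: "j \<in> outer A u" using j by (simp add: outer_def)
        obtain x where x: "x \<in> j" using graph_matching[OF gA] j by (force simp: matching_def)
        then have xh: "x \<in> half A" using join_subset[OF gA j] by blast
        then have xe: "x \<in> ext u" using wu.outer_ext[OF o x] half by blast
        obtain L where L: "L \<in> comps A" "x \<in> L" using comp_exists[OF xh] by blast
        then have "x \<in> ext A" using ext_u_w[OF L(1) K[OF L(1)]] xe by blast
        then show False using j x by (auto simp: in_ext)
      qed
    qed
  qed (rule joins_sub')
  then show ?thesis using half verts by (intro graph.expand) simp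
qed

text \<open>
  The components of \<open>A / u\<close> that belong to \<open>v\<close> are deleted in \<open>(A / u) / v\<close>. They are treated
  separately since their preimages need not be components of \<open>A\<close>: a component of \<open>u\<close> that is
  attached to a leg is missing.
\<close>

lemma quotient_of_quotient:
  assumes fA: "feynman A" and u: "subgraph u A" and v: "subgraph v (quotient_graph A u)"
  shows "\<exists>w. subgraph w A \<and> quotient_graph A w = quotient_graph (quotient_graph A u) v"
proof -
  have gA: "graph A" using fA by (rule feynman_graph)
  let ?Q = "quotient_graph A u"
  interpret c: contraction A u by (rule contraction_if_subgraph[OF gA u])
  interpret Qv: contraction ?Q v by (rule contraction_if_subgraph[OF c.graph_Q v])
  \<comment> \<open>On \<open>X\<close> everything disappears in the end, so there all of
    \<open>A\<close> is contracted; outside of \<open>X\<close> the ordinary preimage is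
    used.\<close>
  define X where "X = \<Union>{L \<in> comps A. L \<inter> half ?Q \<in> comps v}"
  have cl: "s \<subseteq> X" if s: "s \<in> verts A \<union> joins A" "s \<inter> X \<noteq> {}" for s
  proof -
    obtain L where "L \<in> comps A" "L \<inter> half ?Q \<in> comps v" "s \<inter> L \<noteq> {}" using s(2) unfolding X_def by blast
    then show ?thesis using comp_closed[of L A s] s(1) unfolding X_def by blast
  qed
  have cl': "s \<subseteq> - X" if "s \<in> verts A \<union> joins A" "s \<inter> - X \<noteq> {}" for s
    using that cl[OF that(1)] by blast
  let ?A = "grestrict A X" and ?B = "grestrict A (- X)"
  have A: "A = gunion ?A ?B" by (rule gunion_grestrict[OF gA cl])
  interpret AB: disjoint_graphs ?A ?B
    by unfold_locales (rule graph_grestrict[OF gA cl], assumption+, rule graph_grestrict[OF gA cl'], assumption+, auto)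
  have fAB: "feynman ?A" "feynman ?B" using AB.feynman_gunion fA A by simp_all
  obtain a b where ab: "u = gunion a b" "subgraph a ?A" "subgraph b ?B" "disjoint_graphs a b"
    using subgraph_gunion_split[OF AB.disjoint_graphs_axioms, of u] u A by metis
  interpret ca: contraction ?A a by (rule contraction_if_subgraph[OF AB.gG ab(2)])
  interpret cb: contraction ?B b by (rule contraction_if_subgraph[OF AB.gH ab(3)])
  have Q: "?Q = gunion ca.Q cb.Q"
    using quotient_gunion[OF AB.disjoint_graphs_axioms ab(2,3)] A ab(1) by simp
  interpret Q: disjoint_graphs ca.Q cb.Q
    by unfold_locales (use ca.graph_Q cb.graph_Q ca.half_Q_sub cb.half_Q_sub AB.disj in blast)+
  obtain p q where pq: "v = gunion p q" "subgraph p ca.Q" "subgraph q cb.Q" "disjoint_graphs p q"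
    using subgraph_gunion_split[OF Q.disjoint_graphs_axioms, of v] v Q by metis
  interpret pq: disjoint_graphs p q by (fact pq(4))
  interpret Qp: contraction ca.Q p by (rule contraction_if_subgraph[OF ca.graph_Q pq(2)])
  have halfQ: "half ?Q = half ca.Q \<union> half cb.Q" using Q by simp
  \<comment> \<open>The part \<open>p\<close> of \<open>v\<close> over \<open>X\<close> contains all
    half-edges of the quotient there, and each of its components is a component of that quotient, so
    no new vertex arises.\<close>
  have "Qp.Q = Graph {} {} {}"
  proof (rule graph_empty_half[OF Qp.graph_Q])
    have "x \<in> half p" if x: "x \<in> half ca.Q" for x
    proof -
      have "x \<in> X" using x ca.half_Q_sub by auto
      then obtain L where "L \<inter> half ?Q \<in> comps v" "x \<in> L" unfolding X_def by blast
      then have "x \<in> half v" using comp_subset[OF Qv.gu] x halfQ by blast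
      then show ?thesis using x pq(1,3) Q.disj by (auto simp: subgraph_def)
    qed
    moreover have "K \<in> comps ca.Q" if K: "K \<in> comps p" for K
    proof -
      have Kv: "K \<in> comps v" using K pq(1) pq.comps_gunion by simp
      have Kca: "K \<subseteq> half ca.Q" using comp_subset[OF Qp.gu K] Qp.half_sub by blast
      obtain x where x: "x \<in> K" using comp_nonempty[OF K] by blast
      have "x \<in> X" using x Kca ca.half_Q_sub by auto
      then obtain L where L: "L \<in> comps A" "L \<inter> half ?Q \<in> comps v" "x \<in> L" unfolding X_def by blast
      have "K = L \<inter> half ?Q"
        by (rule comp_disjoint[OF Kv L(2) x]) (use x L(3) Kca halfQ in blast)
      then have "K \<in> comps ?Q" using L(1) x unfolding c.comps_Q_iff by blast
      then have "K \<in> comps ca.Q \<or> K \<in> comps cb.Q" using Q Q.comps_gunion by simp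
      then show ?thesis using comp_subset[OF Q.gH, of K] Kca x Q.disj by blast
    qed
    then have "new_verts ca.Q p = {}" by (auto simp: new_verts_def)
    ultimately show "half Qp.Q = {}" by (auto simp: half_quotient[of ca.Q p])
  qed
  then have Qv_eq: "quotient_graph ?Q v = quotient_graph cb.Q q"
    using quotient_gunion[OF Q.disjoint_graphs_axioms pq(2,3)] Q pq(1) by simp
  interpret P: preimage ?B b q by unfold_locales (fact pq(3))
  have w: "subgraph P.w ?B" unfolding subgraph_def using P.feynman_pre P.sub_A by blast
  have "quotient_graph cb.Q q = quotient_graph ?B P.w"
  proof -
    have "quotient_graph cb.Q P.v = quotient_graph ?B P.w"
    proof (rule P.quotient_quotient)
      \<comment> \<open>The condition holds vacuously: such a \<open>K\<close> would come from a
        component of \<open>A\<close> inside \<open>X\<close>, whereas \<open>?B\<close> avoids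
        \<open>X\<close>.\<close>
      fix K assume K: "K \<in> comps P.w" "K \<notin> comps b" "K \<inter> half P.v \<in> comps cb.Q"
      have "K \<inter> half P.v \<in> comps P.v" using K P.comps_v_iff by blast
      then have Kv: "K \<inter> half P.v \<in> comps v" using pq(1) pq.comps_gunion P.quotient_pre by simp
      obtain L where L: "L \<in> comps ?B" "K \<inter> half P.v = L \<inter> half cb.Q"
        using K(3) unfolding cb.comps_Q_iff by blast
      have LB: "L \<subseteq> half ?B" by (rule comp_subset[OF AB.gH L(1)])
      have "L \<inter> half ?Q = L \<inter> half cb.Q" using LB halfQ ca.half_Q_sub AB.disj by blast
      then have "L \<inter> half ?Q \<in> comps v" using Kv L(2) by simp
      moreover have "L \<in> comps A" using L(1) AB.comps_gunion A by simp
      ultimately have "L \<subseteq> X" unfolding X_def by blast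
      then have "L = {}" using LB by auto
      then show "K \<in> comps ?B" using comp_nonempty[OF L(1)] by blast
    qed
    then show ?thesis using P.quotient_pre by simp
  qed
  moreover have "subgraph (gunion ?A P.w) A"
    using subgraph_gunion(1)[OF AB.disjoint_graphs_axioms subgraph_self[OF fAB(1)] w] A by simp
  moreover have "quotient_graph A (gunion ?A P.w) = quotient_graph ?B P.w"
    using quotient_gunion[OF AB.disjoint_graphs_axioms subgraph_self[OF fAB(1)] w] A
    by (simp add: quotient_self)
  ultimately show ?thesis using Qv_eq by metis
qed

section \<open>Graphs as instances of the abstract categories\<close>

lemma LFG_class_simps [simp]:
  "Obj (LFG_class P) = {G. feynman G \<and> P G}" "isom (LFG_class P) = graph_iso"
  "zero_obj (LFG_class P) = Graph {} {} {}"
  "disj_labels (LFG_class P) G H \<longleftrightarrow> half G \<inter> half H = {}" "disj_union (LFG_class P) G H = gunion G H"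
  "Sub (LFG_class P) G = {g. subgraph g G \<and> P g}" "sub_obj (LFG_class P) G g = g"
  "quot_obj (LFG_class P) = quotient_graph"
  by (simp_all add: LFG_class_def gunion_def)

lemma finite_subgraphs:
  assumes "graph G"
  shows "finite {g. subgraph g G}"
proof (rule finite_subset)
  show "{g. subgraph g G} \<subseteq> (\<lambda>(h, v, j). Graph h v j) ` (Pow (half G) \<times> Pow (verts G) \<times> Pow (joins G))"
  proof
    fix g assume "g \<in> {g. subgraph g G}"
    then show "g \<in> (\<lambda>(h, v, j). Graph h v j) ` (Pow (half G) \<times> Pow (verts G) \<times> Pow (joins G))"
      by (intro image_eqI[of _ _ "(half g, verts g, joins g)"]) (auto simp: subgraph_def)
  qed
  have "joins G \<subseteq> Pow (half G)" using join_subset[OF assms] by blast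
  then have "finite (joins G)" using graph_finite[OF assms] by (meson finite_Pow_iff finite_subset)
  then show "finite ((\<lambda>(h, v, j). Graph h v j) ` (Pow (half G) \<times> Pow (verts G) \<times> Pow (joins G)))"
    using graph_finite[OF assms] graph_finite_verts[OF assms] by simp
qed

lemma cls_gmap: "bij f \<Longrightarrow> cls (LFG_class P) (gmap f D) = cls (LFG_class P) D"
  using graph_iso_trans[OF graph_iso_gmap(1)[of f D]] graph_iso_trans[OF graph_iso_gmap(2)[of f D]]
  by (auto simp: cls_def)

lemma graph_transport:
  assumes inv: "\<And>f g. bij f \<Longrightarrow> feynman g \<Longrightarrow> P g \<Longrightarrow> P (gmap f g)"
    and A: "feynman A" and B: "feynman B" and iso: "graph_iso A B"
  shows "\<exists>\<phi>. bij_betw \<phi> {g. subgraph g A \<and> P g} {g. subgraph g B \<and> P g} \<and>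
    (\<forall>u\<in>{g. subgraph g A \<and> P g}. cls (LFG_class P) (\<phi> u) = cls (LFG_class P) u \<and>
      cls (LFG_class P) (quotient_graph B (\<phi> u)) = cls (LFG_class P) (quotient_graph A u))"
proof -
  obtain f where f: "bij f" "B = gmap f A" using graph_isoE[OF iso feynman_graph[OF A]] by blast
  have f': "bij (inv f)" by (rule bij_imp_bij_inv[OF f(1)])
  have feyn: "feynman g" if "subgraph g G" for g G :: "'a graph" using that by (simp add: subgraph_def)
  have "bij_betw (gmap f) {g. subgraph g A \<and> P g} {g. subgraph g B \<and> P g}"
  proof (rule bij_betw_byWitness[of _ "gmap (inv f)"])
    show "gmap f ` {g. subgraph g A \<and> P g} \<subseteq> {g. subgraph g B \<and> P g}"
      using subgraph_gmap[OF f(1)] inv[OF f(1)] feyn f(2) by blast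
    show "gmap (inv f) ` {g. subgraph g B \<and> P g} \<subseteq> {g. subgraph g A \<and> P g}"
    proof
      fix h assume "h \<in> gmap (inv f) ` {g. subgraph g B \<and> P g}"
      then obtain g where g: "h = gmap (inv f) g" "subgraph g B" "P g" by blast
      have "subgraph h A" using subgraph_gmap[OF f' g(2)] g(1) f by simp
      then show "h \<in> {g. subgraph g A \<and> P g}" using inv[OF f' feyn[OF g(2)] g(3)] g(1) by simp
    qed
  qed (use f in auto)
  moreover have "cls (LFG_class P) (quotient_graph B (gmap f u)) = cls (LFG_class P) (quotient_graph A u)"
    if "subgraph u A" for u
    using quotient_gmap[OF f(1) feynman_graph[OF A] that] cls_gmap[OF f(1)] f(2) by simp
  ultimately show ?thesis using cls_gmap[OF f(1)] by (intro exI[of _ "gmap f"]) auto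
qed

lemma feynman_iso: "graph_iso D A \<Longrightarrow> graph D \<Longrightarrow> feynman A \<Longrightarrow> feynman D"
  using feynman_gmap[OF bij_imp_bij_inv] by (metis graph_isoE gmap_inv(1))

text \<open>A class in \<open>Iso\<close> contains an object, which is isomorphic to the quotient,
  and being a Feynman graph is invariant under isomorphism of graphs.\<close>

lemma quot_Obj_LFG:
  assumes A: "feynman A" and u: "subgraph u A"
    and I: "cls (LFG_class P) (quotient_graph A u) \<in> Iso (LFG_class P)"
  shows "feynman (quotient_graph A u)"
proof -
  obtain B where B: "feynman B" "P B" "cls (LFG_class P) (quotient_graph A u) = cls (LFG_class P) B"
    using I by (auto simp: Iso_def)
  then have "B \<in> cls (LFG_class P) (quotient_graph A u)" by (simp add: cls_def graph_iso_refl)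
  then have "graph_iso (quotient_graph A u) B" by (simp add: cls_def)
  moreover have "graph (quotient_graph A u)"
    by (rule contraction.graph_Q[OF contraction_if_subgraph[OF feynman_graph[OF A] u]])
  ultimately show ?thesis using feynman_iso B(1) by blast
qed

theorem hall_LFG: "hall_category (LFG :: ('s::infinite graph, 's graph) hall_cat)"
  unfolding LFG_def
proof unfold_locales
  let ?C = "LFG_class (\<lambda>_. True) :: ('s graph, 's graph) hall_cat"
  fix A B D :: "'s graph" and u v :: "'s graph"
  show "isom ?C A A" by (simp add: graph_iso_refl)
  show "isom ?C B A" if "A \<in> Obj ?C" "isom ?C A B" using that by (simp add: graph_iso_sym feynman_graph)
  show "isom ?C A B \<Longrightarrow> isom ?C B D \<Longrightarrow> isom ?C A D" by simp (rule graph_iso_trans)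
  show "finite (Sub ?C A)" if "A \<in> Obj ?C" using that by (simp add: finite_subgraphs feynman_graph)
  show "\<exists>\<phi>. bij_betw \<phi> (Sub ?C A) (Sub ?C B) \<and> (\<forall>u\<in>Sub ?C A.
        cls ?C (sub_obj ?C B (\<phi> u)) = cls ?C (sub_obj ?C A u) \<and>
        cls ?C (quot_obj ?C B (\<phi> u)) = cls ?C (quot_obj ?C A u))"
    if "A \<in> Obj ?C" "B \<in> Obj ?C" "isom ?C A B"
    using graph_transport[of "\<lambda>_. True" A B] that by simp
  show "quot_obj ?C A u \<in> Obj ?C" if "A \<in> Obj ?C" "u \<in> Sub ?C A" "cls ?C (quot_obj ?C A u) \<in> Iso ?C"
    using quot_Obj_LFG[of A u "\<lambda>_. True"] that by simp
  show "\<exists>w\<in>Sub ?C A. cls ?C (quot_obj ?C A w) = cls ?C (quot_obj ?C (quot_obj ?C A u) v)"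
    if "A \<in> Obj ?C" "u \<in> Sub ?C A" "v \<in> Sub ?C (quot_obj ?C A u)"
    using quotient_of_quotient[of A u v] that by auto
qed

text \<open>The inverse sends \<open>(w, t)\<close> to \<open>(t, w / t)\<close>:
  \<open>quotient_pre\<close> and \<open>pre_quotient\<close> give the two compositions, while
  \<open>one_PI_preimage\<close> and \<open>one_PI_quotient\<close> keep both maps within the
  one-particle irreducible graphs.\<close>

lemma one_PI_towers:
  assumes A: "feynman A" "one_PI A"
  shows "bij_betw (\<lambda>(u, v). (pre A u v, u))
    (SIGMA u:{g. subgraph g A \<and> one_PI g}. {g. subgraph g (quotient_graph A u) \<and> one_PI g})
    (SIGMA w:{g. subgraph g A \<and> one_PI g}. {g. subgraph g w \<and> one_PI g})" (is "bij_betw ?\<Phi> ?X ?Y")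
    and "\<And>u v. subgraph u A \<Longrightarrow> subgraph v (quotient_graph A u) \<Longrightarrow>
      quotient_graph (pre A u v) u = v \<and> quotient_graph A (pre A u v) = quotient_graph (quotient_graph A u) v"
proof -
  have gA: "graph A" using A(1) by (rule feynman_graph)
  have P: "preimage A u v" if "subgraph u A" "subgraph v (quotient_graph A u)" for u v
    using contraction_if_subgraph[OF gA that(1)] that(2) by (simp add: preimage_def preimage_axioms_def)
  show Q: "quotient_graph (pre A u v) u = v \<and> quotient_graph A (pre A u v) = quotient_graph (quotient_graph A u) v"
    if uv: "subgraph u A" "subgraph v (quotient_graph A u)" for u v
  proof -
    interpret P: preimage A u v by (rule P[OF uv])
    have "quotient_graph (quotient_graph A u) P.v = quotient_graph A P.w"
      by (rule P.quotient_quotient, rule P.comp_Q_good[OF good_if_one_PI[OF gA uv(1) A(2)] A(1)])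
    then show ?thesis using P.quotient_pre by simp
  qed
  show "bij_betw ?\<Phi> ?X ?Y"
  proof (rule bij_betw_byWitness[of _ "\<lambda>(w, t). (t, quotient_graph w t)"])
    show "\<forall>p\<in>?X. (\<lambda>(w, t). (t, quotient_graph w t)) (?\<Phi> p) = p" using Q by auto
    have T: "tower A t w" if "subgraph w A" "subgraph t w" "one_PI w" for t w
    proof (rule towerI[OF gA that(1,2)])
      have "graph w" using that(1) by (simp add: subgraph_def feynman_graph)
      then show "good w t" by (rule good_if_one_PI[OF _ that(2,3)])
    qed
    show "\<forall>p\<in>?Y. ?\<Phi> ((\<lambda>(w, t). (t, quotient_graph w t)) p) = p"
      using tower.pre_quotient[OF T] by auto
    show "?\<Phi> ` ?X \<subseteq> ?Y"
    proof
      fix p assume "p \<in> ?\<Phi> ` ?X"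
      then obtain u v where p: "p = (pre A u v, u)" and u: "subgraph u A" "one_PI u"
        and v: "subgraph v (quotient_graph A u)" "one_PI v" by auto
      interpret P: preimage A u v by (rule P[OF u(1) v(1)])
      have "subgraph P.w A" "subgraph u P.w"
        unfolding subgraph_def using P.feynman_pre P.sub_A P.fu P.sub_u by blast+
      moreover have "one_PI P.w" using P.one_PI_preimage[OF u(2)] v(2) P.quotient_pre by simp
      ultimately show "p \<in> ?Y" using p u by simp
    qed
    show "(\<lambda>(w, t). (t, quotient_graph w t)) ` ?Y \<subseteq> ?X"
    proof
      fix p assume "p \<in> (\<lambda>(w, t). (t, quotient_graph w t)) ` ?Y"
      then obtain w t where p: "p = (t, quotient_graph w t)" and w: "subgraph w A" "one_PI w"
        and t: "subgraph t w" "one_PI t" by auto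
      interpret tower A t w by (rule T[OF w(1) t(1) w(2)])
      show "p \<in> ?X" using p t subgraph_trans[OF t(1) w(1)] subgraph_v one_PI_quotient[OF w(2)] by simp
    qed
  qed
qed

text \<open>A subgraph of the union is a union of some \<open>a\<close> in \<open>A\<close> and
  \<open>b\<close> in \<open>B\<close>. If both are nonempty, it is decomposable. If
  \<open>a\<close> is empty, the quotient is the union of \<open>A\<close> and \<open>B / b\<close>,
  which is decomposable unless \<open>b = B\<close>; the case of empty \<open>b\<close> is
  symmetric.\<close>

lemma one_PI_split:
  fixes A B :: "'s::infinite graph"
  assumes A: "feynman A" "one_PI A" "A \<noteq> Graph {} {} {}" and B: "feynman B" "one_PI B" "B \<noteq> Graph {} {} {}"
    and disj: "half A \<inter> half B = {}"
  shows "subgraph A (gunion A B)" "subgraph B (gunion A B)" "A \<noteq> B"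
    "quotient_graph (gunion A B) A = B" "quotient_graph (gunion A B) B = A"
    "\<And>t. subgraph t (gunion A B) \<Longrightarrow> one_PI t \<Longrightarrow> t = A \<or> t = B \<or> t = Graph {} {} {} \<or>
       decomp (LFG_1PI :: ('s graph, 's graph) hall_cat) t \<or>
       decomp (LFG_1PI :: ('s graph, 's graph) hall_cat) (quotient_graph (gunion A B) t)"
proof -
  let ?z = "Graph {} {} {} :: 's graph"
  have gA: "graph A" and gB: "graph B" using A B by (auto intro: feynman_graph)
  interpret AB: disjoint_graphs A B by unfold_locales (fact gA gB disj)+
  note dis = AB.disjoint_graphs_axioms
  note sA = subgraph_self[OF A(1)] and sB = subgraph_self[OF B(1)]
  show "subgraph A (gunion A B)" using subgraph_gunion(1)[OF dis sA subgraph_empty] by simp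
  show "subgraph B (gunion A B)" using subgraph_gunion(1)[OF dis subgraph_empty sB] by simp
  show "A \<noteq> B" using graph_empty_half[OF gA] A(3) disj by auto
  show "quotient_graph (gunion A B) A = B"
    using quotient_gunion[OF dis sA subgraph_empty] by (simp add: quotient_self quotient_empty gB)
  show "quotient_graph (gunion A B) B = A"
    using quotient_gunion[OF dis subgraph_empty sB] by (simp add: quotient_self quotient_empty gA)
  have dec: "decomp (LFG_1PI :: ('s graph, 's graph) hall_cat) (gunion G H)"
    if "feynman G" "one_PI G" "G \<noteq> ?z" "feynman H" "one_PI H" "H \<noteq> ?z" "half G \<inter> half H = {}" for G H
    unfolding decomp_def LFG_1PI_def using that by (intro bexI[of _ G] bexI[of _ H] conjI) simp_all
  fix t assume t: "subgraph t (gunion A B)" "one_PI t"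
  obtain a b where ab: "t = gunion a b" "subgraph a A" "subgraph b B" "disjoint_graphs a b"
    using subgraph_gunion_split[OF dis t(1)] by metis
  interpret ab: disjoint_graphs a b by (fact ab(4))
  have p: "one_PI a" "one_PI b" using ab.one_PI_gunion t(2) ab(1) by simp_all
  have f: "feynman a" "feynman b" using ab(2,3) by (simp_all add: subgraph_def)
  have q: "quotient_graph (gunion A B) t = gunion (quotient_graph A a) (quotient_graph B b)"
    using quotient_gunion[OF dis ab(2,3)] ab(1) by simp
  have one: "s = G \<or> decomp (LFG_1PI :: ('s graph, 's graph) hall_cat) (gunion H (quotient_graph G s))"
    if G: "feynman G" "one_PI G" and s: "subgraph s G" and H: "feynman H" "one_PI H" "H \<noteq> ?z"
      and d: "half G \<inter> half H = {}" for G H s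
  proof (cases "quotient_graph G s = ?z")
    case True
    then show ?thesis
      using quotient_empty_imp[OF G(1) s good_if_one_PI[OF feynman_graph[OF G(1)] s G(2)]] by simp
  next
    case False
    interpret contraction G s by (rule contraction_if_subgraph[OF feynman_graph[OF G(1)] s])
    show ?thesis
      using dec[OF H one_PI_quotient_graph[OF G s] False] half_Q_sub d by blast
  qed
  show "t = A \<or> t = B \<or> t = ?z \<or> decomp (LFG_1PI :: ('s graph, 's graph) hall_cat) t \<or>
       decomp (LFG_1PI :: ('s graph, 's graph) hall_cat) (quotient_graph (gunion A B) t)"
  proof (cases "a = ?z")
    case True
    then have "t = b" using ab(1) by simp
    moreover have "quotient_graph (gunion A B) t = gunion A (quotient_graph B b)"
      using q True quotient_empty[OF gA] by simp
    ultimately show ?thesis using one[OF B(1,2) ab(3) A] disj by (metis Int_commute)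
  next
    case a: False
    show ?thesis
    proof (cases "b = ?z")
      case True
      then have "t = a" using ab(1) by simp
      moreover have "quotient_graph (gunion A B) t = gunion B (quotient_graph A a)"
        using q True quotient_empty[OF gB] gunion_commute by metis
      ultimately show ?thesis using one[OF A(1,2) ab(2) B] disj by metis
    next
      case False
      then show ?thesis using dec[OF f(1) p(1) a f(2) p(2) False ab.disj] ab(1) by simp
    qed
  qed
qed

lemma graph_union_iso:
  assumes g: "graph A" "graph B" and iso: "graph_iso A A'" "graph_iso B B'"
    and disj: "half A \<inter> half B = {}" "half A' \<inter> half B' = {}"
  shows "graph_iso (gunion A B) (gunion A' B')"
proof -
  obtain f where f: "bij_betw f (half A) (half A')" "(`) f ` verts A = verts A'" "(`) f ` joins A = joins A'"
    using iso(1) by (auto simp: graph_iso_def)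
  obtain h where h: "bij_betw h (half B) (half B')" "(`) h ` verts B = verts B'" "(`) h ` joins B = joins B'"
    using iso(2) by (auto simp: graph_iso_def)
  let ?h = "\<lambda>x. if x \<in> half A then f x else h x"
  have "bij_betw ?h (half A \<union> half B) (half A' \<union> half B')"
    by (rule bij_betw_disjoint_Un[OF f(1) h(1) disj])
  moreover have fA: "?h ` s = f ` s" if "s \<subseteq> half A" for s using that by (intro image_cong) auto
  have hB: "?h ` s = h ` s" if "s \<subseteq> half B" for s using that disj(1) by (intro image_cong) auto
  have "(`) ?h ` verts A = verts A'" "(`) ?h ` joins A = joins A'"
    using f fA vert_subset[OF g(1)] join_subset[OF g(1)] by (metis (no_types, lifting) image_cong)+
  moreover have "(`) ?h ` verts B = verts B'" "(`) ?h ` joins B = joins B'"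
    using h hB vert_subset[OF g(2)] join_subset[OF g(2)] by (metis (no_types, lifting) image_cong)+
  ultimately show ?thesis
    unfolding graph_iso_def gunion_simps by (intro exI[of _ ?h]) (simp add: image_Un)
qed

text \<open>As for forests, a fixed set of \<open>n\<close> labels provides representatives for all
  classes.\<close>

lemma finite_graph_classes:
  fixes P :: "'s::infinite graph \<Rightarrow> bool"
  shows "finite (cls (LFG_class P) ` {G \<in> Obj (LFG_class P). card (half G) \<le> n})"
proof -
  let ?C = "LFG_class P"
  obtain Z :: "'s set" where Z: "finite Z" "card Z = n"
    using infinite_arbitrarily_large[OF infinite_UNIV, of n] by blast
  let ?F = "(\<lambda>(h, v, j). Graph h v j) ` (Pow Z \<times> Pow (Pow Z) \<times> Pow (Pow Z))"
  have "cls ?C ` {G \<in> Obj ?C. card (half G) \<le> n} \<subseteq> cls ?C ` ?F"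
  proof
    fix M assume "M \<in> cls ?C ` {G \<in> Obj ?C. card (half G) \<le> n}"
    then obtain G where G: "M = cls ?C G" "feynman G" "card (half G) \<le> n" by auto
    have g: "graph G" by (rule feynman_graph[OF G(2)])
    obtain f where f: "bij f" "f ` half G \<subseteq> Z"
      using ex_bij_into[OF graph_finite[OF g] Z(1)] Z(2) G(3) by auto
    have "gmap f G \<in> ?F"
    proof (rule image_eqI[of _ _ "(half (gmap f G), verts (gmap f G), joins (gmap f G))"])
      show "(half (gmap f G), verts (gmap f G), joins (gmap f G)) \<in> Pow Z \<times> Pow (Pow Z) \<times> Pow (Pow Z)"
      proof -
        have "f ` s \<subseteq> Z" if "s \<in> verts G \<union> joins G" for s using cell_subset[OF g that] f(2) by blast
        then show ?thesis using f(2) by auto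
      qed
    qed (simp add: gmap_def)
    moreover have "M = cls ?C (gmap f G)" using cls_gmap[OF f(1)] G(1) by simp
    ultimately show "M \<in> cls ?C ` ?F" by blast
  qed
  moreover have "finite (cls ?C ` ?F)" using Z(1) by simp
  ultimately show ?thesis by (rule finite_subset)
qed

lemma graph_iso_empty: "graph G \<Longrightarrow> graph_iso (Graph {} {} {}) G \<Longrightarrow> G = Graph {} {} {}"
  by (rule graph_empty_half) (auto simp: graph_iso_def bij_betw_def)

theorem hall_LFG_1PI: "hall_lie_category (LFG_1PI :: ('s::infinite graph, 's graph) hall_cat) (\<lambda>G. card (half G))"
proof unfold_locales
  let ?C = "LFG_1PI :: ('s graph, 's graph) hall_cat"
  note simps [simp] = LFG_1PI_def
  fix A B A' B' D :: "'s graph" and u v :: "'s graph"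
  show "isom ?C A A" by (simp add: graph_iso_refl)
  show "isom ?C B A" if "A \<in> Obj ?C" "isom ?C A B" using that by (simp add: graph_iso_sym feynman_graph)
  show "isom ?C A B \<Longrightarrow> isom ?C B D \<Longrightarrow> isom ?C A D" by simp (rule graph_iso_trans)
  show "finite (Sub ?C A)" if "A \<in> Obj ?C"
    by (rule finite_subset[OF _ finite_subgraphs[of A]]) (use that in \<open>auto simp: feynman_graph\<close>)
  show "\<exists>\<phi>. bij_betw \<phi> (Sub ?C A) (Sub ?C B) \<and> (\<forall>u\<in>Sub ?C A.
        cls ?C (sub_obj ?C B (\<phi> u)) = cls ?C (sub_obj ?C A u) \<and>
        cls ?C (quot_obj ?C B (\<phi> u)) = cls ?C (quot_obj ?C A u))"
    if "A \<in> Obj ?C" "B \<in> Obj ?C" "isom ?C A B"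
    using graph_transport[of one_PI A B, OF one_PI_gmap[OF _ feynman_graph]] that by simp
  show q: "quot_obj ?C A u \<in> Obj ?C" if "A \<in> Obj ?C" "u \<in> Sub ?C A" for A u
    using one_PI_quotient_graph[of A u] that by simp
  show "quot_obj ?C A u \<in> Obj ?C" if "A \<in> Obj ?C" "u \<in> Sub ?C A" by (rule q[OF that])
  show "sub_obj ?C A u \<in> Obj ?C" if "u \<in> Sub ?C A" using that by (simp add: subgraph_def)
  have T: "bij_betw (\<lambda>(u, v). (pre A u v, u)) (SIGMA u:Sub ?C A. Sub ?C (quot_obj ?C A u)) (SIGMA w:Sub ?C A. Sub ?C (sub_obj ?C A w))"
    if "A \<in> Obj ?C" for A using one_PI_towers(1)[of A] that by simp
  have T': "quotient_graph (pre A u v) u = v" "quotient_graph A (pre A u v) = quotient_graph (quotient_graph A u) v"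
    if "A \<in> Obj ?C" "u \<in> Sub ?C A" "v \<in> Sub ?C (quot_obj ?C A u)" for A u v
    using one_PI_towers(2)[of A u v] that by auto
  show "\<exists>\<Phi>. bij_betw \<Phi> (SIGMA u:Sub ?C A. Sub ?C (quot_obj ?C A u))
      (SIGMA w:Sub ?C A. Sub ?C (sub_obj ?C A w)) \<and> (\<forall>u\<in>Sub ?C A. \<forall>v\<in>Sub ?C (quot_obj ?C A u). \<forall>w t.
        \<Phi> (u, v) = (w, t) \<longrightarrow>
          cls ?C (sub_obj ?C (sub_obj ?C A w) t) = cls ?C (sub_obj ?C A u) \<and>
          cls ?C (quot_obj ?C (sub_obj ?C A w) t) = cls ?C (sub_obj ?C (quot_obj ?C A u) v) \<and>
          cls ?C (quot_obj ?C A w) = cls ?C (quot_obj ?C (quot_obj ?C A u) v))" if A: "A \<in> Obj ?C"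
    using T[OF A] T'[OF A] by (intro exI[of _ "\<lambda>(u, v). (pre A u v, u)"]) auto
  show "\<exists>w\<in>Sub ?C A. cls ?C (quot_obj ?C A w) = cls ?C (quot_obj ?C (quot_obj ?C A u) v)"
    if A: "A \<in> Obj ?C" and u: "u \<in> Sub ?C A" and v: "v \<in> Sub ?C (quot_obj ?C A u)"
  proof -
    have "(pre A u v, u) \<in> (SIGMA w:Sub ?C A. Sub ?C (sub_obj ?C A w))"
      using bij_betw_apply[OF T[OF A], of "(u, v)"] u v by simp
    then show ?thesis using T'(2)[OF A u v] by (intro bexI[of _ "pre A u v"]) simp_all
  qed
  show "zero_obj ?C \<in> Obj ?C" by (simp add: feynman_empty one_PI_empty)
  show "cls ?C (zero_obj ?C) = {zero_obj ?C}"
    using graph_iso_empty feynman_graph by (auto simp: cls_def graph_iso_refl feynman_empty one_PI_empty)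
  show "disj_labels ?C (zero_obj ?C) (zero_obj ?C)" by simp
  show "disj_union ?C (zero_obj ?C) (zero_obj ?C) = zero_obj ?C" by simp
  show "sub_obj ?C (zero_obj ?C) u = zero_obj ?C" if "u \<in> Sub ?C (zero_obj ?C)"
    using that graph_empty_half[of u] by (auto simp: subgraph_def feynman_graph)
  show "disj_union ?C A B \<in> Obj ?C" if "A \<in> Obj ?C" "B \<in> Obj ?C" "disj_labels ?C A B"
  proof -
    interpret disjoint_graphs A B by unfold_locales (use that in \<open>auto simp: feynman_graph\<close>)
    show ?thesis using that feynman_gunion one_PI_gunion by simp
  qed
  show "isom ?C (disj_union ?C A B) (disj_union ?C A' B')"
    if "A \<in> Obj ?C" "B \<in> Obj ?C" "isom ?C A A'" "isom ?C B B'" "disj_labels ?C A B" "disj_labels ?C A' B'"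
    using that by (simp add: graph_union_iso feynman_graph)
  show "\<exists>A'\<in>Obj ?C. isom ?C A A' \<and> disj_labels ?C A' B" if AB: "A \<in> Obj ?C" "B \<in> Obj ?C"
  proof -
    have g: "graph A" "graph B" using AB by (simp_all add: feynman_graph)
    obtain f where f: "bij f" "f ` half A \<inter> half B = {}"
      by (rule ex_bij_avoiding[OF graph_finite[OF g(1)] graph_finite[OF g(2)]])
    then show ?thesis
      using AB feynman_gmap[OF f(1), of A] one_PI_gmap[OF f(1) g(1)] graph_iso_gmap(1)[OF f(1), of A]
      by (intro bexI[of _ "gmap f A"]) auto
  qed
  show "card (half A) = card (half B)" if "isom ?C A B"
    using that by (auto simp: graph_iso_def bij_betw_same_card)
  show "card (half (A :: 's graph)) \<le> card (half (sub_obj ?C A u)) + card (half (quot_obj ?C A u))"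
    if A: "A \<in> Obj ?C" and u: "u \<in> Sub ?C A"
  proof -
    have c: "contraction A u" using contraction_if_subgraph[of A u] A u by (simp add: feynman_graph)
    have "half A \<subseteq> half u \<union> half (quotient_graph A u)" by (auto simp: half_quotient)
    moreover have "finite (half u \<union> half (quotient_graph A u))"
      using graph_finite[OF contraction.gu[OF c]] graph_finite[OF contraction.graph_Q[OF c]] by simp
    ultimately have "card (half A) \<le> card (half u \<union> half (quotient_graph A u))" by (rule card_mono[rotated])
    also have "\<dots> \<le> card (half u) + card (half (quotient_graph A u))" by (rule card_Un_le)
    finally show ?thesis by simp
  qed
  show "finite (cls ?C ` {A \<in> Obj ?C. card (half A) \<le> n})" for n
    unfolding LFG_1PI_def by (rule finite_graph_classes)
  show "\<exists>s\<in>Sub ?C D. \<exists>s'\<in>Sub ?C D. s \<noteq> s' \<and>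
        cls ?C (sub_obj ?C D s) = cls ?C A \<and> cls ?C (quot_obj ?C D s) = cls ?C B \<and>
        cls ?C (sub_obj ?C D s') = cls ?C B \<and> cls ?C (quot_obj ?C D s') = cls ?C A \<and>
        (\<forall>t\<in>Sub ?C D. t = s \<or> t = s' \<or> sub_obj ?C D t = zero_obj ?C \<or> quot_obj ?C D t = zero_obj ?C \<or>
           decomp ?C (sub_obj ?C D t) \<or> decomp ?C (quot_obj ?C D t))"
    if AB: "A \<in> Obj ?C" "B \<in> Obj ?C" "A \<noteq> zero_obj ?C" "B \<noteq> zero_obj ?C" "disj_labels ?C A B" "D = disj_union ?C A B"
  proof -
    have *: "feynman A" "one_PI A" "A \<noteq> Graph {} {} {}" "feynman B" "one_PI B" "B \<noteq> Graph {} {} {}"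
      "half A \<inter> half B = {}" "D = gunion A B" using AB by simp_all
    note s = one_PI_split[OF *(1-7), folded *(8), unfolded LFG_1PI_def]
    show ?thesis
      using s * by (intro bexI[of _ A] bexI[of _ B] conjI ballI) auto
  qed
qed

theorem theorem2:
  shows "(\<forall>M \<in> Iso (LRF :: ('s::infinite forest, 's cut) hall_cat).
            finite_dim (H_quot LRF M) \<and> lie_representation LRF (H_quot LRF M))
       \<and> (\<forall>M \<in> Iso (LFG_1PI :: ('s graph, 's graph) hall_cat).
            finite_dim (H_quot LFG_1PI M) \<and> lie_representation LFG_1PI (H_quot LFG_1PI M))
       \<and> (\<forall>M \<in> Iso (LFG :: ('s graph, 's graph) hall_cat).
            finite_dim (H_quot LFG M) \<and> acts_on LFG (H_quot LFG M))"
proof -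
  interpret LRF: hall_lie_category "LRF :: ('s forest, 's cut) hall_cat" "\<lambda>F. card (fverts F)"
    by (rule hall_LRF)
  interpret PI: hall_lie_category "LFG_1PI :: ('s graph, 's graph) hall_cat" "\<lambda>G. card (half G)"
    by (rule hall_LFG_1PI)
  \<comment> \<open>Without one-particle irreducibility only the weaker setting is available, which
    yields the invariance and the linear action.\<close>
  interpret LFG: hall_category "LFG :: ('s graph, 's graph) hall_cat"
    by (rule hall_LFG)
  show ?thesis
    using LRF.finite_dim_H_quot LRF.lie_representation_H_quot PI.finite_dim_H_quot
      PI.lie_representation_H_quot LFG.finite_dim_H_quot LFG.acts_on_H_quot by blast
qed

end
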